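(* Fix $k\in[0,1)$ and let $h:\mathbb{H}\to\mathbb{C}$ be a holomorphic function. Suppose there exist a closed hyperbolic disk $D\subset\mathbb{H}$ of radius $\frac12\log\frac{1+k}{1-k}$ and a holomorphic function $f:\mathbb{H}\to\mathbb{C}$ such that the following two statements hold: (A) $f(z)/f'(z)-z\in D$ for all $z\in\mathbb{H}$, and (B) $\big(h'(z)f(z)\big)^{-1}-z\in D$ for all $z\in\mathbb{H}$. Then $h$ is univalent in $\mathbb{H}$ and has a $k$-quasiconformal extension to $\overline{\mathbb{C}}$.
   Context: $\mathbb{H}:=\{z\in\mathbb{C}:\operatorname{Re} z>0\}$ and $\overline{\mathbb{C}}=\mathbb{C}\cup\{\infty\}$. The hyperbolic distance in $\mathbb{H}$ is normalized as $\mathrm{dist}(z_1,z_2)=\frac12\log\frac{1+\rho}{1-\rho}$, $\rho=\left|\frac{z_1-z_2}{z_1+\overline{z_2}}\right|$; thus a closed hyperbolic disk of radius $\frac12\log\frac{1+k}{1-k}$ centered at $c\in\mathbb{H}$ is $\{w\in\mathbb{H}:|w-c|\le k|w+\overline{c}|\}$. A $k$-quasiconformal map is an orientation-preserving homeomorphism $F$ with distributional derivatives $\partial_zF,\partial_{\bar z}F\in L^1_{\rm loc}$ satisfying $|\partial_{\bar z}F|\le k|\partial_zF|$ a.e. (in local coordinates on $\overline{\mathbb{C}}$). A function $h$ on $\mathbb{H}$ has a $k$-quasiconformal extension to $\overline{\mathbb{C}}$ if there is a $k$-quasiconformal homeomorphism $F:\overline{\mathbb{C}}\to\overline{\mathbb{C}}$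 with $F|_{\mathbb{H}}=h$ (not required to fix $\infty$). *)

theory Defs
  imports "HOL-Complex_Analysis.Complex_Analysis"
begin

definition right_half_plane :: "complex set" where
  "right_half_plane = {z. Re z > 0}"

definition hyp_dist :: "complex \<Rightarrow> complex \<Rightarrow> real" where
  "hyp_dist z w =
     (let \<rho> = cmod ((z - w) / (z + cnj w)) in 1/2 * ln ((1 + \<rho>) / (1 - \<rho>)))"

definition hyp_cball :: "complex \<Rightarrow> real \<Rightarrow> complex set" where
  "hyp_cball c r = {w \<in> right_half_plane. hyp_dist w c \<le> r}"

text \<open>Real partial derivatives in the directions \<open>1\<close> and \<open>\<i>\<close>, and the Wirtinger derivatives.\<close>

definition partial_x :: "(complex \<Rightarrow> complex) \<Rightarrow> complex \<Rightarrow> complex" where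
  "partial_x \<phi> z = frechet_derivative \<phi> (at z) 1"

definition partial_y :: "(complex \<Rightarrow> complex) \<Rightarrow> complex \<Rightarrow> complex" where
  "partial_y \<phi> z = frechet_derivative \<phi> (at z) \<i>"

definition wirtinger :: "(complex \<Rightarrow> complex) \<Rightarrow> complex \<Rightarrow> complex" where
  "wirtinger \<phi> z = (partial_x \<phi> z - \<i> * partial_y \<phi> z) / 2"

definition wirtinger_bar :: "(complex \<Rightarrow> complex) \<Rightarrow> complex \<Rightarrow> complex" where
  "wirtinger_bar \<phi> z = (partial_x \<phi> z + \<i> * partial_y \<phi> z) / 2"

text \<open>\<open>C_class n \<phi>\<close>: \<open>\<phi>\<close> is of class \<open>C\<^sup>n\<close> on the plane, in the real sense.\<close>

primrec C_class :: "nat \<Rightarrow> (complex \<Rightarrow> complex) \<Rightarrow> bool" where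
  "C_class 0 \<phi> \<longleftrightarrow> continuous_on UNIV \<phi>"
| "C_class (Suc n) \<phi> \<longleftrightarrow>
     (\<forall>z. \<phi> differentiable (at z)) \<and> C_class n (partial_x \<phi>) \<and> C_class n (partial_y \<phi>)"

definition test_function :: "complex set \<Rightarrow> (complex \<Rightarrow> complex) \<Rightarrow> bool" where
  "test_function U \<phi> \<longleftrightarrow>
     (\<forall>n. C_class n \<phi>) \<and> (\<exists>K. compact K \<and> K \<subseteq> U \<and> (\<forall>z. z \<notin> K \<longrightarrow> \<phi> z = 0))"

definition locally_integrable_on :: "complex set \<Rightarrow> (complex \<Rightarrow> complex) \<Rightarrow> bool" where
  "locally_integrable_on U p \<longleftrightarrow>
     (\<forall>K. compact K \<and> K \<subseteq> U \<longrightarrow> p absolutely_integrable_on K)"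

text \<open>\<open>p\<close> and \<open>q\<close> represent the distributional derivatives \<open>\<partial>\<^sub>z g\<close> and \<open>\<partial>\<^bsub>z-bar\<^esub> g\<close>
  of \<open>g\<close> on the open set \<open>U\<close>.\<close>

definition weak_wirtinger ::
  "complex set \<Rightarrow> (complex \<Rightarrow> complex) \<Rightarrow> (complex \<Rightarrow> complex) \<Rightarrow> bool" where
  "weak_wirtinger U g p \<longleftrightarrow>
     (\<forall>\<phi>. test_function U \<phi> \<longrightarrow>
        (LINT z:U|lebesgue. g z * wirtinger \<phi> z) = - (LINT z:U|lebesgue. p z * \<phi> z))"

definition weak_wirtinger_bar ::
  "complex set \<Rightarrow> (complex \<Rightarrow> complex) \<Rightarrow> (complex \<Rightarrow> complex) \<Rightarrow> bool" where
  "weak_wirtinger_bar U g q \<longleftrightarrow>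
     (\<forall>\<phi>. test_function U \<phi> \<longrightarrow>
        (LINT z:U|lebesgue. g z * wirtinger_bar \<phi> z) = - (LINT z:U|lebesgue. q z * \<phi> z))"

text \<open>For a homeomorphism between plane open sets, preserving orientation means that the image
  of every small positively oriented circle about \<open>a\<close> winds once, positively, around \<open>g a\<close>.\<close>

definition orientation_preserving_on :: "complex set \<Rightarrow> (complex \<Rightarrow> complex) \<Rightarrow> bool" where
  "orientation_preserving_on U g \<longleftrightarrow>
     (\<forall>a r. 0 < r \<and> cball a r \<subseteq> U \<longrightarrow> winding_number (g \<circ> circlepath a r) (g a) = 1)"

definition quasiconformal_on :: "real \<Rightarrow> complex set \<Rightarrow> (complex \<Rightarrow> complex) \<Rightarrow> bool" where
  "quasiconformal_on k U g \<longleftrightarrow>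
     open U \<and> open (g ` U) \<and> (\<exists>g'. homeomorphism U (g ` U) g g') \<and>
     orientation_preserving_on U g \<and>
     (\<exists>p q. locally_integrable_on U p \<and> locally_integrable_on U q \<and>
            weak_wirtinger U g p \<and> weak_wirtinger_bar U g q \<and>
            (AE z in lebesgue. z \<in> U \<longrightarrow> cmod (q z) \<le> k * cmod (p z)))"

text \<open>The Riemann sphere is the one-point compactification of the plane; \<open>None\<close> is the point at
  infinity and \<open>Some z\<close> the finite point \<open>z\<close>.\<close>

definition riemann_sphere :: "complex option topology" where
  "riemann_sphere = Alexandroff_compactification euclidean"

text \<open>The inversion \<open>z \<mapsto> 1/z\<close> of the sphere.\<close>

definition sphere_inv :: "complex option \<Rightarrow> complex option" where
  "sphere_inv w =
     (case w of None \<Rightarrow> Some 0 | Some z \<Rightarrow> if z = 0 then None else Some (1 / z))"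

text \<open>The sphere carries the two charts \<open>z\<close> and \<open>1/z\<close>. The coordinate representations of \<open>F\<close>
  with respect to them are the restrictions of \<open>\<alpha> \<circ> F \<circ> \<beta>\<close>, for \<open>\<alpha>, \<beta>\<close> the identity or the
  inversion, to those finite points that are mapped to finite points.\<close>

definition quasiconformal_sphere ::
  "real \<Rightarrow> (complex option \<Rightarrow> complex option) \<Rightarrow> bool" where
  "quasiconformal_sphere k F \<longleftrightarrow>
     homeomorphic_map riemann_sphere riemann_sphere F \<and>
     (\<forall>\<alpha> \<in> {id, sphere_inv}. \<forall>\<beta> \<in> {id, sphere_inv}.
        quasiconformal_on k {z. (\<alpha> \<circ> F \<circ> \<beta>) (Some z) \<noteq> None}
          (\<lambda>z. the ((\<alpha> \<circ> F \<circ> \<beta>) (Some z))))"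

definition has_quasiconformal_extension :: "real \<Rightarrow> (complex \<Rightarrow> complex) \<Rightarrow> bool" where
  "has_quasiconformal_extension k h \<longleftrightarrow>
     (\<exists>F. quasiconformal_sphere k F \<and> (\<forall>z \<in> right_half_plane. F (Some z) = Some (h z)))"

end

theory Submission
  imports Defs
begin

text \<open>The extension is explicit. Put \<open>\<kappa> = 2 Re c\<close> and substitute \<open>z + c = \<kappa> / \<eta>\<close>. This maps the half-plane onto
the disc \<open>\<bar>\<eta> - 1\<bar> < 1\<close>, and infinity becomes its boundary point \<open>0\<close>. Write \<open>H(\<eta>) = h(z)\<close> and
\<open>g(\<eta>) = 1 / f(z) = \<eta> \<gamma>(\<eta>)\<close> with \<open>\<gamma> = exp l\<close>. Conditions (A) and (B) then say \<open>g' = \<gamma> v\<close> and \<open>H' = - \<gamma> w\<close>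
for functions \<open>v\<close>, \<open>w\<close> with values in the closed disc \<open>speed_disc k \<eta>\<close>. All these discs lie in a
compact set avoiding \<open>0\<close>, so \<open>l\<close> and \<open>H\<close> have bounded derivatives and extend continuously to the closed
disc.

The functions \<open>H - (s - 1) g\<close>, \<open>s \<ge> 1\<close>, form a Loewner chain: their derivative is \<open>- s \<gamma>\<close> times the convex
combination \<open>w / s + (1 - 1 / s) v\<close>, which lies again in the disc. Following the boundary circle along
this chain extends \<open>H\<close>: the point \<open>s \<eta>\<close> with \<open>\<bar>\<eta> - 1\<bar> = 1\<close> goes to \<open>H(\<eta>) - (s - 1) g(\<eta>)\<close>. These points fill
the right half-plane outside the disc. As \<open>\<xi> = s \<eta>\<close> approaches the imaginary axis away from \<open>0\<close>, \<open>s\<close> tends to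
infinity and \<open>\<eta>\<close> to \<open>0\<close>; the left half-plane receives the affine map \<open>H(0) - \<xi> \<gamma>(0)\<close>. All three pieces are
\<open>G(\<xi>) = H(\<pi> \<xi>) - (\<xi> - \<pi> \<xi>) \<gamma>(\<pi> \<xi>)\<close> for a retraction \<open>\<pi>\<close> of the plane onto the closed disc, and
\<open>w \<mapsto> G(\<kappa> / (w + c))\<close> is the extension of \<open>h\<close> to the sphere.

The dilatation is at most \<open>k\<close> for the following reason. Up to the factor \<open>- \<gamma>(\<eta>)\<close>, the differential of
\<open>G\<close> at \<open>s \<eta>\<close> fixes the radial direction and multiplies the tangent of the circle by a point \<open>v\<close> of the
disc; and \<open>speed_disc k \<eta>\<close> is precisely the set of those \<open>v\<close> for which such a real-linear map has
dilatation at most \<open>k\<close> (\<open>G_derivative_outer\<close>).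

Injectivity is a local matter. By convexity of the discs, difference quotients of \<open>H\<close> and \<open>g\<close> stay near
them, up to the boundary (\<open>derivative_disc_mean_value\<close>), and this makes \<open>G\<close> injective near every point
other than \<open>0\<close>. As \<open>G\<close> is proper, the set of values different from \<open>G(0)\<close> that are taken twice is open and
closed in the punctured plane. It misses one value far away, so it is empty
(\<open>proper_locally_injective_imp_injective\<close>).

The boundary values of \<open>H\<close> and \<open>g\<close> are only Lipschitz. Lebesgue's differentiation theorem on the line
gives the differential of \<open>G\<close> almost everywhere, and for a locally Lipschitz map the pointwise
derivatives are the distributional ones (\<open>weak_wirtinger_of_AE_differentiable\<close>). All of this is invariant
under the changes of chart.\<close>

section \<open>Differentiability almost everywhere of Lipschitz functions of a real variable\<close>

text \<open>Vitali's covering theorem for balls, read with midpoints as centres and half lengths as radii. The open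
set \<open>G\<close> confines the intervals.\<close>
lemma Vitali_covering_intervals:
  fixes E G :: "real set" and P :: "real \<Rightarrow> real \<Rightarrow> bool"
  assumes "open G" "E \<subseteq> G"
    and fine: "\<And>x d. x \<in> E \<Longrightarrow> 0 < d \<Longrightarrow> \<exists>u v. u < x \<and> x < v \<and> v - u < d \<and> P u v"
  obtains C where "countable C" "disjoint_family_on (\<lambda>(u,v). {u<..<v}) C"
    "\<And>u v. (u,v) \<in> C \<Longrightarrow> u < v \<and> P u v \<and> {u..v} \<subseteq> G"
    "negligible (E - (\<Union>(u,v)\<in>C. {u<..<v}))"
proof -
  define K where "K = {(u,v). u < v \<and> P u v \<and> {u..v} \<subseteq> G}"
  define a where "a = (\<lambda>(u,v). (u+v)/2 :: real)"
  define r where "r = (\<lambda>(u,v). (v-u)/2 :: real)"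
  have ball: "ball (a i) (r i) = (case i of (u,v) \<Rightarrow> {u<..<v})" if "i \<in> K" for i
    using that by (auto simp: a_def r_def K_def ball_eq_greaterThanLessThan field_simps)
  have "\<exists>i. i \<in> K \<and> x \<in> ball (a i) (r i) \<and> r i < d" if x: "x \<in> E" and d: "0 < d" for x d
  proof -
    obtain e where e: "e > 0" "cball x e \<subseteq> G" using assms x by (metis open_contains_cball subsetD)
    obtain u v where uv: "u < x" "x < v" "v - u < min d e" "P u v" using fine[OF x, of "min d e"] d e by auto
    have "{u..v} \<subseteq> cball x e" using uv by (auto simp: dist_real_def)
    then have K: "(u,v) \<in> K" using uv e by (auto simp: K_def)
    have "x \<in> ball (a (u,v)) (r (u,v))" unfolding ball[OF K] using uv by simp
    then show ?thesis using uv K by (intro exI[of _ "(u,v)"]) (auto simp: r_def)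
  qed
  then obtain C where C: "countable C" "C \<subseteq> K"
     "pairwise (\<lambda>i j. disjnt (ball (a i) (r i)) (ball (a j) (r j))) C"
     "negligible(E - (\<Union>i \<in> C. ball (a i) (r i)))"
    by (rule Vitali_covering_theorem_balls)
  show thesis
  proof (rule that[of C])
    show "countable C" by fact
    show "disjoint_family_on (\<lambda>(u,v). {u<..<v}) C"
      unfolding disjoint_family_on_def
    proof (intro ballI impI)
      fix i j assume ij: "i \<in> C" "j \<in> C" "i \<noteq> j"
      then have "disjnt (ball (a i) (r i)) (ball (a j) (r j))" using C(3) by (auto simp: pairwise_def)
      then show "(case i of (u,v) \<Rightarrow> {u<..<v}) \<inter> (case j of (u,v) \<Rightarrow> {u<..<v}) = {}"
        using ball ij C(2) by (auto simp: disjnt_def)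
    qed
    show "u < v \<and> P u v \<and> {u..v} \<subseteq> G" if "(u,v) \<in> C" for u v
      using that C(2) by (auto simp: K_def)
    have "(\<Union>i \<in> C. ball (a i) (r i)) = (\<Union>(u,v)\<in>C. {u<..<v})"
      using ball C(2) by (intro SUP_cong) auto
    then show "negligible (E - (\<Union>(u,v)\<in>C. {u<..<v}))" using C(4) by simp
  qed
qed

lemma emeasure_interval_measure_Ioo:
  fixes g :: "real \<Rightarrow> real"
  assumes mono: "\<And>x y. x \<le> y \<Longrightarrow> g x \<le> g y" and cont: "continuous_on UNIV g" and "u \<le> v"
  shows "emeasure (interval_measure g) {u<..<v} = ennreal (g v - g u)"
proof -
  have "isCont g v" using cont by (simp add: continuous_on_eq_continuous_at)
  then have "emeasure (interval_measure g) {v} = 0"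
  proof -
    have c: "\<And>a. continuous (at_right a) g"
      using cont by (simp add: continuous_on_eq_continuous_at continuous_at_imp_continuous_at_within)
    have "emeasure (interval_measure g) {v} \<le> ennreal e" if e: "e > 0" for e
    proof -
      obtain d where d: "d > 0" "\<And>y. dist y v < d \<Longrightarrow> dist (g y) (g v) < e"
        using \<open>isCont g v\<close> e unfolding continuous_at_eps_delta by blast
      have "emeasure (interval_measure g) {v} \<le> emeasure (interval_measure g) {v - d/2 <.. v}"
        using d by (intro emeasure_mono) auto
      also have "\<dots> = ennreal (g v - g (v - d/2))"
        using d mono c by (intro emeasure_interval_measure_Ioc) auto
      also have "\<dots> \<le> ennreal e" using d(2)[of "v - d/2"] d(1) 
        by (intro ennreal_leI) (auto simp: dist_real_def)
      finally show ?thesis .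
    qed
    then show ?thesis by (metis ennreal_le_epsilon add_0 le_zero_eq not_gr_zero)
  qed
  have c: "\<And>a. continuous (at_right a) g"
    using cont by (simp add: continuous_on_eq_continuous_at continuous_at_imp_continuous_at_within)
  show ?thesis
  proof (cases "u = v")
    case False
    then have uv: "u < v" using assms by simp
    have "{u<..v} = {u<..<v} \<union> {v}" using uv by auto
    then have "emeasure (interval_measure g) {u<..v} = emeasure (interval_measure g) {u<..<v} + emeasure (interval_measure g) {v}"
      by (simp add: plus_emeasure)
    then show ?thesis using \<open>emeasure (interval_measure g) {v} = 0\<close> emeasure_interval_measure_Ioc[of u v g] mono c uv by auto
  qed auto
qed

text \<open>The points where the upper two-sided derivate is at least \<open>q\<close>, up to the boundary case of equality.
Requiring \<open>u < x < v\<close> strictly makes the set a countable intersection of open sets.\<close>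
definition steep_at :: "(real \<Rightarrow> real) \<Rightarrow> real \<Rightarrow> real set" where
  "steep_at g q = {x. \<forall>d>0. \<exists>u v. u < x \<and> x < v \<and> v - u < d \<and> g v - g u > q * (v - u)}"

lemma borel_steep_at: "steep_at g q \<in> sets borel"
proof -
  have "steep_at g q = (\<Inter>n. \<Union>u. \<Union>v\<in>{v. v - u < 1 / Suc n \<and> g v - g u > q * (v - u)}. {u<..<v})" (is "_ = ?R")
  proof
    show "steep_at g q \<subseteq> ?R"
    proof
      fix x assume x: "x \<in> steep_at g q"
      have "\<exists>u v. u < x \<and> x < v \<and> v - u < 1 / Suc n \<and> g v - g u > q * (v - u)" for n
        using x by (simp add: steep_at_def)
      then show "x \<in> ?R" by (auto simp: Bex_def) blast
    qed
    show "?R \<subseteq> steep_at g q"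
    proof
      fix x assume x: "x \<in> ?R"
      have "\<exists>u v. u < x \<and> x < v \<and> v - u < d \<and> g v - g u > q * (v - u)" if d: "d > 0" for d
      proof -
        obtain n where n: "1 / Suc n < d" using d by (metis nat_approx_posE)
        from x have "x \<in> (\<Union>u. \<Union>v\<in>{v. v - u < 1 / Suc n \<and> g v - g u > q * (v - u)}. {u<..<v})" by blast
        then obtain u v where "v - u < 1 / Suc n" "g v - g u > q * (v - u)" "u < x" "x < v" by auto
        then show ?thesis using n by (intro exI[of _ u] exI[of _ v]) auto
      qed
      then show "x \<in> steep_at g q" by (simp add: steep_at_def)
    qed
  qed
  moreover have "open (\<Union>u. \<Union>v\<in>{v. v - u < 1 / Suc n \<and> g v - g u > q * (v - u)}. {u<..<v})" for n
    by (intro open_UN ballI) auto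
  ultimately show ?thesis by (simp only:) (intro sets.countable_INT'' borel_open; simp)
qed

text \<open>The two-covering argument for Lebesgue's theorem. Let \<open>\<nu>\<close> be the Stieltjes measure of \<open>g\<close> and \<open>m\<close> the
measure of a bounded piece of the set. A covering by intervals of slope less than \<open>p\<close> gives an open \<open>V\<close>
with \<open>\<nu>(V) \<le> p (m + e)\<close>; inside \<open>V\<close>, a covering by intervals of slope more than \<open>q\<close> gives \<open>\<nu>(V) \<ge> q m\<close>. As \<open>p < q\<close>
this forces \<open>m = 0\<close>.\<close>
lemma negligible_steep_and_flat:
  fixes g :: "real \<Rightarrow> real"
  assumes mono: "\<And>x y. x \<le> y \<Longrightarrow> g x \<le> g y" and cont: "continuous_on UNIV g"
    and pq: "0 < p" "p < q"
  shows "negligible (steep_at g q \<inter> steep_at (\<lambda>x. - g x) (- p))"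
proof -
  define \<nu> where "\<nu> = interval_measure g"
  have \<nu>I: "emeasure \<nu> {u<..<v} = ennreal (g v - g u)" if "u \<le> v" for u v
    unfolding \<nu>_def using emeasure_interval_measure_Ioo[OF mono cont that] by simp
  have sets\<nu>[simp]: "sets \<nu> = sets borel" by (simp add: \<nu>_def)
  \<comment> \<open>The set is cut down to balls so that its measure is finite.\<close>
  define E0 where "E0 = steep_at g q \<inter> steep_at (\<lambda>x. - g x) (- p)"
  have "negligible (E0 \<inter> ball 0 R)" for R
  proof -
    define E where "E = E0 \<inter> ball 0 R"
    have Eb[measurable]: "E \<in> sets borel" unfolding E_def E0_def by (intro sets.Int borel_steep_at) auto
    have Elm: "E \<in> lmeasurable" 
    proof (rule bounded_set_imp_lmeasurable)
      show "bounded E" by (rule bounded_subset[OF bounded_ball[of 0 R]]) (simp add: E_def)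
      show "E \<in> sets lebesgue" using Eb by simp
    qed
    define m where "m = measure lebesgue E"
    have m: "emeasure lborel E = ennreal m"
    proof -
      have "emeasure lborel E = emeasure lebesgue E" by simp
      also have "\<dots> = ennreal m" using emeasure_eq_measure2[OF Elm] by (simp add: m_def)
      finally show ?thesis .
    qed
    have sumU: "emeasure \<mu> (\<Union>(u,v)\<in>C. {u<..<v}) = (\<integral>\<^sup>+i. emeasure \<mu> (case i of (u,v) \<Rightarrow> {u<..<v}) \<partial>count_space C)"
      if "countable C" "disjoint_family_on (\<lambda>(u,v). {u<..<v}) C" "sets \<mu> = sets borel" for C and \<mu> :: "real measure"
      using that by (intro emeasure_UN_countable) (auto simp: case_prod_unfold)
    have key: "ennreal (q * m) \<le> ennreal (p * (m + e))" if e: "e > 0" for e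
    proof -
      obtain G where G: "open G" "E \<subseteq> G" "G - E \<in> lmeasurable" "emeasure lebesgue (G - E) < ennreal e"
        using sets_lebesgue_outer_open[OF _ e, of E] Elm by blast
      have mG: "emeasure lborel G \<le> ennreal (m + e)"
      proof -
        have "emeasure lborel G = emeasure lborel E + emeasure lborel (G - E)"
          using G(1,2) by (subst plus_emeasure) (auto intro!: arg_cong[where f="emeasure lborel"])
        also have "\<dots> \<le> ennreal m + ennreal e"
          using G(1,4) by (intro add_mono) (auto simp: m)
        finally show ?thesis using e by (simp add: m_def)
      qed
      obtain C where C: "countable C" "disjoint_family_on (\<lambda>(u,v). {u<..<v}) C"
        "\<And>u v. (u,v) \<in> C \<Longrightarrow> u < v \<and> - g v - - g u > - p * (v - u) \<and> {u..v} \<subseteq> G"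
        "negligible (E - (\<Union>(u,v)\<in>C. {u<..<v}))"
        by (rule Vitali_covering_intervals[OF G(1,2), where P="\<lambda>u v. - g v - - g u > - p * (v - u)"])
           (auto simp: E_def E0_def steep_at_def)
      define V where "V = (\<Union>(u,v)\<in>C. {u<..<v})"
      have V: "open V" "V \<subseteq> G" unfolding V_def using C(3) by (auto simp: case_prod_unfold) force
      have "emeasure \<nu> V = (\<integral>\<^sup>+i. emeasure \<nu> (case i of (u,v) \<Rightarrow> {u<..<v}) \<partial>count_space C)"
        unfolding V_def by (rule sumU) (use C in auto)
      also have "\<dots> \<le> (\<integral>\<^sup>+i. ennreal p * emeasure lborel (case i of (u,v) \<Rightarrow> {u<..<v}) \<partial>count_space C)"
      proof (rule nn_integral_mono)
        fix i assume i: "i \<in> space (count_space C)"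
        obtain u v where uv: "i = (u,v)" by fastforce
        then have *: "u < v" "g v - g u \<le> p * (v - u)" using C(3)[of u v] i by auto
        then show "emeasure \<nu> (case i of (u,v) \<Rightarrow> {u<..<v}) \<le> ennreal p * emeasure lborel (case i of (u,v) \<Rightarrow> {u<..<v})"
          using uv pq by (simp add: \<nu>I ennreal_mult[symmetric] ennreal_leI)
      qed
      also have "\<dots> = ennreal p * emeasure lborel V"
        unfolding V_def by (subst sumU) (use C in \<open>auto simp: nn_integral_cmult\<close>)
      also have "\<dots> \<le> ennreal p * emeasure lborel G"
        using V G by (intro mult_left_mono emeasure_mono) auto
      also have "\<dots> \<le> ennreal p * ennreal (m + e)" using mG by (intro mult_left_mono) auto
      also have "\<dots> = ennreal (p * (m + e))" using pq e by (simp add: ennreal_mult m_def)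
      finally have up: "emeasure \<nu> V \<le> ennreal (p * (m + e))" .
      obtain C' where C': "countable C'" "disjoint_family_on (\<lambda>(u,v). {u<..<v}) C'"
        "\<And>u v. (u,v) \<in> C' \<Longrightarrow> u < v \<and> g v - g u > q * (v - u) \<and> {u..v} \<subseteq> V"
        "negligible (E \<inter> V - (\<Union>(u,v)\<in>C'. {u<..<v}))"
        by (rule Vitali_covering_intervals[of V "E \<inter> V" "\<lambda>u v. g v - g u > q * (v - u)"])
           (use V in \<open>auto simp: E_def E0_def steep_at_def\<close>)
      define V' where "V' = (\<Union>(u,v)\<in>C'. {u<..<v})"
      have V': "open V'" "V' \<subseteq> V" unfolding V'_def using C'(3) by (auto simp: case_prod_unfold) force
      have "negligible (E - V')"
        by (rule negligible_subset[OF negligible_Un[OF C(4) C'(4)]]) (auto simp: V_def V'_def)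
      then have n0: "E - V' \<in> null_sets lborel"
        using V' by (simp add: negligible_iff_null_sets null_sets_completion_iff)
      have "ennreal m = emeasure lborel E" by (simp add: m)
      also have "\<dots> \<le> emeasure lborel (V' \<union> (E - V'))" using V' by (intro emeasure_mono) auto
      also have "\<dots> = emeasure lborel V'" using n0 V' by (intro emeasure_Un_null_set) auto
      finally have "ennreal q * ennreal m \<le> ennreal q * emeasure lborel V'" by (intro mult_left_mono) auto
      also have "\<dots> = (\<integral>\<^sup>+i. ennreal q * emeasure lborel (case i of (u,v) \<Rightarrow> {u<..<v}) \<partial>count_space C')"
        unfolding V'_def by (subst sumU) (use C' in \<open>auto simp: nn_integral_cmult\<close>)
      also have "\<dots> \<le> (\<integral>\<^sup>+i. emeasure \<nu> (case i of (u,v) \<Rightarrow> {u<..<v}) \<partial>count_space C')"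
      proof (rule nn_integral_mono)
        fix i assume i: "i \<in> space (count_space C')"
        obtain u v where uv: "i = (u,v)" by fastforce
        then have *: "u < v" "q * (v - u) \<le> g v - g u" using C'(3)[of u v] i by auto
        then show "ennreal q * emeasure lborel (case i of (u,v) \<Rightarrow> {u<..<v}) \<le> emeasure \<nu> (case i of (u,v) \<Rightarrow> {u<..<v})"
          using uv pq by (simp add: \<nu>I ennreal_mult[symmetric] ennreal_leI)
      qed
      also have "\<dots> = emeasure \<nu> V'"
        unfolding V'_def by (rule sumU[symmetric]) (use C' in auto)
      also have "\<dots> \<le> emeasure \<nu> V" using V V' by (intro emeasure_mono) auto
      finally show ?thesis using up pq by (simp add: ennreal_mult[symmetric] m_def)
    qed
    have "q * m \<le> p * m"
    proof (rule field_le_epsilon)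
      fix e :: real assume e: "e > 0"
      have "0 \<le> m" by (simp add: m_def)
      have "ennreal (q * m) \<le> ennreal (p * (m + e / p))" using e pq by (intro key) auto
      then have "q * m \<le> p * (m + e / p)" using e pq \<open>0 \<le> m\<close> by (subst (asm) ennreal_le_iff) auto
      moreover have "p * (m + e / p) = p * m + e" using pq by (simp add: distrib_left)
      ultimately show "q * m \<le> p * m + e" by simp
    qed
    then have "m = 0" using pq by (smt (verit) m_def measure_nonneg mult_le_cancel_right)
    then have "emeasure lebesgue E = 0" using m by simp
    then show "negligible (E0 \<inter> ball 0 R)" using Elm unfolding E_def[symmetric]
      by (auto simp: negligible_iff_null_sets null_sets_def)
  qed
  then have "negligible (\<Union>n::nat. E0 \<inter> ball 0 (real n))" by (intro negligible_countable_Union) auto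
  moreover have "E0 \<subseteq> (\<Union>n::nat. E0 \<inter> ball 0 (real n))"
    using reals_Archimedean2 by fastforce
  ultimately show ?thesis unfolding E0_def by (rule negligible_subset)
qed

text \<open>The derivative is the supremum of the steepnesses at \<open>x\<close>. Rational numbers around it bound the
slopes of small intervals around \<open>x\<close> from both sides, and continuity moves one endpoint to \<open>x\<close>.\<close>
lemma differentiable_if_not_steep_and_flat:
  fixes f :: "real \<Rightarrow> real"
  assumes slope: "\<And>u v. u < v \<Longrightarrow> v - u \<le> f v - f u" "\<And>u v. u < v \<Longrightarrow> f v - f u \<le> B * (v - u)"
    and x: "\<And>p q. p \<in> \<rat> \<Longrightarrow> q \<in> \<rat> \<Longrightarrow> 0 < p \<Longrightarrow> p < q \<Longrightarrow> x \<notin> steep_at f q \<inter> steep_at (\<lambda>x. - f x) (- p)"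
  shows "f differentiable (at x)"
proof -
  define S where "S = {q. x \<in> steep_at f q}"
  have half: "1/2 \<in> S"
    unfolding S_def steep_at_def
  proof (clarify)
    fix d :: real assume d: "d > 0"
    have "1 / 2 * ((x + d/3) - (x - d/3)) < (x + d/3) - (x - d/3)" using d by simp
    also have "\<dots> \<le> f (x + d/3) - f (x - d/3)" using d by (intro slope(1)) auto
    finally show "\<exists>u v. u < x \<and> x < v \<and> v - u < d \<and> 1 / 2 * (v - u) < f v - f u"
      using d by (intro exI[of _ "x - d/3"] exI[of _ "x + d/3"]) auto
  qed
  have bdd: "q \<le> B" if "q \<in> S" for q
  proof -
    have "\<exists>u v. u < x \<and> x < v \<and> v - u < 1 \<and> q * (v - u) < f v - f u"
      using that unfolding S_def steep_at_def by (auto dest: spec[of _ 1])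
    then obtain u v where "u < x" "x < v" "q * (v - u) < f v - f u" by auto
    then have "q * (v - u) < B * (v - u)" by (blast intro: less_le_trans slope(2) less_trans)
    moreover have "0 < v - u" using \<open>u < x\<close> \<open>x < v\<close> by simp
    ultimately show ?thesis by (metis mult_less_cancel_right_pos less_imp_le)
  qed
  have down: "q' \<in> S" if "q \<in> S" "q' \<le> q" for q q'
  proof -
    have "\<exists>u v. u < x \<and> x < v \<and> v - u < d \<and> q' * (v - u) < f v - f u"
      if d: "d > 0" for d
    proof -
      obtain u v where uv: "u < x" "x < v" "v - u < d" "q * (v - u) < f v - f u"
        using \<open>q \<in> S\<close> d unfolding S_def steep_at_def by blast
      moreover have "q' * (v - u) \<le> q * (v - u)" using uv \<open>q' \<le> q\<close> by (intro mult_right_mono) auto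
      ultimately have "q' * (v - u) < f v - f u" by (simp only: le_less_trans)
      then show ?thesis using uv by blast
    qed
    then show ?thesis by (auto simp: S_def steep_at_def)
  qed
  define L where "L = Sup S"
  have bS: "bdd_above S" using bdd by (auto simp: bdd_above_def)
  have L: "1/2 \<le> L" unfolding L_def using half bS by (rule cSup_upper)
  have less_L: "q \<in> S" if q: "q < L" for q
  proof -
    have "S \<noteq> {}" using half by auto
    then obtain s where "s \<in> S" "q < s" using q bS unfolding L_def by (meson less_cSup_iff)
    then show ?thesis using down by auto
  qed
  have two: "\<exists>d>0. \<forall>u v. u < x \<and> x < v \<and> v - u < d \<longrightarrow> \<bar>f v - f u - L * (v - u)\<bar> \<le> e * (v - u)"
    if e: "e > 0" for e
  proof -
    have "L + e \<notin> S" using cSup_upper[OF _ bS, of "L + e"] e by (auto simp: L_def)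
    then have "\<exists>d1>0. \<forall>u v. u < x \<longrightarrow> x < v \<longrightarrow> v - u < d1 \<longrightarrow> f v - f u \<le> (L + e) * (v - u)"
      unfolding S_def steep_at_def by (simp add: not_less) (meson not_le)
    then obtain d1 where d1: "d1 > 0" "\<And>u v. u < x \<Longrightarrow> x < v \<Longrightarrow> v - u < d1 \<Longrightarrow> f v - f u \<le> (L + e) * (v - u)"
      by blast
    obtain p where p: "p \<in> \<rat>" "max (L - e) 0 < p" "p < L" using Rats_dense_in_real[of "max (L - e) 0" L] L e by auto
    obtain q where q: "q \<in> \<rat>" "p < q" "q < L" using Rats_dense_in_real[of p L] p by auto
    have "x \<notin> steep_at (\<lambda>x. - f x) (- p)" using x[of p q] p q less_L[of q] by (auto simp: S_def)
    then have "\<exists>d2>0. \<forall>u v. u < x \<longrightarrow> x < v \<longrightarrow> v - u < d2 \<longrightarrow> - f v - - f u \<le> - p * (v - u)"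
      unfolding steep_at_def by (simp add: not_less) (meson not_le)
    then obtain d2 where d2: "d2 > 0" "\<And>u v. u < x \<Longrightarrow> x < v \<Longrightarrow> v - u < d2 \<Longrightarrow> p * (v - u) \<le> f v - f u"
    proof (elim exE conjE)
      fix d assume d: "0 < d" "\<forall>u v. u < x \<longrightarrow> x < v \<longrightarrow> v - u < d \<longrightarrow> - f v - - f u \<le> - p * (v - u)"
      have "p * (v - u) \<le> f v - f u" if "u < x" "x < v" "v - u < d" for u v
        using d(2)[rule_format, OF that] by (simp only: mult_minus_left)
      with d(1) show thesis by (rule that)
    qed
    show ?thesis
    proof (intro exI[of _ "min d1 d2"] conjI allI impI)
      fix u v assume uv: "u < x \<and> x < v \<and> v - u < min d1 d2"
      have "(L - e) * (v - u) \<le> p * (v - u)" using uv p by (intro mult_right_mono) auto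
      then show "\<bar>f v - f u - L * (v - u)\<bar> \<le> e * (v - u)"
        using d1(2)[of u v] d2(2)[of u v] uv by (auto simp: abs_le_iff algebra_simps)
    qed (use d1 d2 in auto)
  qed
  have contf: "continuous_on UNIV f"
  proof (rule lipschitz_on_continuous_on)
    show "(max 0 B)-lipschitz_on UNIV f"
    proof (rule lipschitz_on_leI)
      fix u v :: real assume "u \<le> v"
      show "dist (f u) (f v) \<le> max 0 B * dist u v"
      proof (cases "u = v")
        case False
        then have uv: "u < v" using \<open>u \<le> v\<close> by simp
        have "B * (v - u) \<le> max 0 B * (v - u)" using uv by (intro mult_right_mono) auto
        then have "f v - f u \<le> max 0 B * (v - u)" using slope(2)[OF uv] by (rule order_trans[rotated])
        then show ?thesis using slope(1)[OF uv] uv by (auto simp: dist_real_def)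
      qed auto
    qed auto
  qed
  have one: "\<exists>d>0. \<forall>y. norm (y - x) < d \<longrightarrow> norm (f y - f x - L * (y - x)) \<le> e * norm (y - x)" if e: "e > 0" for e
  proof -
    obtain d where d: "d > 0" "\<And>u v. u < x \<Longrightarrow> x < v \<Longrightarrow> v - u < d \<Longrightarrow> \<bar>f v - f u - L * (v - u)\<bar> \<le> e * (v - u)"
      using two[OF e] by blast
    have "\<bar>f y - f x - L * (y - x)\<bar> \<le> e * \<bar>y - x\<bar>" if y: "\<bar>y - x\<bar> < d" for y
    proof (cases y x rule: linorder_cases)
      case less
      have "((\<lambda>v. e * (v - y) - \<bar>f v - f y - L * (v - y)\<bar>) \<longlongrightarrow> e * (x - y) - \<bar>f x - f y - L * (x - y)\<bar>) (at_right x)"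
        using contf by (intro tendsto_intros) (auto simp: continuous_on_def intro: tendsto_within_subset)
      moreover have "eventually (\<lambda>v. v \<in> {x<..<y + d}) (at_right x)"
        using y less by (intro eventually_at_right_real) auto
      then have "eventually (\<lambda>v. 0 \<le> e * (v - y) - \<bar>f v - f y - L * (v - y)\<bar>) (at_right x)"
        by eventually_elim (use d(2)[of y] less in auto)
      ultimately have "0 \<le> e * (x - y) - \<bar>f x - f y - L * (x - y)\<bar>"
        by (rule tendsto_lowerbound) auto
      then show ?thesis using less by (auto simp: abs_if algebra_simps split: if_splits)
    next
      case greater
      have "((\<lambda>u. e * (y - u) - \<bar>f y - f u - L * (y - u)\<bar>) \<longlongrightarrow> e * (y - x) - \<bar>f y - f x - L * (y - x)\<bar>) (at_left x)"
        using contf by (intro tendsto_intros) (auto simp: continuous_on_def intro: tendsto_within_subset)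
      moreover have "eventually (\<lambda>u. u \<in> {y - d<..<x}) (at_left x)"
        using y greater by (intro eventually_at_left_real) auto
      then have "eventually (\<lambda>u. 0 \<le> e * (y - u) - \<bar>f y - f u - L * (y - u)\<bar>) (at_left x)"
        by eventually_elim (use d(2)[of _ y] greater in auto)
      ultimately have "0 \<le> e * (y - x) - \<bar>f y - f x - L * (y - x)\<bar>"
        by (rule tendsto_lowerbound) auto
      then show ?thesis using greater by auto
    qed auto
    then show ?thesis using d(1) by auto
  qed
  have "(f has_derivative (\<lambda>h. L * h)) (at x)"
    unfolding has_derivative_at_alt
    using one by (auto intro: bounded_linear_mult_right)
  then show ?thesis by (auto simp: differentiable_def)
qed

text \<open>Adding \<open>(M + 1) x\<close> turns a Lipschitz function into an increasing one with slopes at least \<open>1\<close>.\<close>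
lemma Lipschitz_differentiable_AE_real:
  fixes g :: "real \<Rightarrow> real"
  assumes "M-lipschitz_on UNIV g"
  shows "negligible {x. \<not> g differentiable (at x)}"
proof -
  define f where "f = (\<lambda>x. g x + (M + 1) * x)"
  have M: "\<bar>g v - g u\<bar> \<le> M * (v - u)" if "u < v" for u v
    using lipschitz_onD[OF assms, of v u] that by (auto simp: dist_real_def)
  have s1: "v - u \<le> f v - f u" if "u < v" for u v
    using M[OF that] by (auto simp: f_def algebra_simps abs_le_iff)
  have s2: "f v - f u \<le> (2 * M + 1) * (v - u)" if "u < v" for u v
    using M[OF that] by (auto simp: f_def algebra_simps abs_le_iff)
  have mono: "f u \<le> f v" if "u \<le> v" for u v using s1[of u v] that by (cases "u = v") auto
  have cont: "continuous_on UNIV f"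
    unfolding f_def using lipschitz_on_continuous_on[OF assms] by (intro continuous_intros)
  define Q where "Q = {(p,q). p \<in> \<rat> \<and> q \<in> \<rat> \<and> 0 < p \<and> p < (q::real)}"
  have cQ: "countable Q" by (rule countable_subset[of _ "\<rat> \<times> \<rat>"]) (auto simp: Q_def countable_rat)
  have "negligible (\<Union>(p,q)\<in>Q. steep_at f q \<inter> steep_at (\<lambda>x. - f x) (- p))"
    using negligible_steep_and_flat[OF mono cont] cQ
    by (intro negligible_countable_Union countable_image) (auto simp: Q_def)
  moreover have "{x. \<not> g differentiable (at x)} \<subseteq> (\<Union>(p,q)\<in>Q. steep_at f q \<inter> steep_at (\<lambda>x. - f x) (- p))"
  proof (rule ccontr)
    assume "\<not> ?thesis"
    then obtain x where x: "\<not> g differentiable (at x)" "x \<notin> (\<Union>(p,q)\<in>Q. steep_at f q \<inter> steep_at (\<lambda>x. - f x) (- p))" by blast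
    have "f differentiable (at x)"
      by (rule differentiable_if_not_steep_and_flat[OF s1 s2]) (use x(2) in \<open>auto simp: Q_def\<close>)
    then have "(\<lambda>x. f x - (M + 1) * x) differentiable (at x)"
      by (intro differentiable_diff differentiable_mult) auto
    then show False using x(1) by (simp add: f_def)
  qed
  ultimately show ?thesis by (rule negligible_subset)
qed

corollary Lipschitz_differentiable_AE:
  fixes g :: "real \<Rightarrow> complex"
  assumes "M-lipschitz_on UNIV g"
  shows "negligible {x. \<not> g differentiable (at x)}"
proof -
  have R: "M-lipschitz_on UNIV (\<lambda>x. Re (g x))" and I: "M-lipschitz_on UNIV (\<lambda>x. Im (g x))"
    using assms unfolding lipschitz_on_def dist_norm
    by (auto simp flip: minus_complex.sel intro: order_trans[OF abs_Re_le_cmod] order_trans[OF abs_Im_le_cmod])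
  have "{x. \<not> g differentiable (at x)} \<subseteq> {x. \<not> (\<lambda>x. Re (g x)) differentiable (at x)} \<union> {x. \<not> (\<lambda>x. Im (g x)) differentiable (at x)}"
  proof (clarsimp)
    fix x assume d: "(\<lambda>x. Re (g x)) differentiable (at x)" "(\<lambda>x. Im (g x)) differentiable (at x)" "\<not> g differentiable (at x)"
    have "(\<lambda>x. Re (g x) *\<^sub>R 1 + Im (g x) *\<^sub>R \<i>) differentiable (at x)"
      using d by (intro differentiable_add differentiable_scaleR) auto
    moreover have "(\<lambda>x. Re (g x) *\<^sub>R 1 + Im (g x) *\<^sub>R \<i>) = g"
      by (auto simp: fun_eq_iff complex_eq_iff)
    ultimately show False using d by simp
  qed
  then show ?thesis
    using negligible_subset negligible_Un Lipschitz_differentiable_AE_real[OF R] Lipschitz_differentiable_AE_real[OF I] by blast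
qed

lemma negligible_Im_vimage:
  assumes "negligible N"
  shows "negligible {z::complex. Im z \<in> N}"
proof -
  obtain N' where N': "N' \<in> null_sets lborel" "N \<subseteq> N'"
    using assms by (auto simp: negligible_iff_null_sets null_sets_completion_iff2)
  then have [measurable]: "N' \<in> sets borel" by auto
  have "emeasure (lborel \<Otimes>\<^sub>M lborel) ((UNIV::real set) \<times> N') = emeasure lborel (UNIV::real set) * emeasure lborel N'"
    by (rule lborel.emeasure_pair_measure_Times) auto
  also have "\<dots> = 0" using N' by (simp add: null_sets_def)
  finally have "(UNIV::real set) \<times> N' \<in> null_sets lborel"
    unfolding lborel_prod[symmetric] by (auto simp: null_sets_def)
  then have "negligible ((UNIV::real set) \<times> N')"
    by (simp add: negligible_iff_null_sets null_sets_completionI)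
  then have "negligible ((\<lambda>(x,y). Complex x y) ` ((UNIV::real set) \<times> N'))"
  proof (rule negligible_differentiable_image_negligible[rotated])
    have "(\<lambda>p. (fst p) *\<^sub>R 1 + snd p *\<^sub>R \<i>) differentiable_on UNIV \<times> N'"
      unfolding differentiable_on_def
      by (intro ballI differentiable_add differentiable_scaleR) 
         (auto intro!: bounded_linear_imp_differentiable bounded_linear_fst bounded_linear_snd)
    then show "(\<lambda>(x,y). Complex x y) differentiable_on UNIV \<times> N'"
      by (simp add: case_prod_unfold Complex_eq scaleR_conv_of_real mult.commute)
  qed auto
  then show ?thesis
    by (rule negligible_subset) (use N' in \<open>auto intro!: image_eqI[where x="(Re z, Im z)" for z]\<close>)
qed

section \<open>Weak derivatives of locally Lipschitz maps\<close>

definition locally_Lipschitz_on :: "complex set \<Rightarrow> (complex \<Rightarrow> complex) \<Rightarrow> bool" where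
  "locally_Lipschitz_on U g \<longleftrightarrow> (\<forall>z\<in>U. \<exists>r>0. \<exists>M. M-lipschitz_on (ball z r) g)"

lemma locally_Lipschitz_imp_continuous_on:
  assumes "locally_Lipschitz_on U g"
  shows "continuous_on U g"
proof -
  have "isCont g z" if z: "z \<in> U" for z
  proof -
    obtain r M where "r > 0" "M-lipschitz_on (ball z r) g" using assms z unfolding locally_Lipschitz_on_def by blast
    then have "continuous_on (ball z r) g" by (intro lipschitz_on_continuous_on)
    then show ?thesis using \<open>r > 0\<close> by (simp add: continuous_on_eq_continuous_at)
  qed
  then show ?thesis by (simp add: continuous_at_imp_continuous_on)
qed

lemma locally_Lipschitz_uniform_on_compact:
  assumes "locally_Lipschitz_on U g" "compact K" "K \<subseteq> U"
  obtains d M where "d > 0" "M \<ge> 0" "\<And>z w. z \<in> K \<Longrightarrow> dist w z < d \<Longrightarrow> dist (g w) (g z) \<le> M * dist w z"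
proof -
  obtain r M :: "complex \<Rightarrow> real" where rM: "\<And>z. z \<in> K \<Longrightarrow> r z > 0 \<and> (M z)-lipschitz_on (ball z (r z)) g"
    using assms unfolding locally_Lipschitz_on_def by (meson subsetD)
  have "K \<subseteq> (\<Union>z\<in>K. ball z (r z / 2))" using rM by force
  then obtain F where F: "F \<subseteq> K" "finite F" "K \<subseteq> (\<Union>z\<in>F. ball z (r z / 2))"
    using compactE_image[OF assms(2), of K "\<lambda>z. ball z (r z / 2)"] by auto
  define d where "d = Min (insert 1 ((\<lambda>z. r z / 2) ` F))"
  define B where "B = Max (insert 0 (M ` F))"
  show thesis
  proof (rule that)
    show "d > 0" unfolding d_def using F rM by (subst Min_gr_iff) auto
    show "B \<ge> 0" unfolding B_def using F by (intro Max_ge) auto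
    fix z w assume z: "z \<in> K" "dist w z < d"
    obtain x where x: "x \<in> F" "dist x z < r x / 2" using F(3) z by auto
    have "d \<le> r x / 2" unfolding d_def using F x by (intro Min_le) auto
    moreover have "dist x w \<le> dist x z + dist z w" by (rule dist_triangle)
    moreover have "0 < r x" using x F(1) rM by auto
    ultimately have "dist x w < r x" "dist x z < r x" using x(2) z(2) dist_commute[of w z] by linarith+
    then have "w \<in> ball x (r x)" "z \<in> ball x (r x)" by auto
    then have "dist (g w) (g z) \<le> M x * dist w z" using rM[of x] F(1) x by (auto simp: lipschitz_on_def)
    also have "\<dots> \<le> B * dist w z"
      unfolding B_def using F x by (intro mult_right_mono Max_ge) auto
    finally show "dist (g w) (g z) \<le> B * dist w z" .
  qed
qed

lemma integrable_bounded_compact_support: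
  fixes f :: "complex \<Rightarrow> complex"
  assumes "f \<in> borel_measurable borel" "compact K" "\<And>z. z \<notin> K \<Longrightarrow> f z = 0" "\<And>z. z \<in> K \<Longrightarrow> norm (f z) \<le> B"
  shows "integrable lborel f"
proof -
  have "integrable lborel (\<lambda>z. indicator K z *\<^sub>R f z)"
    using assms(1,4) emeasure_compact_finite[OF assms(2)] borel_compact[OF assms(2)]
    by (intro integrableI_bounded_set_indicator[where B=B]) auto
  also have "(\<lambda>z. indicator K z *\<^sub>R f z) = f" using assms by (auto simp: indicator_def fun_eq_iff)
  finally show ?thesis .
qed

text \<open>Quotients along \<open>- e / n\<close> are what translation invariance of the integral produces when a forward
quotient is moved off the test function.\<close>
definition left_quotient :: "(complex \<Rightarrow> complex) \<Rightarrow> complex \<Rightarrow> nat \<Rightarrow> complex \<Rightarrow> complex" where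
  "left_quotient g e n z = of_nat (Suc n) * (g z - g (z - e / of_nat (Suc n)))"

text \<open>A total Borel function that agrees with the derivative in direction \<open>e\<close> wherever that exists; taking
the limit pointwise avoids a choice on the exceptional null set.\<close>
definition left_derivative :: "(complex \<Rightarrow> complex) \<Rightarrow> complex \<Rightarrow> complex \<Rightarrow> complex" where
  "left_derivative g e z = lim (\<lambda>n. left_quotient g e n z)"

lemma tendsto_divide_Suc: "(\<lambda>n. e / of_nat (Suc n)) \<longlonglongrightarrow> (0::complex)"
  using tendsto_mult[OF tendsto_const[of e] LIMSEQ_Suc[OF lim_inverse_n[where 'a=complex]]]
  by (simp add: field_simps)

lemma has_derivative_quotient_limit:
  fixes g :: "complex \<Rightarrow> complex"
  assumes "(g has_derivative g') (at z)"
  shows "(\<lambda>n. of_nat (Suc n) * (g (z + e / of_nat (Suc n)) - g z)) \<longlonglongrightarrow> g' e"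
proof (cases "e = 0")
  case True
  then have "g' e = 0" using has_derivative_bounded_linear[OF assms] linear_simps(3) by blast
  then show ?thesis using True by simp
next
  case False
  interpret g': bounded_linear g' using assms by (rule has_derivative_bounded_linear)
  have fl: "filterlim (\<lambda>n. z + e / of_nat (Suc n)) (at z) sequentially"
    unfolding filterlim_at using tendsto_add[OF tendsto_const tendsto_divide_Suc, of z e] False
    by (auto simp del: of_nat_Suc)
  have "((\<lambda>y. (g y - g z - g' (y - z)) /\<^sub>R norm (y - z)) \<longlongrightarrow> 0) (at z)"
    using assms unfolding has_derivative_at_within by simp
  from filterlim_compose[OF this fl]
  have "(\<lambda>n. (g (z + e / of_nat (Suc n)) - g z - g' (e / of_nat (Suc n))) /\<^sub>R norm (e / of_nat (Suc n))) \<longlonglongrightarrow> 0"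
    by simp
  from tendsto_scaleR[OF tendsto_const[of "norm e"] this]
  have "(\<lambda>n. norm e *\<^sub>R ((g (z + e / of_nat (Suc n)) - g z - g' (e / of_nat (Suc n))) /\<^sub>R norm (e / of_nat (Suc n)))) \<longlonglongrightarrow> 0"
    by simp
  also have "(\<lambda>n. norm e *\<^sub>R ((g (z + e / of_nat (Suc n)) - g z - g' (e / of_nat (Suc n))) /\<^sub>R norm (e / of_nat (Suc n))))
     = (\<lambda>n. of_nat (Suc n) * (g (z + e / of_nat (Suc n)) - g z) - g' e)"
  proof
    fix n
    have "g' (e / of_nat (Suc n)) = g' ((1 / real (Suc n)) *\<^sub>R e)"
      by (simp add: scaleR_conv_of_real)
    also have "\<dots> = g' e / of_nat (Suc n)" by (simp only: g'.scaleR) (simp add: scaleR_conv_of_real)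
    finally have *: "g' (e / of_nat (Suc n)) = g' e / of_nat (Suc n)" .
    have "norm e *\<^sub>R (x /\<^sub>R norm (e / of_nat (Suc n))) = of_nat (Suc n) * x" for x :: complex
      using False by (simp add: norm_divide scaleR_conv_of_real del: of_nat_Suc)
    then show "norm e *\<^sub>R ((g (z + e / of_nat (Suc n)) - g z - g' (e / of_nat (Suc n))) /\<^sub>R norm (e / of_nat (Suc n)))
      = of_nat (Suc n) * (g (z + e / of_nat (Suc n)) - g z) - g' e"
      unfolding * by (simp add: right_diff_distrib del: of_nat_Suc)
  qed
  finally show ?thesis by (simp add: LIM_zero_iff del: of_nat_Suc)
qed

lemma left_quotient_limit:
  assumes "(g has_derivative g') (at z)"
  shows "(\<lambda>n. left_quotient g e n z) \<longlonglongrightarrow> g' e"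
proof -
  interpret g': bounded_linear g' using assms by (rule has_derivative_bounded_linear)
  have "(\<lambda>n. - (of_nat (Suc n) * (g (z + (-e) / of_nat (Suc n)) - g z))) \<longlonglongrightarrow> - g' (- e)"
    by (intro tendsto_minus has_derivative_quotient_limit assms)
  moreover have "g' (- e) = - g' e" by (rule g'.neg)
  ultimately show ?thesis by (simp add: left_quotient_def algebra_simps del: of_nat_Suc)
qed

lemma integral_lborel_shift:
  fixes f :: "complex \<Rightarrow> complex"
  assumes "f \<in> borel_measurable borel"
  shows "(\<integral>z. f (c + z) \<partial>lborel) = (\<integral>z. f z \<partial>lborel)"
proof -
  have "(\<integral>z. f z \<partial>lborel) = (\<integral>z. f z \<partial>(distr lborel borel ((+) c)))" by (simp add: lborel_distr_plus)
  also have "\<dots> = (\<integral>z. f (c + z) \<partial>lborel)" using assms by (subst integral_distr) auto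
  finally show ?thesis by simp
qed

lemma continuous_on_compact_bound:
  fixes \<phi> :: "complex \<Rightarrow> complex"
  assumes "continuous_on K \<phi>" "compact K"
  obtains B where "B \<ge> 0" "\<And>z. z \<in> K \<Longrightarrow> norm (\<phi> z) \<le> B"
proof -
  have "bounded (\<phi> ` K)" using assms by (intro compact_imp_bounded compact_continuous_image)
  then obtain B where "\<forall>z\<in>K. norm (\<phi> z) \<le> B" by (auto simp: bounded_iff)
  then show thesis by (intro that[of "max 0 B"]) auto
qed

text \<open>Integration by parts without Fubini: move a difference quotient from \<open>\<phi>\<close> to \<open>g\<close> by translation and let
the step tend to \<open>0\<close>. The local Lipschitz constant of \<open>g\<close>, uniform on compact sets, dominates the
quotients of \<open>g\<close>, and differentiability almost everywhere gives their limit.\<close>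
lemma weak_directional_derivative:
  fixes g :: "complex \<Rightarrow> complex"
  assumes U: "open U" and lip: "locally_Lipschitz_on U g" and N: "negligible N"
    and diff': "\<forall>z\<in>U - N. g differentiable (at z)"
    and e: "norm e = 1"
  defines "gt \<equiv> (\<lambda>z. indicator U z *\<^sub>R g z)"
  defines "D \<equiv> left_derivative gt e"
  shows "D \<in> borel_measurable borel"
    and "\<And>K. compact K \<Longrightarrow> K \<subseteq> U \<Longrightarrow> D absolutely_integrable_on K"
    and "\<And>z g'. z \<in> U \<Longrightarrow> (g has_derivative g') (at z) \<Longrightarrow> D z = g' e"
    and "\<And>\<phi> K. \<lbrakk>compact K; K \<subseteq> U; \<And>z. z \<notin> K \<Longrightarrow> \<phi> z = 0; \<And>z. \<phi> differentiable (at z);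
          continuous_on UNIV (\<lambda>z. frechet_derivative \<phi> (at z) e)\<rbrakk> \<Longrightarrow>
         integrable lborel (\<lambda>z. gt z * frechet_derivative \<phi> (at z) e) \<and>
         integrable lborel (\<lambda>z. D z * \<phi> z) \<and>
         (\<integral>z. gt z * frechet_derivative \<phi> (at z) e \<partial>lborel) = - (\<integral>z. D z * \<phi> z \<partial>lborel)"
proof -
  have diff: "g differentiable (at z)" if "z \<in> U - N" for z using diff' that by blast
  have cont: "continuous_on U g" using lip by (rule locally_Lipschitz_imp_continuous_on)
  have gt[measurable]: "gt \<in> borel_measurable borel"
    unfolding gt_def using U cont by (intro borel_measurable_continuous_on_indicator) auto
  have lq[measurable]: "left_quotient gt e n \<in> borel_measurable borel" for n
    unfolding left_quotient_def[abs_def] by measurable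
  show D[measurable]: "D \<in> borel_measurable borel"
    unfolding D_def left_derivative_def[abs_def] by (intro borel_measurable_lim_metric lq)
  have lim: "(\<lambda>n. left_quotient gt e n z) \<longlonglongrightarrow> g' e" if "z \<in> U" "(g has_derivative g') (at z)" for z g'
  proof (rule left_quotient_limit)
    show "(gt has_derivative g') (at z)"
      by (rule has_derivative_transform_within_open[OF that(2) U that(1)]) (auto simp: gt_def)
  qed
  show Deq: "D z = g' e" if "z \<in> U" "(g has_derivative g') (at z)" for z g'
    unfolding D_def left_derivative_def using lim[OF that] by (rule limI)
  have limD: "(\<lambda>n. left_quotient gt e n z) \<longlonglongrightarrow> D z" if "z \<in> U - N" for z
    using diff[OF that] lim[of z] Deq[of z] that unfolding differentiable_def by force
  have AEN: "AE z in lborel. z \<notin> N"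
  proof -
    have "AE z in lebesgue. z \<notin> N" using N by (simp add: negligible_iff_null_sets AE_not_in)
    then show ?thesis by (simp add: AE_completion_iff)
  qed
  have lqb: "\<exists>n0 M. M \<ge> 0 \<and> (\<forall>n\<ge>n0. \<forall>z\<in>K. norm (left_quotient gt e n z) \<le> M)" if K: "compact K" "K \<subseteq> U" for K
  proof -
    obtain d1 M where d1: "d1 > 0" "M \<ge> 0" "\<And>z w. z \<in> K \<Longrightarrow> dist w z < d1 \<Longrightarrow> dist (g w) (g z) \<le> M * dist w z"
      by (rule locally_Lipschitz_uniform_on_compact[OF lip K]) blast
    obtain d2 where d2: "d2 > 0" "(\<Union>z\<in>K. ball z d2) \<subseteq> U"
      using compact_subset_open_imp_ball_epsilon_subset[OF K(1) U K(2)] by auto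
    obtain n0 where n0: "1 / Suc n0 < min d1 d2" using d1 d2 by (metis min_less_iff_conj nat_approx_posE)
    have "norm (left_quotient gt e n z) \<le> M" if n: "n \<ge> n0" and z: "z \<in> K" for n z
    proof -
      let ?w = "z - e / of_nat (Suc n)"
      have dw: "dist ?w z = 1 / Suc n" using e by (simp add: dist_norm norm_divide del: of_nat_Suc)
      have "1 / real (Suc n) \<le> 1 / Suc n0" using n by (simp add: field_simps)
      then have lt: "dist ?w z < min d1 d2" using n0 unfolding dw by linarith
      then have "?w \<in> ball z d2" by (simp add: dist_commute)
      then have "?w \<in> U" using d2(2) z by blast
      then have "left_quotient gt e n z = of_nat (Suc n) * (g z - g ?w)"
        using z K by (auto simp: left_quotient_def gt_def)
      then have "norm (left_quotient gt e n z) = real (Suc n) * dist (g ?w) (g z)"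
        by (simp only: norm_mult norm_of_nat dist_norm norm_minus_commute)
      also have "\<dots> \<le> real (Suc n) * (M * dist ?w z)"
        using d1(3)[OF z, of ?w] lt by (intro mult_left_mono) auto
      also have "\<dots> = M" unfolding dw by simp
      finally show ?thesis .
    qed
    then show ?thesis using d1(2) by blast
  qed
  have DM: "\<exists>M\<ge>0. \<forall>z\<in>K - N. norm (D z) \<le> M" if K: "compact K" "K \<subseteq> U" for K
  proof -
    obtain n0 M where M: "M \<ge> 0" "\<And>n z. n \<ge> n0 \<Longrightarrow> z \<in> K \<Longrightarrow> norm (left_quotient gt e n z) \<le> M"
      using lqb[OF K] by blast
    have "norm (D z) \<le> M" if z: "z \<in> K - N" for z
    proof (rule tendsto_upperbound)
      show "(\<lambda>n. norm (left_quotient gt e n z)) \<longlonglongrightarrow> norm (D z)"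
        using limD z K by (intro tendsto_norm) auto
      show "\<forall>\<^sub>F n in sequentially. norm (left_quotient gt e n z) \<le> M"
        using M(2) z by (auto simp: eventually_sequentially)
    qed auto
    then show ?thesis using M(1) by blast
  qed
  show "D absolutely_integrable_on K" if K: "compact K" "K \<subseteq> U" for K
  proof -
    obtain M where M: "M \<ge> 0" "\<And>z. z \<in> K - N \<Longrightarrow> norm (D z) \<le> M" using DM[OF K] by blast
    have "integrable lborel (\<lambda>z. indicator K z *\<^sub>R D z)"
    proof (rule integrableI_bounded_set_indicator[where B=M])
      show "K \<in> sets lborel" using borel_compact[OF K(1)] by simp
      show "emeasure lborel K < \<infinity>" by (rule emeasure_compact_finite[OF K(1)])
      show "AE z in lborel. z \<in> K \<longrightarrow> norm (D z) \<le> M" using AEN by eventually_elim (use M in auto)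
    qed auto
    then show ?thesis
      unfolding set_integrable_def
      by (subst integrable_completion) (use borel_compact[OF K(1)] D in \<open>auto intro!: borel_measurable_scaleR borel_measurable_indicator\<close>)
  qed
  fix \<phi> :: "complex \<Rightarrow> complex" and K assume K: "compact K" "K \<subseteq> U" and \<phi>0: "\<And>z. z \<notin> K \<Longrightarrow> \<phi> z = 0"
    and \<phi>d: "\<And>z. \<phi> differentiable (at z)"
    and \<phi>c: "continuous_on UNIV (\<lambda>z. frechet_derivative \<phi> (at z) e)"
  define \<phi>' where "\<phi>' = (\<lambda>z. frechet_derivative \<phi> (at z) e)"
  have \<phi>'c: "continuous_on UNIV \<phi>'" using \<phi>c by (simp add: \<phi>'_def)
  have \<phi>cc: "continuous_on UNIV \<phi>" using \<phi>d by (simp add: continuous_at_imp_continuous_on differentiable_imp_continuous_within)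
  have [measurable]: "\<phi> \<in> borel_measurable borel" "\<phi>' \<in> borel_measurable borel"
    using \<phi>cc \<phi>'c by (auto intro: borel_measurable_continuous_onI)
  have \<phi>der: "(\<phi> has_derivative frechet_derivative \<phi> (at z)) (at z)" for z
    using \<phi>d by (simp add: frechet_derivative_works[symmetric])
  have \<phi>'0: "\<phi>' z = 0" if "z \<notin> K" for z
  proof -
    have "(\<phi> has_derivative (\<lambda>h. 0)) (at z)"
      by (rule has_derivative_transform_within_open[where s = "- K" and f = "\<lambda>_. 0"])
         (use that K \<phi>0 compact_imp_closed in auto)
    then have "frechet_derivative \<phi> (at z) = (\<lambda>h. 0)" by (simp add: frechet_derivative_at[symmetric])
    then show ?thesis by (simp add: \<phi>'_def)
  qed
  obtain d2 where d2: "d2 > 0" "(\<Union>z\<in>K. cball z d2) \<subseteq> U"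
    using compact_subset_open_imp_cball_epsilon_subset[OF K(1) U K(2)] by auto
  \<comment> \<open>All translates of the support by small steps stay in \<open>K'\<close>, where \<open>g\<close> is bounded.\<close>
  define K' where "K' = {x + y | x y. x \<in> K \<and> y \<in> cball 0 d2}"
  have K': "compact K'" unfolding K'_def using K by (intro compact_sums) auto
  have KK': "z \<in> K'" if "z + c \<in> K" "norm c \<le> d2" for z c
    unfolding K'_def using that by (intro CollectI exI[of _ "z + c"] exI[of _ "- c"]) auto
  have K'U: "K' \<subseteq> U" unfolding K'_def using d2(2) by (force simp: dist_norm)
  obtain n1 where n1: "1 / Suc n1 < d2" using d2 by (metis nat_approx_posE)
  have small: "norm (e / of_nat (Suc n)) \<le> d2" if n: "n \<ge> n1" for n
  proof -
    have "1 / real (Suc n) \<le> 1 / Suc n1" using n by (simp add: field_simps)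
    then show ?thesis using n1 e by (simp add: norm_divide del: of_nat_Suc)
  qed
  obtain B where B: "B \<ge> 0" "\<And>z. z \<in> K' \<Longrightarrow> norm (g z) \<le> B"
    using continuous_on_compact_bound[OF continuous_on_subset[OF cont K'U] K'] by blast
  obtain B1 where B1: "B1 \<ge> 0" "\<And>z. z \<in> K \<Longrightarrow> norm (\<phi> z) \<le> B1"
    using continuous_on_compact_bound[OF continuous_on_subset[OF \<phi>cc] K(1)] by blast
  obtain B2 where B2: "B2 \<ge> 0" "\<And>z. z \<in> K \<Longrightarrow> norm (\<phi>' z) \<le> B2"
    using continuous_on_compact_bound[OF continuous_on_subset[OF \<phi>'c] K(1)] by blast
  have B1': "norm (\<phi> z) \<le> B1" for z using B1 \<phi>0[of z] by (cases "z \<in> K") auto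
  have B2': "norm (\<phi>' z) \<le> B2" for z using B2 \<phi>'0[of z] by (cases "z \<in> K") auto
  have gtB: "norm (gt z) \<le> B" if "z \<in> K'" for z using B(2)[OF that] B(1) by (auto simp: gt_def indicator_def)
  define Q where "Q = (\<lambda>(n::nat) (z::complex). of_nat (Suc n) * (\<phi> (z + e / of_nat (Suc n)) - \<phi> z))"
  have [measurable]: "Q n \<in> borel_measurable borel" for n unfolding Q_def by measurable
  have QB: "norm (Q n z) \<le> B2" for n z
  proof -
    let ?c = "e / of_nat (Suc n)"
    have der: "((\<lambda>t. \<phi> (z + t *\<^sub>R e)) has_vector_derivative \<phi>' (z + t *\<^sub>R e)) (at t)" for t
    proof -
      have "((\<lambda>t. \<phi> (z + t *\<^sub>R e)) has_derivative (\<lambda>s. frechet_derivative \<phi> (at (z + t *\<^sub>R e)) (s *\<^sub>R e))) (at t)"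
        by (rule has_derivative_compose[OF _ \<phi>der, unfolded o_def]) (auto intro!: derivative_eq_intros)
      moreover have "frechet_derivative \<phi> (at (z + t *\<^sub>R e)) (s *\<^sub>R e) = s *\<^sub>R \<phi>' (z + t *\<^sub>R e)" for s
        unfolding \<phi>'_def using \<phi>der[of "z + t *\<^sub>R e", THEN has_derivative_bounded_linear]
        by (rule linear_simps)
      ultimately show ?thesis by (simp add: has_vector_derivative_def)
    qed
    have "norm (\<phi> (z + (1 / Suc n) *\<^sub>R e) - \<phi> (z + 0 *\<^sub>R e)) \<le> B2 * norm (1 / real (Suc n) - 0)"
    proof (rule differentiable_bound[of UNIV "\<lambda>t. \<phi> (z + t *\<^sub>R e)" "\<lambda>t s. s *\<^sub>R \<phi>' (z + t *\<^sub>R e)"])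
      show "onorm (\<lambda>s. s *\<^sub>R \<phi>' (z + t *\<^sub>R e)) \<le> B2" for t :: real
        using B2'[of "z + t *\<^sub>R e"] B2(1)
        by (intro onorm_bound) (auto simp: mult.commute[of B2] intro: mult_left_mono)
    qed (use der in \<open>auto simp: has_vector_derivative_def\<close>)
    then have "norm (\<phi> (z + ?c) - \<phi> z) \<le> B2 / Suc n" by (simp add: scaleR_conv_of_real)
    then have "real (Suc n) * norm (\<phi> (z + ?c) - \<phi> z) \<le> B2" by (simp add: field_simps)
    then show ?thesis unfolding Q_def by (simp only: norm_mult norm_of_nat)
  qed
  have Q0: "Q n z = 0" if "n \<ge> n1" "z \<notin> K'" for n z
    using KK'[of z "e / of_nat (Suc n)"] KK'[of z 0] small[OF that(1)] that(2) d2(1) \<phi>0 unfolding Q_def by force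
  have intK: "integrable lborel (\<lambda>z. C * indicator S z)" if "compact S" for S :: "complex set" and C :: real
    using emeasure_compact_finite[OF that] borel_compact[OF that]
    by (intro integrable_mult_right integrable_real_indicator) auto
  have L: "integrable lborel (\<lambda>z. gt z * \<phi>' z)" "(\<lambda>n. \<integral>z. gt z * Q (n + n1) z \<partial>lborel) \<longlonglongrightarrow> (\<integral>z. gt z * \<phi>' z \<partial>lborel)"
  proof -
    have 1: "AE z in lborel. (\<lambda>n. gt z * Q (n + n1) z) \<longlonglongrightarrow> gt z * \<phi>' z"
    proof (rule AE_I2)
      fix z
      have "(\<lambda>n. Q n z) \<longlonglongrightarrow> \<phi>' z" unfolding Q_def \<phi>'_def by (rule has_derivative_quotient_limit[OF \<phi>der])
      then show "(\<lambda>n. gt z * Q (n + n1) z) \<longlonglongrightarrow> gt z * \<phi>' z" by (intro tendsto_mult tendsto_const LIMSEQ_ignore_initial_segment)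
    qed
    have 2: "AE z in lborel. norm (gt z * Q (n + n1) z) \<le> B * B2 * indicator K' z" for n
    proof (rule AE_I2)
      fix z show "norm (gt z * Q (n + n1) z) \<le> B * B2 * indicator K' z"
        using Q0[of "n + n1" z] gtB[of z] QB[of "n+n1" z] B(1) B2(1)
        by (cases "z \<in> K'") (auto simp: norm_mult intro!: mult_mono)
    qed
    note dc = integrable_dominated_convergence[OF _ _ intK[OF K'] 1 2] integral_dominated_convergence[OF _ _ intK[OF K'] 1 2]
    show "integrable lborel (\<lambda>z. gt z * \<phi>' z)" by (rule dc) measurable
    show "(\<lambda>n. \<integral>z. gt z * Q (n + n1) z \<partial>lborel) \<longlonglongrightarrow> (\<integral>z. gt z * \<phi>' z \<partial>lborel)" by (rule dc) measurable
  qed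
  obtain n2 M where M: "M \<ge> 0" "\<And>n z. n \<ge> n2 \<Longrightarrow> z \<in> K \<Longrightarrow> norm (left_quotient gt e n z) \<le> M"
    using lqb[OF K] by blast
  have R: "integrable lborel (\<lambda>z. D z * \<phi> z)" "(\<lambda>n. \<integral>z. left_quotient gt e (n + n2) z * \<phi> z \<partial>lborel) \<longlonglongrightarrow> (\<integral>z. D z * \<phi> z \<partial>lborel)"
  proof -
    have 1: "AE z in lborel. (\<lambda>n. left_quotient gt e (n + n2) z * \<phi> z) \<longlonglongrightarrow> D z * \<phi> z"
      using AEN
    proof eventually_elim
      fix z assume z: "z \<notin> N"
      show "(\<lambda>n. left_quotient gt e (n + n2) z * \<phi> z) \<longlonglongrightarrow> D z * \<phi> z"
      proof (cases "z \<in> K")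
        case True
        then show ?thesis using limD[of z] z K by (intro tendsto_mult tendsto_const LIMSEQ_ignore_initial_segment) auto
      qed (simp add: \<phi>0)
    qed
    have 2: "AE z in lborel. norm (left_quotient gt e (n + n2) z * \<phi> z) \<le> M * B1 * indicator K z" for n
    proof (rule AE_I2)
      fix z show "norm (left_quotient gt e (n + n2) z * \<phi> z) \<le> M * B1 * indicator K z"
        using \<phi>0[of z] M(2)[of "n+n2" z] B1' M(1)
        by (cases "z \<in> K") (auto simp: norm_mult intro!: mult_mono)
    qed
    note dc = integrable_dominated_convergence[OF _ _ intK[OF K(1)] 1 2] integral_dominated_convergence[OF _ _ intK[OF K(1)] 1 2]
    show "integrable lborel (\<lambda>z. D z * \<phi> z)" by (rule dc) measurable
    show "(\<lambda>n. \<integral>z. left_quotient gt e (n + n2) z * \<phi> z \<partial>lborel) \<longlonglongrightarrow> (\<integral>z. D z * \<phi> z \<partial>lborel)" by (rule dc) measurable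
  qed
  have eq: "(\<integral>z. gt z * Q n z \<partial>lborel) = - (\<integral>z. left_quotient gt e n z * \<phi> z \<partial>lborel)" if n: "n \<ge> n1" for n
  proof -
    let ?c = "e / of_nat (Suc n)"
    have i1: "integrable lborel (\<lambda>z. gt z * \<phi> (z + ?c))"
      using KK'[of _ ?c] small[OF n] \<phi>0 B1' gtB B1(1) B(1)
      by (intro integrable_bounded_compact_support[OF _ K', where B="B*B1"]) (auto simp: norm_mult intro!: mult_mono)
    have i2: "integrable lborel (\<lambda>z. gt z * \<phi> z)"
      using KK'[of _ 0] d2 \<phi>0 B1' gtB B1(1) B(1)
      by (intro integrable_bounded_compact_support[OF _ K', where B="B*B1"]) (auto simp: norm_mult intro!: mult_mono)
    have s: "(\<lambda>z. gt (?c + z - ?c) * \<phi> (?c + z)) = (\<lambda>z. gt z * \<phi> (z + ?c))" by (simp add: add.commute)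
    have i3: "integrable lborel (\<lambda>z. gt (z - ?c) * \<phi> z)"
    proof -
      have "integrable (distr lborel borel ((+) ?c)) (\<lambda>z. gt (z - ?c) * \<phi> z)"
        by (subst integrable_distr_eq) (use i1 s in auto)
      then show ?thesis by (simp add: lborel_distr_plus)
    qed
    have sh: "(\<integral>z. gt (z - ?c) * \<phi> z \<partial>lborel) = (\<integral>z. gt z * \<phi> (z + ?c) \<partial>lborel)"
      using integral_lborel_shift[of "\<lambda>z. gt (z - ?c) * \<phi> z" ?c] s by simp
    have "(\<integral>z. gt z * Q n z \<partial>lborel) = (\<integral>z. of_nat (Suc n) * (gt z * \<phi> (z + ?c) - gt z * \<phi> z) \<partial>lborel)"
      by (intro Bochner_Integration.integral_cong) (auto simp: Q_def algebra_simps)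
    also have "\<dots> = of_nat (Suc n) * ((\<integral>z. gt z * \<phi> (z + ?c) \<partial>lborel) - (\<integral>z. gt z * \<phi> z \<partial>lborel))"
      using i1 i2 by (simp del: of_nat_Suc)
    also have "\<dots> = - (of_nat (Suc n) * ((\<integral>z. gt z * \<phi> z \<partial>lborel) - (\<integral>z. gt (z - ?c) * \<phi> z \<partial>lborel)))"
      unfolding sh by (simp add: algebra_simps)
    also have "\<dots> = - (\<integral>z. of_nat (Suc n) * (gt z * \<phi> z - gt (z - ?c) * \<phi> z) \<partial>lborel)"
      using i2 i3 by (simp del: of_nat_Suc)
    also have "\<dots> = - (\<integral>z. left_quotient gt e n z * \<phi> z \<partial>lborel)"
      by (intro arg_cong[where f=uminus] Bochner_Integration.integral_cong) (auto simp: left_quotient_def algebra_simps)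
    finally show ?thesis .
  qed
  have "(\<lambda>n. \<integral>z. gt z * Q (n + (n1 + n2)) z \<partial>lborel) \<longlonglongrightarrow> (\<integral>z. gt z * \<phi>' z \<partial>lborel)"
    using LIMSEQ_ignore_initial_segment[OF L(2), of n2] by (simp add: ac_simps)
  moreover have "(\<lambda>n. \<integral>z. gt z * Q (n + (n1 + n2)) z \<partial>lborel) \<longlonglongrightarrow> - (\<integral>z. D z * \<phi> z \<partial>lborel)"
    using tendsto_minus[OF LIMSEQ_ignore_initial_segment[OF R(2), of n1]] by (simp add: eq ac_simps)
  ultimately have "(\<integral>z. gt z * \<phi>' z \<partial>lborel) = - (\<integral>z. D z * \<phi> z \<partial>lborel)"
    by (rule LIMSEQ_unique)
  then show "integrable lborel (\<lambda>z. gt z * frechet_derivative \<phi> (at z) e) \<and>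
         integrable lborel (\<lambda>z. D z * \<phi> z) \<and>
         (\<integral>z. gt z * frechet_derivative \<phi> (at z) e \<partial>lborel) = - (\<integral>z. D z * \<phi> z \<partial>lborel)"
    using L(1) R(1) by (simp add: \<phi>'_def)
qed

lemma test_functionD:
  assumes "test_function U \<phi>"
  obtains K where "compact K" "K \<subseteq> U" "\<And>z. z \<notin> K \<Longrightarrow> \<phi> z = 0" "\<And>z. \<phi> differentiable (at z)"
    "continuous_on UNIV (partial_x \<phi>)" "continuous_on UNIV (partial_y \<phi>)"
proof -
  obtain K where K: "compact K" "K \<subseteq> U" "\<And>z. z \<notin> K \<Longrightarrow> \<phi> z = 0"
    using assms by (auto simp: test_function_def)
  have "C_class (Suc 0) \<phi>" using assms unfolding test_function_def by blast
  then show thesis using that[OF K] by simp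
qed

text \<open>If the differential is \<open>x \<mapsto> A x + B cnj x\<close>, the derivatives in the directions \<open>1\<close> and \<open>\<i>\<close> are \<open>A + B\<close> and
\<open>\<i> (A - B)\<close>, so that the Wirtinger derivatives are \<open>A\<close> and \<open>B\<close>.\<close>
lemma weak_wirtinger_of_AE_differentiable:
  assumes U: "open U" and lip: "locally_Lipschitz_on U g" and N: "negligible N"
    and diff: "\<And>z. z \<in> U - N \<Longrightarrow> \<exists>A B. (g has_derivative (\<lambda>x. A * x + B * cnj x)) (at z) \<and> cmod B \<le> k * cmod A"
  shows "\<exists>p q. locally_integrable_on U p \<and> locally_integrable_on U q \<and>
            weak_wirtinger U g p \<and> weak_wirtinger_bar U g q \<and>
            (AE z in lebesgue. z \<in> U \<longrightarrow> cmod (q z) \<le> k * cmod (p z))"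
proof -
  define gt where "gt = (\<lambda>z. indicator U z *\<^sub>R g z)"
  have d: "\<forall>z\<in>U - N. g differentiable (at z)"
    using diff unfolding differentiable_def by blast
  note wx = weak_directional_derivative[OF U lip N d norm_one, folded gt_def]
  note wy = weak_directional_derivative[OF U lip N d norm_ii, folded gt_def]
  define X Y where "X = left_derivative gt 1" and "Y = left_derivative gt \<i>"
  define p q where "p = (\<lambda>z. (X z - \<i> * Y z) / 2)" and "q = (\<lambda>z. (X z + \<i> * Y z) / 2)"
  have XY: "X z = A + B" "Y z = \<i> * (A - B)" if "z \<in> U" "(g has_derivative (\<lambda>x. A * x + B * cnj x)) (at z)" for z A B
    using wx(3)[OF that] wy(3)[OF that] by (auto simp: X_def Y_def algebra_simps)
  have gtm: "gt \<in> borel_measurable borel"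
    unfolding gt_def using U locally_Lipschitz_imp_continuous_on[OF lip] by (intro borel_measurable_continuous_on_indicator) auto
  have Xm: "X \<in> borel_measurable borel" "Y \<in> borel_measurable borel"
    using wx(1) wy(1) by (auto simp: X_def Y_def)
  have ai: "X absolutely_integrable_on K" "Y absolutely_integrable_on K" if "compact K" "K \<subseteq> U" for K
    using wx(2)[OF that] wy(2)[OF that] by (auto simp: X_def Y_def)
  have lip_p: "locally_integrable_on U p" "locally_integrable_on U q"
    unfolding locally_integrable_on_def p_def q_def set_integrable_def
    using ai unfolding set_integrable_def
    by (auto simp: scaleR_conv_of_real distrib_left right_diff_distrib add_divide_distrib diff_divide_distrib
        mult.left_commute[of _ \<i>] intro!: Bochner_Integration.integrable_add Bochner_Integration.integrable_diff)
  have AEb: "AE z in lebesgue. z \<in> U \<longrightarrow> cmod (q z) \<le> k * cmod (p z)"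
  proof -
    have "AE z in lebesgue. z \<notin> N" using N by (simp add: negligible_iff_null_sets AE_not_in)
    then show ?thesis
    proof eventually_elim
      fix z assume z: "z \<notin> N"
      show "z \<in> U \<longrightarrow> cmod (q z) \<le> k * cmod (p z)"
      proof
        assume zU: "z \<in> U"
        then obtain A B where AB: "(g has_derivative (\<lambda>x. A * x + B * cnj x)) (at z)" "cmod B \<le> k * cmod A"
          using diff[of z] z by blast
        have "p z = A" "q z = B" unfolding p_def q_def XY[OF zU AB(1)] by (simp_all add: algebra_simps)
        then show "cmod (q z) \<le> k * cmod (p z)" using AB by simp
      qed
    qed
  qed
  have main: "(LINT z:U|lebesgue. g z * ((partial_x \<phi> z + s * partial_y \<phi> z) / 2)) = - (LINT z:U|lebesgue. ((X z + s * Y z) / 2) * \<phi> z)"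
    if tf: "test_function U \<phi>" for \<phi> s
  proof -
    obtain K where K: "compact K" "K \<subseteq> U" "\<And>z. z \<notin> K \<Longrightarrow> \<phi> z = 0" "\<And>z. \<phi> differentiable (at z)"
      "continuous_on UNIV (partial_x \<phi>)" "continuous_on UNIV (partial_y \<phi>)"
      using test_functionD[OF tf] by blast
    have [measurable]: "partial_x \<phi> \<in> borel_measurable borel" "partial_y \<phi> \<in> borel_measurable borel"
      using K by (auto intro: borel_measurable_continuous_onI)
    have [measurable]: "\<phi> \<in> borel_measurable borel" 
      using K(4) by (intro borel_measurable_continuous_onI) (simp add: continuous_at_imp_continuous_on differentiable_imp_continuous_within)
    note [measurable] = gtm Xm
    have x: "integrable lborel (\<lambda>z. gt z * partial_x \<phi> z)" "integrable lborel (\<lambda>z. X z * \<phi> z)"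
      "(\<integral>z. gt z * partial_x \<phi> z \<partial>lborel) = - (\<integral>z. X z * \<phi> z \<partial>lborel)"
      using wx(4)[OF K(1-4)] K(5) unfolding partial_x_def X_def gt_def by auto
    have y: "integrable lborel (\<lambda>z. gt z * partial_y \<phi> z)" "integrable lborel (\<lambda>z. Y z * \<phi> z)"
      "(\<integral>z. gt z * partial_y \<phi> z \<partial>lborel) = - (\<integral>z. Y z * \<phi> z \<partial>lborel)"
      using wy(4)[OF K(1-4)] K(6) unfolding partial_y_def Y_def gt_def by auto
    have "(LINT z:U|lebesgue. g z * ((partial_x \<phi> z + s * partial_y \<phi> z) / 2)) = (\<integral>z. gt z * ((partial_x \<phi> z + s * partial_y \<phi> z) / 2) \<partial>lebesgue)"
      unfolding set_lebesgue_integral_def gt_def by (intro Bochner_Integration.integral_cong) auto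
    also have "\<dots> = (\<integral>z. (gt z * partial_x \<phi> z + s * (gt z * partial_y \<phi> z)) / 2 \<partial>lborel)"
      by (subst integral_completion) (auto intro!: Bochner_Integration.integral_cong simp: algebra_simps)
    also have "\<dots> = ((\<integral>z. gt z * partial_x \<phi> z \<partial>lborel) + s * (\<integral>z. gt z * partial_y \<phi> z \<partial>lborel)) / 2"
      using x(1) y(1) by simp
    also have "\<dots> = - (((\<integral>z. X z * \<phi> z \<partial>lborel) + s * (\<integral>z. Y z * \<phi> z \<partial>lborel)) / 2)"
      unfolding x(3) y(3) by (simp add: algebra_simps)
    also have "\<dots> = - (\<integral>z. (X z * \<phi> z + s * (Y z * \<phi> z)) / 2 \<partial>lborel)"
      using x(2) y(2) by simp
    also have "\<dots> = - (\<integral>z. (X z + s * Y z) / 2 * \<phi> z \<partial>lebesgue)"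
      by (subst integral_completion) (auto intro!: Bochner_Integration.integral_cong simp: algebra_simps)
    also have "(\<integral>z. (X z + s * Y z) / 2 * \<phi> z \<partial>lebesgue) = (LINT z:U|lebesgue. ((X z + s * Y z) / 2) * \<phi> z)"
      unfolding set_lebesgue_integral_def using K by (intro Bochner_Integration.integral_cong) (auto simp: indicator_def)
    finally show ?thesis .
  qed
  have "weak_wirtinger U g p" "weak_wirtinger_bar U g q"
    unfolding weak_wirtinger_def weak_wirtinger_bar_def p_def q_def wirtinger_def wirtinger_bar_def
    using main[of _ "- \<i>"] main[of _ \<i>] by auto
  then show ?thesis using lip_p AEb by blast
qed

section \<open>Orientation of injective maps\<close>

lemma winding_number_circlepath_mult:
  assumes "A \<noteq> 0" "0 < r"
  shows "winding_number (\<lambda>t. b + A * (circlepath a r t - a)) b = 1"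
proof -
  let ?p = "\<lambda>t. b + A * (circlepath a r t - a)"
  have vp: "valid_path ?p"
    using assms by (intro valid_path_compose_holomorphic[of "circlepath a r" "\<lambda>z. b + A * (z - a)" UNIV, unfolded o_def])
      (auto intro!: holomorphic_intros)
  have peq: "?p = (\<lambda>t. b + A * of_real r * exp (2 * of_real pi * \<i> * of_real t))"
    by (auto simp: circlepath algebra_simps)
  have nin: "b \<notin> path_image ?p" unfolding path_image_def peq using assms by auto
  have der: "(?p has_vector_derivative (2 * of_real pi * \<i>) * (A * of_real r * exp (2 * of_real pi * \<i> * of_real t))) (at t)" for t
    unfolding peq
    by (rule has_vector_derivative_real_field) (auto intro!: derivative_eq_intros)
  have "((\<lambda>w. 1 / (w - b)) has_contour_integral (2 * of_real pi * \<i>)) ?p"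
    unfolding has_contour_integral_def
  proof (rule has_integral_eq[rotated])
    show "((\<lambda>t::real. 2 * of_real pi * \<i>) has_integral 2 * complex_of_real pi * \<i>) {0..1}"
      using has_integral_const_real[of "2 * complex_of_real pi * \<i>" 0 1] by simp
    fix t :: real assume t: "t \<in> {0..1}"
    have "vector_derivative ?p (at t within {0..1}) = (2 * of_real pi * \<i>) * (A * of_real r * exp (2 * of_real pi * \<i> * of_real t))"
      using t by (intro vector_derivative_at_within_ivl[OF der]) auto
    moreover have "?p t - b = A * of_real r * exp (2 * of_real pi * \<i> * of_real t)" by (simp add: circlepath)
    ultimately show "2 * of_real pi * \<i> = 1 / (?p t - b) * vector_derivative ?p (at t within {0..1})"
      using assms by simp
  qed
  then show ?thesis
    using winding_number_valid_path[OF vp nin] contour_integral_unique by (simp add: contour_integral_unique)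
qed

lemma winding_number_small_circle_derivative:
  assumes U: "open U" "a \<in> U" and der: "(g has_field_derivative A) (at a)" "A \<noteq> 0" and cont: "continuous_on U g"
  obtains r where "r > 0" "cball a r \<subseteq> U" "winding_number (g \<circ> circlepath a r) (g a) = 1"
proof -
  have "(g has_derivative (\<lambda>h. A * h)) (at a)" using der by (simp add: has_field_derivative_def)
  then obtain d where d: "d > 0" "\<And>y. norm (y - a) < d \<Longrightarrow> norm (g y - g a - A * (y - a)) \<le> (norm A / 2) * norm (y - a)"
    using der(2) unfolding has_derivative_at_alt by (metis half_gt_zero zero_less_norm_iff)
  obtain e where e: "e > 0" "cball a e \<subseteq> U" using U by (meson open_contains_cball)
  define r where "r = min (d/2) e"
  have r: "r > 0" "r < d" "cball a r \<subseteq> U" using d e by (auto simp: r_def)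
  let ?p = "\<lambda>t. g a + A * (circlepath a r t - a)" and ?q = "g \<circ> circlepath a r"
  have sph: "circlepath a r t \<in> sphere a r" if "t \<in> {0..1}" for t
    using that r(1) path_image_circlepath[where r=r and z=a] unfolding path_image_def by auto
  have pq: "path ?p" "path ?q"
  proof -
    show "path ?p" unfolding path_def by (intro continuous_intros) (use path_circlepath in \<open>auto simp: path_def\<close>)
    show "path ?q" using r e by (intro path_continuous_image continuous_on_subset[OF cont])
       (auto simp: path_image_circlepath)
  qed
  have nz: "g a \<notin> closed_segment (?q t) (?p t)" if t: "t \<in> {0..1}" for t
  proof
    assume "g a \<in> closed_segment (?q t) (?p t)"
    then obtain u where u: "0 \<le> u" "u \<le> 1" "g a = (1 - u) *\<^sub>R ?q t + u *\<^sub>R ?p t" by (auto simp: closed_segment_def)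
    let ?y = "circlepath a r t"
    have y: "norm (?y - a) = r" using sph[OF t] by (simp add: dist_norm norm_minus_commute)
    have eqy: "A * (?y - a) = - (1 - u) *\<^sub>R (g ?y - g a - A * (?y - a))"
      using u(3) by (simp add: algebra_simps scaleR_conv_of_real)
    have "norm (A * (?y - a)) = norm (- (1 - u) *\<^sub>R (g ?y - g a - A * (?y - a)))"
      by (rule arg_cong[where f = norm, OF eqy])
    also have "\<dots> = (1 - u) * norm (g ?y - g a - A * (?y - a))" using u(1,2) unfolding norm_scaleR by simp
    also have "\<dots> \<le> 1 * norm (g ?y - g a - A * (?y - a))" using u by (intro mult_right_mono) auto
    also have "\<dots> \<le> norm A / 2 * r" using d(2)[of ?y] y r by simp
    finally have "norm A * r \<le> norm A / 2 * r" using y by (simp add: norm_mult)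
    then show False using der(2) r(1) by simp
  qed
  have "homotopic_loops (- {g a}) ?q ?p"
  proof (rule homotopic_loops_linear)
    show "closed_segment (?q t) (?p t) \<subseteq> - {g a}" if "t \<in> {0..1}" for t using nz[OF that] by auto
  qed (use pq in \<open>auto simp: pathfinish_compose pathstart_compose pathstart_def pathfinish_def circlepath\<close>)
  then have "winding_number ?q (g a) = winding_number ?p (g a)" by (rule winding_number_homotopic_loops)
  also have "\<dots> = 1" using der(2) r(1) by (rule winding_number_circlepath_mult)
  finally show thesis using that r by blast
qed

text \<open>Injectivity keeps the centre value off the image of each circle, so the winding number is constant
along paths of discs in \<open>U\<close>. Every disc can be shrunk and moved to one point where the derivative is
complex and nonzero, and there it is \<open>1\<close>.\<close>
lemma orientation_preserving_if_injective:
  assumes U: "open U" "connected U" and cont: "continuous_on U g" and inj: "inj_on g U"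
    and a0: "a0 \<in> U" and der: "(g has_field_derivative A) (at a0)" "A \<noteq> 0"
  shows "orientation_preserving_on U g"
proof -
  have nin: "g a \<notin> path_image (g \<circ> circlepath a r)" if "0 < r" "cball a r \<subseteq> U" for a r
  proof
    assume "g a \<in> path_image (g \<circ> circlepath a r)"
    then have "g a \<in> g ` sphere a r" using that(1) path_image_circlepath[where r=r and z=a]
      by (simp add: path_image_compose)
    then obtain y where y: "y \<in> sphere a r" "g y = g a" by (metis imageE)
    then have "y \<in> U" "a \<in> U" "y \<noteq> a" using that by auto
    then show False using inj_on_eq_iff[OF inj] y(2) by blast
  qed
  \<comment> \<open>Two circles joined by a path of admissible circles have the same winding number.\<close>
  have homot: "winding_number (g \<circ> circlepath (\<gamma> 0) (\<rho> 0)) (g (\<gamma> 0)) = winding_number (g \<circ> circlepath (\<gamma> 1) (\<rho> 1)) (g (\<gamma> 1))"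
    if \<gamma>: "continuous_on {0..1} \<gamma>" "continuous_on {0..1} \<rho>"
      "\<And>s. s \<in> {0..1} \<Longrightarrow> 0 < \<rho> s \<and> cball (\<gamma> s) (\<rho> s) \<subseteq> U" for \<gamma> :: "real \<Rightarrow> complex" and \<rho> :: "real \<Rightarrow> real"
  proof -
    let ?h = "\<lambda>x::real\<times>real. g (\<gamma> (fst x) + of_real (\<rho> (fst x)) * exp (2 * of_real pi * \<i> * of_real (snd x))) - g (\<gamma> (fst x))"
    have h: "homotopic_loops (- {0}) (\<lambda>t. ?h (0,t)) (\<lambda>t. ?h (1,t))"
      unfolding homotopic_loops
    proof (intro exI[of _ ?h] conjI ballI)
      have inU: "\<gamma> s + of_real (\<rho> s) * exp (2 * of_real pi * \<i> * of_real t) \<in> U" if "s \<in> {0..1}" for s t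
        using \<gamma>(3)[OF that] by (auto simp: dist_norm norm_mult intro!: subsetD[of "cball (\<gamma> s) (\<rho> s)" U])
      show "continuous_on ({0..1} \<times> {0..1}) ?h"
      proof (intro continuous_on_diff)
        have c1: "continuous_on ({0..1} \<times> {0..1}) (\<lambda>x::real\<times>real. \<gamma> (fst x))" "continuous_on ({0..1} \<times> {0..1}) (\<lambda>x::real\<times>real. \<rho> (fst x))"
          by (rule continuous_on_compose2[OF \<gamma>(1)] continuous_on_compose2[OF \<gamma>(2)]; auto intro!: continuous_intros)+
        show "continuous_on ({0..1} \<times> {0..1}) (\<lambda>x::real\<times>real. g (\<gamma> (fst x) + of_real (\<rho> (fst x)) * exp (2 * of_real pi * \<i> * of_real (snd x))))"
          by (rule continuous_on_compose2[OF cont]) (use inU in \<open>auto intro!: continuous_intros c1\<close>)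
        show "continuous_on ({0..1} \<times> {0..1}) (\<lambda>x::real\<times>real. g (\<gamma> (fst x)))"
          by (rule continuous_on_compose2[OF cont]) (use \<gamma>(3) in \<open>fastforce intro!: continuous_intros c1\<close>)+
      qed
      have "?h x \<in> - {0}" if "x \<in> {0..1} \<times> {0..1}" for x
      proof -
        obtain s t where x: "x = (s,t)" "s \<in> {0..1}" "t \<in> {0..1}" using \<open>x \<in> {0..1} \<times> {0..1}\<close> by auto
        have "\<gamma> s + of_real (\<rho> s) * exp (2 * of_real pi * \<i> * of_real t) \<noteq> \<gamma> s" using \<gamma>(3)[OF x(2)] by auto
        moreover have "\<gamma> s \<in> U" using \<gamma>(3)[OF x(2)] by auto
        ultimately have "g (\<gamma> s + of_real (\<rho> s) * exp (2 * of_real pi * \<i> * of_real t)) \<noteq> g (\<gamma> s)"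
          using inj_on_eq_iff[OF inj inU[OF x(2), of t]] by blast
        then show ?thesis using x(1) by simp
      qed
      then show "?h \<in> {0..1} \<times> {0..1} \<rightarrow> - {0}" by blast
      show "pathfinish (?h \<circ> Pair s) = pathstart (?h \<circ> Pair s)" if "s \<in> {0..1}" for s
        by (simp add: pathfinish_def pathstart_def)
    qed auto
    have off: "winding_number (g \<circ> circlepath (\<gamma> s) (\<rho> s)) (g (\<gamma> s)) = winding_number (\<lambda>t. ?h (s,t)) 0" for s
      by (subst winding_number_offset) (simp add: o_def circlepath)
    show ?thesis unfolding off using h by (rule winding_number_homotopic_loops)
  qed
  show ?thesis
    unfolding orientation_preserving_on_def
  proof (intro allI impI, elim conjE)
    fix a r assume r: "0 < (r::real)" "cball a r \<subseteq> U"
    obtain r0 where r0: "r0 > 0" "cball a0 r0 \<subseteq> U" "winding_number (g \<circ> circlepath a0 r0) (g a0) = 1"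
      using winding_number_small_circle_derivative[OF U(1) a0 der cont] by blast
    have "a \<in> U" using r by auto
    then obtain p where p: "path p" "path_image p \<subseteq> U" "pathstart p = a" "pathfinish p = a0"
      using connected_open_path_connected[OF U] a0 unfolding path_connected_def by blast
    have "compact (path_image p)" using p(1) by (rule compact_path_image)
    then obtain e where e: "e > 0" "(\<Union>x\<in>path_image p. cball x e) \<subseteq> U"
      using compact_subset_open_imp_cball_epsilon_subset[OF _ U(1) p(2)] by blast
    define d where "d = min e (min r r0)"
    have d: "d > 0" "d \<le> e" "d \<le> r" "d \<le> r0" using e r r0 by (auto simp: d_def)
    have pc: "continuous_on {0..1} p" using p(1) by (simp add: path_def)
    have shrink: "winding_number (g \<circ> circlepath b d) (g b) = winding_number (g \<circ> circlepath b R) (g b)"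
      if "cball b R \<subseteq> U" "d \<le> R" for b R
    proof -
      have "0 < (1 - s) * d + s * R \<and> (1 - s) * d + s * R \<le> R" if "s \<in> {0..1}" for s
      proof
        have "d \<le> (1 - s) * d + s * R" using \<open>d \<le> R\<close> that mult_left_mono[of d R s] by (auto simp: algebra_simps)
        then show "0 < (1 - s) * d + s * R" using d(1) by linarith
        show "(1 - s) * d + s * R \<le> R" using \<open>d \<le> R\<close> that mult_left_mono[of d R "1 - s"] by (auto simp: algebra_simps)
      qed
      then have "cball b ((1 - s) * d + s * R) \<subseteq> U" "0 < (1 - s) * d + s * R" if "s \<in> {0..1}" for s
        using that(1) \<open>cball b R \<subseteq> U\<close> subset_cball[of "(1 - s) * d + s * R" R b] by blast+
      moreover have "continuous_on {0..1} (\<lambda>s::real. (1 - s) * d + s * R)" by (intro continuous_intros)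
      ultimately show ?thesis
        using homot[of "\<lambda>s. b" "\<lambda>s. (1 - s) * d + s * R"] by simp
    qed
    have "winding_number (g \<circ> circlepath (p 0) d) (g (p 0)) = winding_number (g \<circ> circlepath (p 1) d) (g (p 1))"
    proof (rule homot[of p "\<lambda>_. d"])
      fix s :: real assume s: "s \<in> {0..1}"
      then have "p s \<in> path_image p" by (auto simp: path_image_def)
      then have "cball (p s) e \<subseteq> U" using e(2) by blast
      then show "0 < d \<and> cball (p s) d \<subseteq> U" using d subset_cball[of d e "p s"] by auto
    qed (use pc in auto)
    then show "winding_number (g \<circ> circlepath a r) (g a) = 1"
      using p(3,4) shrink[OF r(2) d(3)] shrink[OF r0(2) d(4)] r0(3) by (simp add: pathstart_def pathfinish_def)
  qed
qed

section \<open>The Riemann sphere and its charts\<close>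

lemma openin_riemann_sphere_iff:
  "openin riemann_sphere V \<longleftrightarrow> open (Some -` V) \<and> (None \<in> V \<longrightarrow> bounded (- (Some -` V)))"
proof
  assume "openin riemann_sphere V"
  then consider U where "open U" "V = Some ` U" | C where "compact C" "V = insert None (Some ` (- C))"
    unfolding riemann_sphere_def openin_Alexandroff_compactification by (auto simp: Compl_eq_Diff_UNIV)
  then show "open (Some -` V) \<and> (None \<in> V \<longrightarrow> bounded (- (Some -` V)))"
  proof cases
    case 1
    then have "Some -` V = U" "None \<notin> V" by auto
    then show ?thesis using 1 by simp
  next
    case 2
    then have "Some -` V = - C" by auto
    then show ?thesis using 2 compact_imp_closed compact_imp_bounded by auto
  qed
next
  assume V: "open (Some -` V) \<and> (None \<in> V \<longrightarrow> bounded (- (Some -` V)))"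
  show "openin riemann_sphere V"
  proof (cases "None \<in> V")
    case True
    have "compact (- (Some -` V))" using V True by (auto simp: compact_eq_bounded_closed)
    moreover have "V = insert None (Some ` (UNIV - (- (Some -` V))))"
    proof (rule set_eqI)
      show "x \<in> V \<longleftrightarrow> x \<in> insert None (Some ` (UNIV - (- (Some -` V))))" for x
        using True by (cases x) auto
    qed
    ultimately show ?thesis
      unfolding riemann_sphere_def openin_Alexandroff_compactification
      by (intro disjI2) (auto intro!: exI[of _ "- (Some -` V)"] simp: compact_imp_closed)
  next
    case False
    have "V = Some ` (Some -` V)"
    proof (rule set_eqI)
      show "x \<in> V \<longleftrightarrow> x \<in> Some ` (Some -` V)" for x using False by (cases x) auto
    qed
    then show ?thesis using V unfolding riemann_sphere_def openin_Alexandroff_compactification by auto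
  qed
qed

lemma topspace_riemann_sphere [simp]: "topspace riemann_sphere = UNIV"
  by (auto simp: riemann_sphere_def UNIV_option_conv)

lemma continuous_map_map_option:
  assumes cont: "continuous_on UNIV g" and proper: "\<And>B. bounded {z. norm (g z) \<le> B}"
  shows "continuous_map riemann_sphere riemann_sphere (map_option g)"
  unfolding continuous_map_def
proof (intro conjI allI impI)
  fix V assume "openin riemann_sphere V"
  then have V: "open (Some -` V)" "None \<in> V \<Longrightarrow> bounded (- (Some -` V))" by (auto simp: openin_riemann_sphere_iff)
  have eq: "Some -` {x \<in> topspace riemann_sphere. map_option g x \<in> V} = g -` (Some -` V)" by auto
  show "openin riemann_sphere {x \<in> topspace riemann_sphere. map_option g x \<in> V}"
    unfolding openin_riemann_sphere_iff eq
  proof (intro conjI impI)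
    show "open (g -` Some -` V)" using cont V(1) by (intro open_vimage) auto
    assume "None \<in> {x \<in> topspace riemann_sphere. map_option g x \<in> V}"
    then have "bounded (- (Some -` V))" using V(2) by auto
    then obtain B where "\<forall>z\<in>- (Some -` V). norm z \<le> B" by (auto simp: bounded_iff)
    then show "bounded (- g -` Some -` V)" by (intro bounded_subset[OF proper[of B]]) auto
  qed
qed simp

lemma continuous_map_sphere_inv: "continuous_map riemann_sphere riemann_sphere sphere_inv"
  unfolding continuous_map_def
proof (intro conjI allI impI)
  fix V assume "openin riemann_sphere V"
  then have V: "open (Some -` V)" "None \<in> V \<Longrightarrow> bounded (- (Some -` V))" by (auto simp: openin_riemann_sphere_iff)
  define W where "W = {x \<in> topspace riemann_sphere. sphere_inv x \<in> V}"
  have W: "Some -` W = ((\<lambda>z. 1 / z) -` (Some -` V) \<inter> (- {0})) \<union> (if None \<in> V then {0} else {})"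
    by (auto simp: W_def sphere_inv_def split: if_splits)
  have o: "open ((\<lambda>z::complex. 1 / z) -` (Some -` V) \<inter> (- {0}))"
  proof -
    have "open (- {0} \<inter> (\<lambda>z::complex. 1 / z) -` (Some -` V))"
      by (rule continuous_open_preimage[OF _ _ V(1)]) (auto intro!: continuous_intros)
    then show ?thesis by (simp only: Int_commute)
  qed
  have "openin riemann_sphere W"
    unfolding openin_riemann_sphere_iff
  proof (intro conjI impI)
    show "open (Some -` W)"
    proof (cases "None \<in> V")
      case True
      then obtain B where B: "\<And>z. Some z \<notin> V \<Longrightarrow> norm z \<le> B" using V(2) by (auto simp: bounded_iff)
      define b where "b = max B 1"
      have b: "b > 0" "\<And>z. norm z > b \<Longrightarrow> Some z \<in> V" using B by (force simp: b_def)+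
      have "Some -` W = ((\<lambda>z::complex. 1 / z) -` (Some -` V) \<inter> (- {0})) \<union> ball 0 (1 / b)"
      proof -
        have "Some (1 / z) \<in> V" if "norm z < 1 / b" "z \<noteq> 0" for z
          using that b(1) by (intro b(2)) (simp add: norm_divide field_simps)
        then show ?thesis unfolding W using True b(1) by auto
      qed
      then show ?thesis using open_Un[OF o open_ball] by (simp only:)
    qed (use W o in simp)
    assume "None \<in> W"
    then have "0 \<in> Some -` V" by (simp add: W_def sphere_inv_def)
    then obtain r where r: "r > 0" "ball 0 r \<subseteq> Some -` V" using V(1) open_contains_ball by blast
    show "bounded (- (Some -` W))"
    proof (rule boundedI)
      fix z assume z: "z \<in> - (Some -` W)"
      show "norm z \<le> 1 / r"
      proof (cases "z = 0")
        case False
        then have "1 / z \<notin> ball 0 r" using z r unfolding W by auto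
        then show ?thesis using False r by (simp add: norm_divide field_simps)
      qed (use r in auto)
    qed
  qed
  then show "openin riemann_sphere {x \<in> topspace riemann_sphere. sphere_inv x \<in> V}" by (simp add: W_def)
qed simp

text \<open>A continuous bijection from a compact space to a Hausdorff space.\<close>
lemma homeomorphic_map_riemann_sphereI:
  assumes "continuous_map riemann_sphere riemann_sphere F" "bij F"
  shows "homeomorphic_map riemann_sphere riemann_sphere F"
proof (rule continuous_imp_homeomorphic_map)
  show "compact_space riemann_sphere" "Hausdorff_space riemann_sphere"
    by (auto simp: riemann_sphere_def Hausdorff_space_Alexandroff_compactification locally_compact_space_euclidean)
qed (use assms in \<open>auto simp: bij_def\<close>)

text \<open>Invariance of domain supplies the homeomorphism, and the point \<open>pt\<close> fixes the orientation.\<close>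
lemma quasiconformal_onI:
  assumes U: "open U" "connected U" and lip: "locally_Lipschitz_on U g" and inj: "inj_on g U"
    and pt: "pt \<in> U" "(g has_field_derivative A) (at pt)" "A \<noteq> 0"
    and N: "negligible N"
    and diff: "\<And>z. z \<in> U - N \<Longrightarrow> \<exists>A B. (g has_derivative (\<lambda>x. A * x + B * cnj x)) (at z) \<and> cmod B \<le> k * cmod A"
  shows "quasiconformal_on k U g"
proof -
  have cont: "continuous_on U g" using lip by (rule locally_Lipschitz_imp_continuous_on)
  have "open (g ` U)" using cont U inj by (intro invariance_of_domain)
  moreover have "\<exists>g'. homeomorphism U (g ` U) g g'"     by (rule invariance_of_domain_homeomorphism[OF U(1) cont _ inj]) auto
  moreover have "orientation_preserving_on U g"
    by (rule orientation_preserving_if_injective[OF U cont inj pt])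
  ultimately show ?thesis
    unfolding quasiconformal_on_def using U weak_wirtinger_of_AE_differentiable[OF U(1) lip N diff] by blast
qed

lemma locally_Lipschitz_on_holomorphic:
  assumes "f holomorphic_on S" "open S" "z \<in> S"
  shows "\<exists>r>0. \<exists>M. M-lipschitz_on (ball z r) f"
proof -
  obtain r where r: "r > 0" "cball z r \<subseteq> S" using assms by (meson open_contains_cball)
  have "continuous_on (cball z r) (deriv f)"
    using assms r by (intro holomorphic_on_imp_continuous_on holomorphic_deriv holomorphic_on_subset[OF _ r(2)]) auto
  then obtain B where B: "B \<ge> 0" "\<And>w. w \<in> cball z r \<Longrightarrow> norm (deriv f w) \<le> B"
    using continuous_on_compact_bound[of "cball z r" "deriv f"] by auto
  have "B-lipschitz_on (ball z r) f"
  proof (rule lipschitz_onI)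
    fix x y assume xy: "x \<in> ball z r" "y \<in> ball z r"
    have "norm (f x - f y) \<le> B * norm (x - y)"
    proof (rule field_differentiable_bound[OF convex_ball[of z r]])
      fix w assume w: "w \<in> ball z r"
      then show "norm (deriv f w) \<le> B" using B by auto
      have "w \<in> S" using w r(2) by auto
      then show "(f has_field_derivative deriv f w) (at w within ball z r)"
        by (rule holomorphic_derivI[OF assms(1,2)])
    qed (use xy in auto)
    then show "dist (f x) (f y) \<le> B * dist x y" by (simp add: dist_norm)
  qed (rule B)
  then show ?thesis using r by blast
qed

lemma locally_Lipschitz_compose:
  assumes "\<exists>r>0. \<exists>M. M-lipschitz_on (ball z r) (f::complex\<Rightarrow>complex)" "\<exists>r>0. \<exists>M. M-lipschitz_on (ball (f z) r) (g::complex\<Rightarrow>complex)"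
    and "\<exists>r>0. \<forall>w\<in>ball z r. h w = g (f w)"
  shows "\<exists>r>0. \<exists>M. M-lipschitz_on (ball z r) h"
proof -
  obtain r1 M1 where 1: "r1 > 0" "M1-lipschitz_on (ball z r1) f" using assms(1) by blast
  obtain r2 M2 where 2: "r2 > 0" "M2-lipschitz_on (ball (f z) r2) g" using assms(2) by blast
  obtain r3 where 3: "r3 > 0" "\<And>w. w \<in> ball z r3 \<Longrightarrow> h w = g (f w)" using assms(3) by blast
  have "continuous_on (ball z r1) f" using 1(2) by (rule lipschitz_on_continuous_on)
  then have "isCont f z" using 1 by (simp add: continuous_on_eq_continuous_at)
  then obtain d where d: "d > 0" "\<And>w. dist w z < d \<Longrightarrow> dist (f w) (f z) < r2"
    using 2(1) unfolding continuous_at_eps_delta by blast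
  define r where "r = Min {r1, r3, d}"
  have r: "r > 0" "r \<le> r1" "r \<le> r3" "r \<le> d" using 1 3 d by (auto simp: r_def)
  have "f ` ball z r \<subseteq> ball (f z) r2" using d(2) r by (auto simp: dist_commute)
  then have "(M2 * M1)-lipschitz_on (ball z r) (\<lambda>w. g (f w))"
    using r by (intro lipschitz_on_compose2 lipschitz_on_subset[OF 1(2)] lipschitz_on_subset[OF 2(2)]) auto
  then have "(M2 * M1)-lipschitz_on (ball z r) h"
    by (rule lipschitz_on_transform) (use 3(2) r in auto)
  then show ?thesis using r by blast
qed

text \<open>A global quasiconformal map of the plane, in the pointwise form that survives composition with
Moebius maps. Linear growth makes the map Lipschitz in the chart at infinity as well; the set \<open>S\<close>
serves to fix the orientation.\<close>
locale qc_plane_map =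
  fixes G :: "complex \<Rightarrow> complex" and k M m R :: real and N S :: "complex set"
  assumes inj: "inj G" and lip: "M-lipschitz_on UNIV G"
    and pos: "0 < m" "0 < R" and low: "\<And>\<xi>. R \<le> norm \<xi> \<Longrightarrow> m * norm \<xi> \<le> norm (G \<xi>)"
    and N: "negligible N"
    and beltrami: "\<And>\<xi>. \<xi> \<notin> N \<Longrightarrow> \<exists>A B. (G has_derivative (\<lambda>x. A * x + B * cnj x)) (at \<xi>) \<and> cmod B \<le> k * cmod A"
    and S: "open S" "S \<noteq> {}" and conf: "\<And>\<xi>. \<xi> \<in> S \<Longrightarrow> \<exists>A. A \<noteq> 0 \<and> (G has_field_derivative A) (at \<xi>)"
begin

lemma cont: "continuous_on UNIV G" using lip by (rule lipschitz_on_continuous_on)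

lemma proper: "bounded {\<xi>. norm (G \<xi>) \<le> B}"
proof (rule boundedI)
  fix \<xi> assume \<xi>: "\<xi> \<in> {\<xi>. norm (G \<xi>) \<le> B}"
  show "norm \<xi> \<le> max R (B / m)"
  proof (cases "R \<le> norm \<xi>")
    case True
    then have "m * norm \<xi> \<le> B" using low \<xi> by force
    then show ?thesis using pos by (simp add: field_simps le_max_iff_disj)
  qed auto
qed

lemma surj: "surj G"
proof -
  have op: "open (range G)" using cont inj by (intro invariance_of_domain) auto
  have cl: "closed (range G)"
    unfolding closed_sequential_limits
  proof (intro allI impI, elim conjE)
    fix x l assume x: "\<forall>n. x n \<in> range G" "x \<longlonglongrightarrow> l"
    then have "\<forall>n. \<exists>y. x n = G y" by blast
    then obtain \<xi> where \<xi>: "\<And>n. x n = G (\<xi> n)" by (auto dest: choice)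
    have "bounded (range x)" using x(2) by (rule convergent_imp_bounded)
    then obtain B where "\<And>n. norm (x n) \<le> B" by (auto simp: bounded_iff)
    then have "bounded (range \<xi>)" using \<xi> by (intro bounded_subset[OF proper[of B]]) auto
    then obtain l' r where lr: "strict_mono r" "(\<xi> \<circ> r) \<longlonglongrightarrow> l'" using bounded_imp_convergent_subsequence by blast
    have "isCont G l'" using cont by (simp add: continuous_on_eq_continuous_at)
    then have "(\<lambda>n. G ((\<xi> \<circ> r) n)) \<longlonglongrightarrow> G l'" using lr(2) by (rule isCont_tendsto_compose)
    moreover have "(\<lambda>n. G ((\<xi> \<circ> r) n)) \<longlonglongrightarrow> l" using LIMSEQ_subseq_LIMSEQ[OF x(2) lr(1)] \<xi> by (simp add: o_def)
    ultimately show "l \<in> range G" using LIMSEQ_unique by blast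
  qed
  have "range G = {} \<or> range G = UNIV" using connected_clopen[of "UNIV :: complex set"] op cl by auto
  then show ?thesis by auto
qed

text \<open>\<open>\<bar>1 / G(1/x) - 1 / G(1/y)\<bar>\<close> is at most \<open>M \<bar>1/y - 1/x\<bar>\<close> divided by \<open>\<bar>G(1/x)\<bar> \<bar>G(1/y)\<bar>\<close>, and linear growth
bounds that denominator below by a multiple of \<open>1 / \<bar>x y\<bar>\<close>.\<close>
lemma Lipschitz_at_infinity:
  "\<exists>r>0. \<exists>C. C-lipschitz_on (ball 0 r) (\<lambda>v. if v = 0 then 0 else 1 / G (1 / v))"
proof -
  let ?\<Gamma> = "\<lambda>v. if v = 0 then 0 else 1 / G (1 / v)"
  define C where "C = max (1 / m) (M / m^2)"
  have M0: "M \<ge> 0" using lip by (rule lipschitz_on_nonneg)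
  have C: "C \<ge> 0" "1 / m \<le> C" "M / m^2 \<le> C" using pos by (auto simp: C_def le_max_iff_disj)
  have lo: "m / norm v \<le> norm (G (1 / v))" if "v \<in> ball 0 (1 / R)" "v \<noteq> 0" for v
  proof -
    have "R \<le> norm (1 / v)" using that pos by (auto simp: norm_divide field_simps)
    from low[OF this] show ?thesis by (simp add: norm_divide)
  qed
  have nz: "norm (1 / G (1 / v)) \<le> (1 / m) * norm v" if "v \<in> ball 0 (1 / R)" "v \<noteq> 0" for v
  proof -
    have "0 < m / norm v" using pos that by simp
    then have "1 / norm (G (1 / v)) \<le> 1 / (m / norm v)" using lo[OF that] by (intro divide_left_mono mult_pos_pos) auto
    then show ?thesis by (simp add: norm_divide)
  qed
  have "C-lipschitz_on (ball 0 (1 / R)) ?\<Gamma>"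
  proof (rule lipschitz_onI)
    fix x y :: complex assume xy: "x \<in> ball 0 (1 / R)" "y \<in> ball 0 (1 / R)"
    have one: "norm (1 / G (1 / v)) \<le> C * norm v" if "v \<in> ball 0 (1 / R)" "v \<noteq> 0" for v
      using nz[OF that] C(2) by (meson mult_right_mono norm_ge_zero order_trans)
    show "dist (?\<Gamma> x) (?\<Gamma> y) \<le> C * dist x y"
    proof (cases "x = 0 \<or> y = 0")
      case True
      then show ?thesis using one[OF xy(1)] one[OF xy(2)] C(1) by (auto simp: dist_norm)
    next
      case False
      have "0 < m / norm x" "0 < m / norm y" using pos False by auto
      then have G0: "G (1/x) \<noteq> 0" "G (1/y) \<noteq> 0" using lo[of x] lo[of y] xy False by auto
      have "1 / G (1/x) - 1 / G (1/y) = (G (1/y) - G (1/x)) * (1 / G (1/x)) * (1 / G (1/y))"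
        using G0 by (simp add: field_simps)
      then have "norm (1 / G (1/x) - 1 / G (1/y)) = norm (G (1/y) - G (1/x)) * norm (1 / G (1/x)) * norm (1 / G (1/y))"
        by (simp only: norm_mult)
      also have "\<dots> \<le> (M * norm (1/y - 1/x)) * ((1/m) * norm x) * ((1/m) * norm y)"
        using lipschitz_onD[OF lip, of "1/y" "1/x"] nz[of x] nz[of y] xy False pos M0
        by (intro mult_mono) (auto simp: dist_norm)
      also have "norm (1/y - 1/x) = norm (x - y) / (norm x * norm y)"
        using False by (simp add: norm_divide[symmetric] norm_mult[symmetric] field_simps)
      also have "(M * (norm (x - y) / (norm x * norm y))) * ((1/m) * norm x) * ((1/m) * norm y) = M / m^2 * norm (x - y)"
        using False pos by (simp add: field_simps power2_eq_square)
      also have "\<dots> \<le> C * norm (x - y)" using C(3) by (intro mult_right_mono) auto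
      finally show ?thesis using False by (simp add: dist_norm)
    qed
  qed (rule C)
  then show ?thesis using pos by (intro exI[of _ "1 / R"]) auto
qed

text \<open>The two source charts of the sphere, composed with a Moebius map that sends \<open>pole\<close> to infinity, are
treated at once: \<open>pre\<close> is the chart away from the pole and \<open>rpre\<close> its reciprocal near the pole. The value
\<open>d\<close> is what a coordinate representation returns outside its domain.\<close>
lemma chart:
  assumes pre: "pre holomorphic_on - {pole}" "inj_on pre (- {pole})" "pre ` (- {pole}) = - {q}"
    and rpre: "rpre holomorphic_on T" "open T" "pole \<in> T" "rpre pole = 0"
      "\<And>w. w \<in> T - {pole} \<Longrightarrow> rpre w \<noteq> 0 \<and> pre w = 1 / rpre w"
  shows "quasiconformal_on k (- {pole}) (\<lambda>w. if w = pole then d else G (pre w))"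
    and "quasiconformal_on k {w. w = pole \<or> G (pre w) \<noteq> 0}
           (\<lambda>w. if w = pole then 0 else if G (pre w) = 0 then d else 1 / G (pre w))"
proof -
  define N' where "N' = {pole} \<union> {w \<in> - {pole}. pre w \<in> N}"
  have dpre: "(pre has_field_derivative deriv pre w) (at w)" "deriv pre w \<noteq> 0" if "w \<noteq> pole" for w
    using holomorphic_derivI[OF pre(1), of w] holomorphic_injective_imp_regular[OF pre(1) _ pre(2), of w] that by auto
  have N': "negligible N'"
    unfolding N'_def
  proof (intro negligible_Un negligible_sing negligible_differentiable_vimage[OF N])
    show "inj (\<lambda>h. deriv pre w * h)" if "w \<in> - {pole}" for w using dpre(2)[of w] that by (auto simp: inj_def)
    show "(pre has_derivative (*) (deriv pre w)) (at w within - {pole})" if "w \<in> - {pole}" for w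
      using dpre(1)[of w] that by (auto simp: has_field_derivative_def intro: has_derivative_at_withinI)
  qed
  have dif: "\<exists>A B. ((\<lambda>w. G (pre w)) has_derivative (\<lambda>x. A * x + B * cnj x)) (at w) \<and> cmod B \<le> k * cmod A"
    if w: "w \<notin> N'" for w
  proof -
    have wp: "w \<noteq> pole" "pre w \<notin> N" using w by (auto simp: N'_def)
    obtain A B where AB: "(G has_derivative (\<lambda>x. A * x + B * cnj x)) (at (pre w))" "cmod B \<le> k * cmod A"
      using beltrami[OF wp(2)] by blast
    define p where "p = deriv pre w"
    have "((\<lambda>w. G (pre w)) has_derivative (\<lambda>x. A * (p * x) + B * cnj (p * x))) (at w)"
    proof -
      have "(pre has_derivative (\<lambda>x. p * x)) (at w)"
        using dpre(1)[OF wp(1)] unfolding p_def has_field_derivative_def .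
      from has_derivative_compose[OF this AB(1)] show ?thesis .
    qed
    moreover have "cmod (B * cnj p) \<le> k * cmod (A * p)"
      using mult_right_mono[OF AB(2), of "cmod p"] by (simp add: norm_mult mult.assoc)
    ultimately show ?thesis by (intro exI[of _ "A * p"] exI[of _ "B * cnj p"]) (simp add: mult.assoc)
  qed
  have lipG: "\<exists>r>0. \<exists>C. C-lipschitz_on (ball w r) (\<lambda>w. G (pre w))" if w: "w \<noteq> pole" for w
  proof (rule locally_Lipschitz_compose)
    show "\<exists>r>0. \<exists>M. M-lipschitz_on (ball w r) pre"
      using w by (intro locally_Lipschitz_on_holomorphic[OF pre(1)]) auto
    show "\<exists>r>0. \<exists>M. M-lipschitz_on (ball (pre w) r) G"
      using lip by (intro exI[of _ 1] conjI exI[of _ M]) (auto intro: lipschitz_on_subset)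
  qed (auto intro: exI[of _ 1])
  have "infinite S" using S by (meson finite_imp_not_open)
  moreover obtain \<xi>1 where \<xi>1: "G \<xi>1 = 0" using surj by (metis surj_def)
  ultimately obtain \<xi>0 where \<xi>0: "\<xi>0 \<in> S" "\<xi>0 \<noteq> q" "\<xi>0 \<noteq> \<xi>1"
    using infinite_super[of S "{q, \<xi>1}"] by blast
  then have G\<xi>0: "G \<xi>0 \<noteq> 0" using \<xi>1 inj by (auto simp: inj_def)
  obtain w0 where w0: "w0 \<noteq> pole" "pre w0 = \<xi>0" using pre(3) \<xi>0(2) by (metis (mono_tags, lifting) ComplD ComplI imageE singletonI singletonD)
  obtain A0 where A0: "A0 \<noteq> 0" "(G has_field_derivative A0) (at (pre w0))" using conf \<xi>0(1) w0 by blast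
  have d0: "((\<lambda>w. G (pre w)) has_field_derivative A0 * deriv pre w0) (at w0)" "A0 * deriv pre w0 \<noteq> 0"
    using DERIV_chain2[OF A0(2) dpre(1)[OF w0(1)]] A0(1) dpre(2)[OF w0(1)] by auto
  let ?g = "\<lambda>w. if w = pole then d else G (pre w)"
  have open1: "open (- {pole})" by auto
  show "quasiconformal_on k (- {pole}) ?g"
  proof (rule quasiconformal_onI[OF open1, where pt=w0 and N=N'])
    show "connected (- {pole})" by (intro connected_punctured_universe) simp
    show "locally_Lipschitz_on (- {pole}) ?g"
      unfolding locally_Lipschitz_on_def
    proof
      fix w assume w: "w \<in> - {pole}"
      show "\<exists>r>0. \<exists>C. C-lipschitz_on (ball w r) ?g"
        by (rule locally_Lipschitz_compose[where f="\<lambda>w. G (pre w)" and g="\<lambda>x. x"])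
           (use w lipG[of w] in \<open>auto intro: exI[of _ "1::real"] exI[of _ "dist w pole"] lipschitz_on_id zero_less_one\<close>)
    qed
    show "inj_on ?g (- {pole})"
    proof (rule inj_onI)
      fix x y assume xy: "x \<in> - {pole}" "y \<in> - {pole}" "?g x = ?g y"
      then have "pre x = pre y" using injD[OF inj, of "pre x" "pre y"] by simp
      then show "x = y" using xy inj_on_eq_iff[OF pre(2)] by blast
    qed
    show "(?g has_field_derivative A0 * deriv pre w0) (at w0)"
      by (rule has_field_derivative_transform_within_open[OF d0(1) open1]) (use w0 in auto)
    fix w assume w: "w \<in> - {pole} - N'"
    obtain A B where AB: "((\<lambda>w. G (pre w)) has_derivative (\<lambda>x. A * x + B * cnj x)) (at w)" "cmod B \<le> k * cmod A"
      using dif w by blast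
    have "(?g has_derivative (\<lambda>x. A * x + B * cnj x)) (at w)"
      by (rule has_derivative_transform_within_open[OF AB(1) open1]) (use w in auto)
    then show "\<exists>A B. (?g has_derivative (\<lambda>x. A * x + B * cnj x)) (at w) \<and> cmod B \<le> k * cmod A" using AB by blast
  qed (use w0 d0 N' in auto)
  let ?U = "{w. w = pole \<or> G (pre w) \<noteq> 0}"
  let ?h = "\<lambda>w. if w = pole then 0 else if G (pre w) = 0 then d else 1 / G (pre w)"
  obtain z0 where U: "?U = UNIV \<or> ?U = - {z0}"
  proof (cases "?U = UNIV")
    case False
    then obtain z0 where z0: "z0 \<noteq> pole" "G (pre z0) = 0" by auto
    have "w = z0" if "w \<noteq> pole" "G (pre w) = 0" for w
    proof -
      have "pre w = pre z0" using z0 that inj by (auto simp: inj_def)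
      then show ?thesis using pre(2) z0 that by (auto simp: inj_on_def)
    qed
    then have "?U = - {z0}" using z0 by blast
    then show ?thesis using that by blast
  qed (use that in blast)
  have oU: "open ?U" using U by (elim disjE) (simp_all only:, auto)
  have oU': "open (?U - {pole})" using oU by (rule open_delete)
  show "quasiconformal_on k ?U ?h"
  proof (rule quasiconformal_onI[OF oU, where pt=w0 and N=N'])
    show "connected ?U" using U connected_punctured_universe[of z0] by (elim disjE) (simp_all only:, auto)
    show "locally_Lipschitz_on ?U ?h"
      unfolding locally_Lipschitz_on_def
    proof
      fix w assume w: "w \<in> ?U"
      show "\<exists>r>0. \<exists>C. C-lipschitz_on (ball w r) ?h"
      proof (cases "w = pole")
        case True
        obtain r where r: "r > 0" "ball pole r \<subseteq> T" using rpre(2,3) open_contains_ball by blast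
        obtain s where s: "s > 0" "ball pole s \<subseteq> ?U" using oU open_contains_ball[of ?U] by blast
        show ?thesis
        proof (rule locally_Lipschitz_compose[where f=rpre and g="\<lambda>v. if v = 0 then 0 else 1 / G (1 / v)"])
          show "\<exists>r>0. \<exists>C. C-lipschitz_on (ball w r) rpre"
            using locally_Lipschitz_on_holomorphic[OF rpre(1,2,3)] True by simp
          show "\<exists>r>0. \<exists>C. C-lipschitz_on (ball (rpre w) r) (\<lambda>v. if v = 0 then 0 else 1 / G (1 / v))"
            using Lipschitz_at_infinity rpre(4) True by simp
          show "\<exists>r>0. \<forall>x\<in>ball w r. ?h x = (if rpre x = 0 then 0 else 1 / G (1 / rpre x))"
          proof (intro exI[of _ "min r s"] conjI ballI)
            fix x assume x: "x \<in> ball w (min r s)"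
            show "?h x = (if rpre x = 0 then 0 else 1 / G (1 / rpre x))"
            proof (cases "x = pole")
              case False
              have "x \<in> T" "x \<in> ?U" using x r s True by auto
              then show ?thesis using rpre(5)[of x] False by auto
            qed (use rpre(4) in simp)
          qed (use r s in auto)
        qed
      next
        case False
        then have G0: "G (pre w) \<noteq> 0" using w by simp
        obtain s where s: "s > 0" "ball w s \<subseteq> ?U - {pole}" using oU' open_contains_ball[of "?U - {pole}"] False w by blast
        show ?thesis
        proof (rule locally_Lipschitz_compose[where f="\<lambda>w. G (pre w)" and g="\<lambda>v. 1 / v"])
          show "\<exists>r>0. \<exists>C. C-lipschitz_on (ball (G (pre w)) r) (\<lambda>v. 1 / v)"
            by (rule locally_Lipschitz_on_holomorphic[of _ "- {0}"]) (use G0 in \<open>auto intro!: holomorphic_intros\<close>)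
          show "\<exists>r>0. \<forall>x\<in>ball w r. ?h x = 1 / G (pre x)"
            using s by (intro exI[of _ s]) (auto dest!: subsetD)
        qed (use lipG False in auto)
      qed
    qed
    show "inj_on ?h ?U"
    proof (rule inj_onI)
      fix x y assume xy: "x \<in> ?U" "y \<in> ?U" "?h x = ?h y"
      show "x = y"
      proof (cases "x = pole \<or> y = pole")
        case True
        then show ?thesis using xy by (auto split: if_splits)
      next
        case False
        then have "G (pre x) = G (pre y)" using xy by simp
        then have "pre x = pre y" by (rule injD[OF inj])
        then show ?thesis using False inj_on_eq_iff[OF pre(2)] by simp
      qed
    qed
    show "w0 \<in> ?U" using w0 G\<xi>0 by auto
    have w0U: "w0 \<in> ?U - {pole}" using w0 G\<xi>0 by auto
    have "((\<lambda>w. 1 / G (pre w)) has_field_derivative - (A0 * deriv pre w0) / (G (pre w0) * G (pre w0))) (at w0)"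
      using w0 G\<xi>0 by (auto intro!: derivative_eq_intros d0(1))
    then show "(?h has_field_derivative - (A0 * deriv pre w0) / (G (pre w0) * G (pre w0))) (at w0)"
      by (rule has_field_derivative_transform_within_open[OF _ oU' w0U]) auto
    show "- (A0 * deriv pre w0) / (G (pre w0) * G (pre w0)) \<noteq> 0" using d0(2) w0 G\<xi>0 by auto
    fix w assume w: "w \<in> ?U - N'"
    then have w': "w \<in> ?U - {pole}" "G (pre w) \<noteq> 0" by (auto simp: N'_def)
    obtain A B where AB: "((\<lambda>w. G (pre w)) has_derivative (\<lambda>x. A * x + B * cnj x)) (at w)" "cmod B \<le> k * cmod A"
      using dif w by blast
    define b where "b = - 1 / (G (pre w) * G (pre w))"
    have "((\<lambda>v. 1 / v) has_derivative (\<lambda>x. b * x)) (at (G (pre w)))"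
      using w'(2) unfolding b_def by (auto intro!: derivative_eq_intros simp: field_simps)
    from has_derivative_compose[OF AB(1) this]
    have "((\<lambda>w. 1 / G (pre w)) has_derivative (\<lambda>x. b * (A * x + B * cnj x))) (at w)" .
    then have "(?h has_derivative (\<lambda>x. b * (A * x + B * cnj x))) (at w)"
      by (rule has_derivative_transform_within_open[OF _ oU' w'(1)]) auto
    moreover have "cmod (b * B) \<le> k * cmod (b * A)"
      using mult_left_mono[OF AB(2), of "cmod b"] by (simp add: norm_mult mult.left_commute)
    ultimately show "\<exists>A B. (?h has_derivative (\<lambda>x. A * x + B * cnj x)) (at w) \<and> cmod B \<le> k * cmod A"
      by (intro exI[of _ "b * A"] exI[of _ "b * B"]) (simp add: algebra_simps)
  qed (use N' in auto)
qed

lemma quasiconformal_sphere: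
  assumes c: "c \<noteq> 0"
  shows "quasiconformal_sphere k (map_option G \<circ> sphere_inv \<circ> map_option (\<lambda>w. w + c))" (is "quasiconformal_sphere k ?F")
proof -
  have inv2: "sphere_inv (sphere_inv x) = x" for x by (cases x) (auto simp: sphere_inv_def)
  have "bij sphere_inv" by (rule involuntory_imp_bij) (rule inv2)
  moreover have "bij (map_option G)" 
  proof (intro bijI option.inj_map inj surjI)
    show "map_option G (map_option (inv G) x) = x" for x using surj by (cases x) (auto simp: surj_f_inv_f)
  qed
  moreover have "bij (map_option (\<lambda>w. w + c))" 
    by (rule o_bij[of "map_option (\<lambda>w. w - c)"]) (auto simp: fun_eq_iff option.map_comp o_def option.map_ident)
  ultimately have bij: "bij ?F" by (intro bij_comp)
  have ct: "continuous_map riemann_sphere riemann_sphere (map_option (\<lambda>w. w + c))"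
  proof (rule continuous_map_map_option)
    show "bounded {z. norm (z + c) \<le> B}" for B
    proof (rule boundedI)
      fix z assume "z \<in> {z. norm (z + c) \<le> B}"
      then show "norm z \<le> B + norm c" using norm_triangle_ineq4[of "z + c" c] by simp
    qed
  qed (auto intro!: continuous_intros)
  have "continuous_map riemann_sphere riemann_sphere ?F"
    using continuous_map_compose[OF continuous_map_compose[OF ct continuous_map_sphere_inv] continuous_map_map_option[OF cont proper]]
    by (simp add: o_assoc)
  then have hom: "homeomorphic_map riemann_sphere riemann_sphere ?F" using bij by (rule homeomorphic_map_riemann_sphereI)
  have charts: "quasiconformal_on k {z. (\<alpha> \<circ> \<Phi>) (Some z) \<noteq> None} (\<lambda>z. the ((\<alpha> \<circ> \<Phi>) (Some z)))"
    if \<Phi>: "\<And>w. \<Phi> (Some w) = (if w = pole then None else Some (G (pre w)))" and \<alpha>: "\<alpha> \<in> {id, sphere_inv}"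
      and pre: "pre holomorphic_on - {pole}" "inj_on pre (- {pole})" "pre ` (- {pole}) = - {q}"
      and rpre: "rpre holomorphic_on T" "open T" "pole \<in> T" "rpre pole = 0"
      "\<And>w. w \<in> T - {pole} \<Longrightarrow> rpre w \<noteq> 0 \<and> pre w = 1 / rpre w"
    for \<alpha> \<Phi> pole pre q rpre T
  proof -
    note ch = chart[OF pre rpre]
    from \<alpha> consider "\<alpha> = id" | "\<alpha> = sphere_inv" by blast
    then show ?thesis
    proof cases
      case 1
      have "{z. (\<alpha> \<circ> \<Phi>) (Some z) \<noteq> None} = - {pole}" using 1 \<Phi> by auto
      moreover have "(\<lambda>z. the ((\<alpha> \<circ> \<Phi>) (Some z))) = (\<lambda>w. if w = pole then the None else G (pre w))"
        using 1 \<Phi> by auto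
      ultimately show ?thesis using ch(1)[of "the None"] by simp
    next
      case 2
      have "{z. (\<alpha> \<circ> \<Phi>) (Some z) \<noteq> None} = {w. w = pole \<or> G (pre w) \<noteq> 0}" 
        using 2 \<Phi> by (auto simp: sphere_inv_def)
      moreover have "(\<lambda>z. the ((\<alpha> \<circ> \<Phi>) (Some z))) = (\<lambda>w. if w = pole then 0 else if G (pre w) = 0 then the None else 1 / G (pre w))"
        using 2 \<Phi> by (auto simp: sphere_inv_def fun_eq_iff)
      ultimately show ?thesis using ch(2)[of "the None"] by simp
    qed
  qed
  have "quasiconformal_on k {z. (\<alpha> \<circ> ?F \<circ> \<beta>) (Some z) \<noteq> None} (\<lambda>z. the ((\<alpha> \<circ> ?F \<circ> \<beta>) (Some z)))"
    if \<alpha>: "\<alpha> \<in> {id, sphere_inv}" and \<beta>: "\<beta> \<in> {id, sphere_inv}" for \<alpha> \<beta>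
  proof -
    from \<beta> consider "\<beta> = id" | "\<beta> = sphere_inv" by blast
    then show ?thesis
    proof cases
      case 1
      have im: "(\<lambda>w. 1 / (w + c)) ` (- {- c}) = - {0}"
      proof (intro equalityI subsetI)
        fix x assume "x \<in> - {0::complex}"
        then show "x \<in> (\<lambda>w. 1 / (w + c)) ` (- {- c})" by (intro image_eqI[of _ _ "1 / x - c"]) (auto simp: field_simps)
      qed (auto simp: add_eq_0_iff2)
      show ?thesis unfolding 1 comp_id
      proof (rule charts[OF _ \<alpha>, of _ "- c" "\<lambda>w. 1 / (w + c)" 0 "\<lambda>w. w + c" UNIV])
        show "?F (Some w) = (if w = - c then None else Some (G (1 / (w + c))))" for w
          by (auto simp: sphere_inv_def add_eq_0_iff2)
        show "(\<lambda>w. 1 / (w + c)) holomorphic_on - {- c}" by (intro holomorphic_intros) (auto simp: add_eq_0_iff2)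
        show "inj_on (\<lambda>w. 1 / (w + c)) (- {- c})" by (auto simp: inj_on_def)
      qed (use im in \<open>auto intro!: holomorphic_intros simp: add_eq_0_iff2\<close>)
    next
      case 2
      have nz: "1 + c * w \<noteq> 0" if "w \<noteq> - (1 / c)" for w
      proof
        assume "1 + c * w = 0"
        then have "c * w = - 1" by (simp add: add_eq_0_iff)
        then show False using c that by (simp add: field_simps)
      qed
      have im: "(\<lambda>w. w / (1 + c * w)) ` (- {- (1 / c)}) = - {1 / c}"
      proof (intro equalityI subsetI)
        fix x assume "x \<in> (\<lambda>w. w / (1 + c * w)) ` (- {- (1 / c)})"
        then show "x \<in> - {1 / c}" using nz c by (auto simp: field_simps)
      next
        fix x assume x: "x \<in> - {1 / c}"
        then have x': "1 - c * x \<noteq> 0" using c by (auto simp: field_simps)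
        have s: "1 + c * (x / (1 - c * x)) = 1 / (1 - c * x)" using x' by (simp add: field_simps)
        have "x / (1 - c * x) \<noteq> - (1 / c)"
        proof
          assume "x / (1 - c * x) = - (1 / c)"
          then have "1 + c * (x / (1 - c * x)) = 0" using c by simp
          then show False using s x' by simp
        qed
        then show "x \<in> (\<lambda>w. w / (1 + c * w)) ` (- {- (1 / c)})" using x' by (intro image_eqI[of _ _ "x / (1 - c * x)"]) (auto simp only: s, auto)
      qed
      show ?thesis unfolding 2 comp_assoc[of \<alpha>]
      proof (rule charts[OF _ \<alpha>, of _ "- (1 / c)" "\<lambda>w. w / (1 + c * w)" "1 / c" "\<lambda>w. (1 + c * w) / w" "- {0}"])
        show "(?F \<circ> sphere_inv) (Some w) = (if w = - (1 / c) then None else Some (G (w / (1 + c * w))))" for w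
        proof (cases "w = 0")
          case True
          then show ?thesis using c by (auto simp: sphere_inv_def)
        next
          case False
          have "1 / w + c = (1 + c * w) / w" using False by (simp add: field_simps)
          moreover have "1 + c * w = 0 \<longleftrightarrow> w = - (1 / c)" using c nz by auto
          ultimately show ?thesis using False by (simp add: sphere_inv_def)
        qed
        show "(\<lambda>w. w / (1 + c * w)) holomorphic_on - {- (1 / c)}" using nz by (intro holomorphic_intros) auto
        show "inj_on (\<lambda>w. w / (1 + c * w)) (- {- (1 / c)})"
        proof (rule inj_onI)
          fix x y assume "x \<in> - {- (1 / c)}" "y \<in> - {- (1 / c)}" "x / (1 + c * x) = y / (1 + c * y)"
          then show "x = y" using nz[of x] nz[of y] by (auto simp: field_simps)
        qed
        show "(1 + c * w) / w \<noteq> 0 \<and> w / (1 + c * w) = 1 / ((1 + c * w) / w)" if "w \<in> - {0} - {- (1 / c)}" for w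
          using that nz[of w] by auto
      qed (use im c in \<open>auto intro!: holomorphic_intros\<close>)
    qed
  qed
  then show ?thesis unfolding quasiconformal_sphere_def using hom by blast
qed

end

section \<open>The discs that express the dilatation bound\<close>

text \<open>The image of \<open>D\<close> under \<open>a \<mapsto> (a - c) / (2 Re c)\<close>.\<close>
definition dil_disc :: "real \<Rightarrow> complex set" where
  "dil_disc k = {\<delta>. cmod \<delta> \<le> k * cmod (1 + \<delta>)}"

text \<open>For \<open>0 \<le> k < 1\<close> and \<open>\<eta> \<noteq> 0\<close> in the closed disc, this is the set of all \<open>1 / (1 + \<delta> \<eta>)\<close> with \<open>\<delta>\<close> in
\<open>dil_disc k\<close>. In this form it is visibly an Apollonius disc, also at \<open>\<eta> = 0\<close>, where it is a point.\<close>
definition speed_disc :: "real \<Rightarrow> complex \<Rightarrow> complex set" where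
  "speed_disc k \<eta> = {v. cmod (1 - v) \<le> k * cmod (1 - (1 - \<eta>) * v)}"

definition speed_centre :: "real \<Rightarrow> complex \<Rightarrow> complex" where
  "speed_centre k \<eta> = (1 - of_real (k\<^sup>2) * (1 - cnj \<eta>)) / of_real (1 - k\<^sup>2 * (cmod (1 - \<eta>))\<^sup>2)"

definition speed_radius :: "real \<Rightarrow> complex \<Rightarrow> real" where
  "speed_radius k \<eta> = k * cmod \<eta> / (1 - k\<^sup>2 * (cmod (1 - \<eta>))\<^sup>2)"

text \<open>Completing the square in \<open>v\<close>.\<close>
lemma Apollonius_disc:
  fixes b v :: complex and k :: real
  assumes k: "0 \<le> k" "k * cmod b < 1"
  shows "cmod (1 - v) \<le> k * cmod (1 - b * v) \<longleftrightarrow>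
    cmod (v - (1 - of_real (k\<^sup>2) * cnj b) / of_real (1 - k\<^sup>2 * (cmod b)\<^sup>2)) \<le> k * cmod (1 - b) / (1 - k\<^sup>2 * (cmod b)\<^sup>2)"
proof -
  define q where "q = 1 - k\<^sup>2 * (cmod b)\<^sup>2"
  have "(k * cmod b)\<^sup>2 < 1" using k by (simp add: power_less_one_iff abs_square_less_1)
  then have q: "q > 0" by (simp add: q_def power_mult_distrib)
  have cq: "complex_of_real q \<noteq> 0" using q by simp
  have 1: "cmod (1 - v) \<le> k * cmod (1 - b * v) \<longleftrightarrow> (cmod (1 - v))\<^sup>2 \<le> (k * cmod (1 - b * v))\<^sup>2"
    using k by (intro abs_le_square_iff[of "cmod (1 - v)" "k * cmod (1 - b * v)", simplified, THEN trans[rotated]]) (auto simp: abs_mult)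
  have 2: "cmod (v - (1 - of_real (k\<^sup>2) * cnj b) / of_real q) \<le> k * cmod (1 - b) / q
      \<longleftrightarrow> (cmod (of_real q * v - (1 - of_real (k\<^sup>2) * cnj b)))\<^sup>2 \<le> (k * cmod (1 - b))\<^sup>2"
  proof -
    have "v - (1 - of_real (k\<^sup>2) * cnj b) / of_real q = (of_real q * v - (1 - of_real (k\<^sup>2) * cnj b)) / of_real q"
      using cq by (simp add: field_simps)
    then have "cmod (v - (1 - of_real (k\<^sup>2) * cnj b) / of_real q) = cmod (of_real q * v - (1 - of_real (k\<^sup>2) * cnj b)) / q"
      using q by (simp add: norm_divide)
    then have "cmod (v - (1 - of_real (k\<^sup>2) * cnj b) / of_real q) \<le> k * cmod (1 - b) / q \<longleftrightarrow>
      cmod (of_real q * v - (1 - of_real (k\<^sup>2) * cnj b)) \<le> k * cmod (1 - b)"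
      using q by (simp add: divide_le_cancel)
    then show ?thesis using k by (simp add: power_mono_iff)
  qed
  have 3: "(cmod (of_real q * v - (1 - of_real (k\<^sup>2) * cnj b)))\<^sup>2 - (k * cmod (1 - b))\<^sup>2
     = q * ((cmod (1 - v))\<^sup>2 - (k * cmod (1 - b * v))\<^sup>2)"
    unfolding q_def power_mult_distrib cmod_power2 by (simp add: power2_eq_square) algebra
  have "(cmod (1 - v))\<^sup>2 \<le> (k * cmod (1 - b * v))\<^sup>2 \<longleftrightarrow> (cmod (of_real q * v - (1 - of_real (k\<^sup>2) * cnj b)))\<^sup>2 \<le> (k * cmod (1 - b))\<^sup>2"
  proof -
    have "(cmod (1 - v))\<^sup>2 \<le> (k * cmod (1 - b * v))\<^sup>2 \<longleftrightarrow> q * ((cmod (1 - v))\<^sup>2 - (k * cmod (1 - b * v))\<^sup>2) \<le> 0"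
      using q by (simp add: mult_le_0_iff)
    then show ?thesis unfolding 3[symmetric] by simp
  qed
  then show ?thesis unfolding 1 q_def[symmetric] 2 .
qed

context
  fixes k :: real
  assumes k: "0 \<le> k" "k < 1"
begin

lemma speed_disc_eq_cball:
  assumes "\<eta> \<in> cball 1 1"
  shows "speed_disc k \<eta> = cball (speed_centre k \<eta>) (speed_radius k \<eta>)"
proof -
  have "cmod (1 - \<eta>) \<le> 1" using assms by (simp add: dist_norm)
  then have "k * cmod (1 - \<eta>) \<le> k * 1" using k by (intro mult_left_mono) auto
  then have "k * cmod (1 - \<eta>) < 1" using k by simp
  note A = Apollonius_disc[OF k(1) this, simplified]
  show ?thesis
  proof (rule set_eqI)
    show "v \<in> speed_disc k \<eta> \<longleftrightarrow> v \<in> cball (speed_centre k \<eta>) (speed_radius k \<eta>)" for v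
      unfolding speed_disc_def mem_Collect_eq mem_cball speed_centre_def speed_radius_def dist_commute[of _ v] dist_norm[of v]
      using A[of v] by simp
  qed
qed

lemma dil_disc_eq_cball: "dil_disc k = cball (of_real (k\<^sup>2 / (1 - k\<^sup>2))) (k / (1 - k\<^sup>2))"
proof -
  have k2: "1 - k\<^sup>2 > 0" using k by (simp add: power_less_one_iff abs_square_less_1)
  have "cmod \<delta> \<le> k * cmod (1 + \<delta>) \<longleftrightarrow> cmod (\<delta> - of_real (k\<^sup>2 / (1 - k\<^sup>2))) \<le> k / (1 - k\<^sup>2)" for \<delta>
  proof -
    have 1: "cmod \<delta> \<le> k * cmod (1 + \<delta>) \<longleftrightarrow> (cmod \<delta>)\<^sup>2 \<le> (k * cmod (1 + \<delta>))\<^sup>2"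
      using k by (simp add: power_mono_iff)
    have "cmod (\<delta> - of_real (k\<^sup>2 / (1 - k\<^sup>2))) = cmod (of_real (1 - k\<^sup>2) * \<delta> - of_real (k\<^sup>2)) / (1 - k\<^sup>2)"
    proof -
      have "\<delta> - of_real (k\<^sup>2 / (1 - k\<^sup>2)) = (of_real (1 - k\<^sup>2) * \<delta> - of_real (k\<^sup>2)) / of_real (1 - k\<^sup>2)"
      proof -
        have "complex_of_real (1 - k\<^sup>2) \<noteq> 0" using k2 by (simp only: of_real_eq_0_iff)
        then have "complex_of_real (1 - k\<^sup>2) * \<delta> / complex_of_real (1 - k\<^sup>2) = \<delta>"
          by (rule nonzero_mult_div_cancel_left)
        then show ?thesis unfolding of_real_divide diff_divide_distrib by (simp only:)
      qed
      then show ?thesis using k2 by (simp only: norm_divide norm_of_real abs_of_pos)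
    qed
    then have "cmod (\<delta> - of_real (k\<^sup>2 / (1 - k\<^sup>2))) \<le> k / (1 - k\<^sup>2) \<longleftrightarrow> cmod (of_real (1 - k\<^sup>2) * \<delta> - of_real (k\<^sup>2)) \<le> k"
      using k2 by (simp add: divide_le_cancel)
    also have "\<dots> \<longleftrightarrow> (cmod (of_real (1 - k\<^sup>2) * \<delta> - of_real (k\<^sup>2)))\<^sup>2 \<le> k\<^sup>2" using k by (simp add: power_mono_iff)
    also have "(cmod (of_real (1 - k\<^sup>2) * \<delta> - of_real (k\<^sup>2)))\<^sup>2 - k\<^sup>2 = (1 - k\<^sup>2) * ((cmod \<delta>)\<^sup>2 - (k * cmod (1 + \<delta>))\<^sup>2)"
      unfolding power_mult_distrib cmod_power2 by (simp add: power2_eq_square algebra_simps)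
    then have "(cmod (of_real (1 - k\<^sup>2) * \<delta> - of_real (k\<^sup>2)))\<^sup>2 \<le> k\<^sup>2 \<longleftrightarrow> (1 - k\<^sup>2) * ((cmod \<delta>)\<^sup>2 - (k * cmod (1 + \<delta>))\<^sup>2) \<le> 0" by linarith
    also have "\<dots> \<longleftrightarrow> (cmod \<delta>)\<^sup>2 \<le> (k * cmod (1 + \<delta>))\<^sup>2" using k2 by (simp add: mult_le_0_iff)
    finally show ?thesis using 1 by simp
  qed
  then show ?thesis
    unfolding dil_disc_def cball_def dist_norm norm_minus_commute[of "of_real (k\<^sup>2 / (1 - k\<^sup>2))"] by blast
qed

text \<open>All three come from \<open>\<bar>\<delta>\<bar> \<le> k \<bar>1 + \<delta>\<bar>\<close>; the third says that the disc lies in the half-plane of points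
closer to \<open>0\<close> than to \<open>-1\<close>, with a margin, because \<open>1 + 2 Re \<delta> = \<bar>1 + \<delta>\<bar>\<^sup>2 - \<bar>\<delta>\<bar>\<^sup>2\<close>.\<close>
lemma dil_disc_bounds:
  assumes "\<delta> \<in> dil_disc k"
  shows "cmod \<delta> \<le> 1 / (1 - k)" "1 / 2 \<le> cmod (1 + \<delta>)" "(1 - k\<^sup>2) / 4 \<le> 1 + 2 * Re \<delta>"
proof -
  have d: "cmod \<delta> \<le> k * cmod (1 + \<delta>)" using assms by (simp add: dil_disc_def)
  have "k * cmod (1 + \<delta>) \<le> k * (1 + cmod \<delta>)" using norm_triangle_ineq[of 1 \<delta>] k by (intro mult_left_mono) auto
  then have "cmod \<delta> \<le> k + k * cmod \<delta>" using d by (simp add: algebra_simps)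
  then have "cmod \<delta> * (1 - k) \<le> 1" using k by (simp add: algebra_simps)
  then show "cmod \<delta> \<le> 1 / (1 - k)" using k by (simp add: pos_le_divide_eq)
  have "k * cmod (1 + \<delta>) \<le> 1 * cmod (1 + \<delta>)" using k by (intro mult_right_mono) auto
  moreover have "1 \<le> cmod (1 + \<delta>) + cmod \<delta>" using norm_triangle_ineq4[of "1 + \<delta>" \<delta>] by simp
  ultimately show h: "1 / 2 \<le> cmod (1 + \<delta>)" using d by linarith
  have "(cmod \<delta>)\<^sup>2 \<le> (k * cmod (1 + \<delta>))\<^sup>2" using d by (intro power_mono) auto
  moreover have "(cmod (1 + \<delta>))\<^sup>2 - (cmod \<delta>)\<^sup>2 = 1 + 2 * Re \<delta>" unfolding cmod_power2 by (simp add: power2_eq_square algebra_simps)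
  ultimately have "(1 - k\<^sup>2) * (cmod (1 + \<delta>))\<^sup>2 \<le> 1 + 2 * Re \<delta>" by (simp add: power_mult_distrib algebra_simps)
  moreover have "(1 - k\<^sup>2) * (1 / 2)\<^sup>2 \<le> (1 - k\<^sup>2) * (cmod (1 + \<delta>))\<^sup>2"
    using h k by (intro mult_left_mono power_mono) (auto simp: abs_square_le_1)
  ultimately show "(1 - k\<^sup>2) / 4 \<le> 1 + 2 * Re \<delta>" by (simp add: power2_eq_square)
qed

lemma one_plus_dil_bound:
  assumes "\<delta> \<in> dil_disc k" "\<eta> \<in> cball 1 1"
  shows "(1 - k) / 2 \<le> cmod (1 + \<delta> * \<eta>)" "1 + \<delta> * \<eta> \<noteq> 0"
proof -
  have d: "cmod \<delta> \<le> k * cmod (1 + \<delta>)" using assms by (simp add: dil_disc_def)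
  have e: "cmod (1 - \<eta>) \<le> 1" using assms by (simp add: dist_norm)
  have "(1 - k) / 2 \<le> (1 - k) * cmod (1 + \<delta>)" using mult_left_mono[OF dil_disc_bounds(2)[OF assms(1)], of "1 - k"] k by simp
  also have "\<dots> \<le> cmod (1 + \<delta>) - cmod \<delta>" using d by (simp add: algebra_simps)
  also have "\<dots> \<le> cmod (1 + \<delta>) - cmod (\<delta> * (1 - \<eta>))"
    using mult_left_mono[OF e, of "cmod \<delta>"] by (simp add: norm_mult)
  also have "\<dots> \<le> cmod (1 + \<delta> - \<delta> * (1 - \<eta>))" by (rule norm_triangle_ineq2)
  also have "1 + \<delta> - \<delta> * (1 - \<eta>) = 1 + \<delta> * \<eta>" by (simp add: algebra_simps)
  finally show b: "(1 - k) / 2 \<le> cmod (1 + \<delta> * \<eta>)" .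
  show "1 + \<delta> * \<eta> \<noteq> 0"
  proof
    assume "1 + \<delta> * \<eta> = 0"
    then show False using b k by simp
  qed
qed

lemma speed_in_disc:
  assumes "\<delta> \<in> dil_disc k" "\<eta> \<in> cball 1 1"
  shows "1 / (1 + \<delta> * \<eta>) \<in> speed_disc k \<eta>"
proof -
  note nz = one_plus_dil_bound(2)[OF assms]
  let ?v = "1 / (1 + \<delta> * \<eta>)"
  have 1: "1 - ?v = (?v * \<eta>) * \<delta>" and 2: "1 - (1 - \<eta>) * ?v = (?v * \<eta>) * (1 + \<delta>)"
    using nz by (auto simp: field_simps)
  have "cmod \<delta> \<le> k * cmod (1 + \<delta>)" using assms(1) by (simp add: dil_disc_def)
  then have "cmod (?v * \<eta>) * cmod \<delta> \<le> cmod (?v * \<eta>) * (k * cmod (1 + \<delta>))" by (intro mult_left_mono) auto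
  then show ?thesis unfolding speed_disc_def mem_Collect_eq 1 2 norm_mult[of "?v * \<eta>"] by (simp add: mult.left_commute)
qed

lemma speed_disc_bounds:
  assumes "v \<in> speed_disc k \<eta>" "\<eta> \<in> cball 1 1"
  shows "(1 - k) / 2 \<le> cmod v" "cmod v \<le> 2 / (1 - k)"
proof -
  have e: "cmod (1 - \<eta>) \<le> 1" using assms by (simp add: dist_norm)
  have "cmod (1 - (1 - \<eta>) * v) \<le> 1 + cmod (1 - \<eta>) * cmod v"
    using norm_triangle_ineq4[of 1 "(1 - \<eta>) * v"] by (simp add: norm_mult)
  also have "\<dots> \<le> 1 + 1 * cmod v" using e by (intro add_left_mono mult_right_mono) auto
  finally have "k * cmod (1 - (1 - \<eta>) * v) \<le> k * (1 + cmod v)" using k by (intro mult_left_mono) auto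
  then have "cmod (1 - v) \<le> k * (1 + cmod v)" using assms(1) by (simp add: speed_disc_def)
  then have "1 - cmod v \<le> k + k * cmod v" "cmod v - 1 \<le> k + k * cmod v"
    using norm_triangle_ineq2[of 1 v] norm_triangle_ineq2[of v 1] by (auto simp: norm_minus_commute algebra_simps)
  moreover have "k * cmod v \<le> cmod v" using k by (simp add: mult_left_le_one_le)
  ultimately have "1 - k \<le> 2 * cmod v" "(1 - k) * cmod v \<le> 2" using k by (auto simp: algebra_simps)
  then show "(1 - k) / 2 \<le> cmod v" "cmod v \<le> 2 / (1 - k)" using k by (auto simp: field_simps)
qed

text \<open>The geometric core of univalence: for \<open>\<eta>\<close> on the circle, \<open>\<eta> / v\<close> points strictly out of the disc. With
\<open>1 / v = 1 + \<delta> \<eta>\<close> and outer normal \<open>\<eta> - 1\<close>, the inner product of \<open>\<eta> / v\<close> and the normal is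
\<open>\<bar>\<eta>\<bar>\<^sup>2 (1 + 2 Re \<delta>) / 2\<close>.\<close>
lemma speed_disc_outward:
  assumes v: "v \<in> speed_disc k \<eta>" and \<eta>: "cmod (\<eta> - 1) = 1" "\<eta> \<noteq> 0"
  shows "((1 - k) / 2)\<^sup>2 * ((cmod \<eta>)\<^sup>2 / 2 * ((1 - k\<^sup>2) / 4)) \<le> Re (cnj v * (\<eta> * cnj (\<eta> - 1)))"
proof -
  have \<eta>c: "\<eta> \<in> cball 1 1" using \<eta> by (simp add: dist_norm norm_minus_commute)
  note b = speed_disc_bounds[OF v \<eta>c]
  then have v0: "v \<noteq> 0" using k by auto
  define \<delta> where "\<delta> = (1 / v - 1) / \<eta>"
  have \<delta>: "1 - v = (v * \<eta>) * \<delta>" "1 - (1 - \<eta>) * v = (v * \<eta>) * (1 + \<delta>)" "1 / v = 1 + \<delta> * \<eta>"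
    using v0 \<eta>(2) by (auto simp: \<delta>_def field_simps)
  have "cmod (v * \<eta>) * cmod \<delta> \<le> k * (cmod (v * \<eta>) * cmod (1 + \<delta>))"
    using v unfolding speed_disc_def mem_Collect_eq \<delta>(1,2) norm_mult[of "v * \<eta>"] .
  then have "cmod (v * \<eta>) * cmod \<delta> \<le> cmod (v * \<eta>) * (k * cmod (1 + \<delta>))" by (simp add: mult.left_commute)
  then have "\<delta> \<in> dil_disc k" using v0 \<eta>(2) by (simp add: dil_disc_def)
  note d = dil_disc_bounds(3)[OF this]
  have n1: "(Re \<eta> - 1)\<^sup>2 + (Im \<eta>)\<^sup>2 = 1" using \<eta>(1) cmod_power2[of "\<eta> - 1"] by simp
  have "(cmod \<eta>)\<^sup>2 = 2 * Re \<eta>" unfolding cmod_power2 using n1 by (simp add: power2_eq_square algebra_simps)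
  have "Re ((1 + \<delta> * \<eta>) * (\<eta> * cnj (\<eta> - 1))) = (cmod \<eta>)\<^sup>2 / 2 * (1 + 2 * Re \<delta>)"
  proof -
    have e: "\<eta> * cnj (\<eta> - 1) = cnj \<eta>"
      using n1 by (auto simp: complex_eq_iff power2_eq_square algebra_simps)
    have "Re ((1 + \<delta> * \<eta>) * cnj \<eta>) = Re (cnj \<eta> + \<delta> * (\<eta> * cnj \<eta>))" by (simp add: algebra_simps)
    also have "\<eta> * cnj \<eta> = of_real ((cmod \<eta>)\<^sup>2)" by (rule complex_norm_square[symmetric])
    also have "Re (cnj \<eta> + \<delta> * of_real ((cmod \<eta>)\<^sup>2)) = (cmod \<eta>)\<^sup>2 / 2 * (1 + 2 * Re \<delta>)"
      using \<open>(cmod \<eta>)\<^sup>2 = 2 * Re \<eta>\<close> by (simp add: algebra_simps)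
    finally show ?thesis unfolding e .
  qed
  moreover have "cnj v * (\<eta> * cnj (\<eta> - 1)) = of_real ((cmod v)\<^sup>2) * ((1 + \<delta> * \<eta>) * (\<eta> * cnj (\<eta> - 1)))"
  proof -
    have "cnj v = of_real ((cmod v)\<^sup>2) * (1 / v)" using v0 by (simp add: complex_norm_square field_simps del: of_real_power)
    then show ?thesis unfolding \<delta>(3) by (simp add: mult.assoc)
  qed
  ultimately have eq: "Re (cnj v * (\<eta> * cnj (\<eta> - 1))) = (cmod v)\<^sup>2 * ((cmod \<eta>)\<^sup>2 / 2 * (1 + 2 * Re \<delta>))"
    by (simp only: Re_complex_of_real Im_complex_of_real times_complex.sel mult_zero_left diff_zero)
  have "0 \<le> (1 - k\<^sup>2) / 4" using k by (simp add: abs_square_le_1)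
  then show ?thesis unfolding eq using b d k by (intro mult_mono power_mono mult_left_mono) auto
qed

lemma continuous_on_speed_centre: "continuous_on (cball 1 1) (speed_centre k)"
  and continuous_on_speed_radius: "continuous_on (cball 1 1) (speed_radius k)"
proof -
  have nz: "1 - k\<^sup>2 * (cmod (1 - \<eta>))\<^sup>2 \<noteq> 0" if "\<eta> \<in> cball 1 1" for \<eta>
  proof -
    have "cmod (1 - \<eta>) \<le> 1" using that by (simp add: dist_norm)
    then have "k * cmod (1 - \<eta>) \<le> k * 1" using k by (intro mult_left_mono) auto
    then have "(k * cmod (1 - \<eta>))\<^sup>2 < 1" using k by (simp add: power_less_one_iff abs_square_less_1)
    then show ?thesis by (simp add: power_mult_distrib)
  qed
  show "continuous_on (cball 1 1) (speed_centre k)"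
    unfolding speed_centre_def[abs_def] using nz
    by (intro continuous_intros ballI) (metis of_real_eq_0_iff)
  show "continuous_on (cball 1 1) (speed_radius k)"
    unfolding speed_radius_def[abs_def] using nz by (intro continuous_intros) auto
qed

end

text \<open>Contract towards the centre.\<close>
lemma cball_approx:
  fixes v m :: complex
  assumes "cmod (v - m) \<le> R + e" "0 \<le> R" "0 < e"
  obtains u where "u \<in> cball m R" "cmod (v - u) \<le> e"
proof
  define t where "t = R / (R + e)"
  have t: "0 \<le> t" "t \<le> 1" "t * (R + e) = R" using assms by (auto simp: t_def)
  define u where "u = m + of_real t * (v - m)"
  have "cmod (of_real t * (v - m)) = t * cmod (v - m)" using t by (simp add: norm_mult)
  also have "\<dots> \<le> t * (R + e)" using assms t by (intro mult_left_mono) auto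
  finally show "u \<in> cball m R" using t by (simp add: u_def dist_norm)
  have "v - u = of_real (1 - t) * (v - m)" by (simp add: u_def algebra_simps)
  then have "cmod (v - u) = (1 - t) * cmod (v - m)" using t by (simp add: norm_mult del: of_real_diff)
  also have "\<dots> \<le> (1 - t) * (R + e)" using assms t by (intro mult_left_mono) auto
  also have "\<dots> = e" using t(3) by (simp add: algebra_simps)
  finally show "cmod (v - u) \<le> e" .
qed

text \<open>A mean value theorem with values in discs, valid up to the boundary circle where no derivative is
available: \<open>\<phi> - M(\<eta>0) \<eta>\<close> has derivative bounded by \<open>r(\<eta>0) + e\<close> on the convex set of points of the open disc
near \<open>\<eta>0\<close>, hence is Lipschitz on the closure.\<close>
lemma derivative_disc_mean_value:
  fixes \<phi> \<phi>' M :: "complex \<Rightarrow> complex" and r :: "complex \<Rightarrow> real"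
  assumes cont: "continuous_on (cball 1 1) \<phi>" "continuous_on (cball 1 1) M" "continuous_on (cball 1 1) r"
    and der: "\<And>\<eta>. \<eta> \<in> ball 1 1 \<Longrightarrow> (\<phi> has_field_derivative \<phi>' \<eta>) (at \<eta>)"
    and bd: "\<And>\<eta>. \<eta> \<in> ball 1 1 \<Longrightarrow> cmod (\<phi>' \<eta> - M \<eta>) \<le> r \<eta>"
    and \<eta>0: "\<eta>0 \<in> cball 1 1" and e: "e > 0"
  obtains d where "d > 0" "\<And>\<eta>1 \<eta>2. \<eta>1 \<in> cball 1 1 \<inter> ball \<eta>0 d \<Longrightarrow> \<eta>2 \<in> cball 1 1 \<inter> ball \<eta>0 d \<Longrightarrow>
     cmod (\<phi> \<eta>1 - \<phi> \<eta>2 - M \<eta>0 * (\<eta>1 - \<eta>2)) \<le> (r \<eta>0 + e) * cmod (\<eta>1 - \<eta>2)"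
proof -
  obtain d1 where d1: "d1 > 0" "\<And>\<eta>. \<eta> \<in> cball 1 1 \<Longrightarrow> dist \<eta> \<eta>0 < d1 \<Longrightarrow> dist (M \<eta>) (M \<eta>0) < e/2"
    using cont(2) \<eta>0 e unfolding continuous_on_iff by (meson half_gt_zero)
  obtain d2 where d2: "d2 > 0" "\<And>\<eta>. \<eta> \<in> cball 1 1 \<Longrightarrow> dist \<eta> \<eta>0 < d2 \<Longrightarrow> dist (r \<eta>) (r \<eta>0) < e/2"
    using cont(3) \<eta>0 e unfolding continuous_on_iff by (meson half_gt_zero)
  define d where "d = min d1 d2"
  define W where "W = ball 1 1 \<inter> ball \<eta>0 d"
  have b: "cmod (\<phi>' \<eta> - M \<eta>0) \<le> r \<eta>0 + e" if "\<eta> \<in> W" for \<eta>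
  proof -
    have 0: "\<eta> \<in> ball 1 1" "\<eta> \<in> cball 1 1" "dist \<eta> \<eta>0 < d" using that by (auto simp: W_def dist_commute)
    then have "dist (M \<eta>) (M \<eta>0) < e/2" "dist (r \<eta>) (r \<eta>0) < e/2"
      using d1(2)[OF 0(2)] d2(2)[OF 0(2)] unfolding d_def by linarith+
    then have "cmod (M \<eta> - M \<eta>0) < e/2" "r \<eta> < r \<eta>0 + e/2" unfolding dist_norm real_norm_def by linarith+
    moreover have "cmod (\<phi>' \<eta> - M \<eta>0) \<le> cmod (\<phi>' \<eta> - M \<eta>) + cmod (M \<eta> - M \<eta>0)"
      using norm_triangle_ineq[of "\<phi>' \<eta> - M \<eta>" "M \<eta> - M \<eta>0"] by simp
    ultimately show ?thesis using bd[OF 0(1)] by linarith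
  qed
  define L where "L = max 0 (r \<eta>0 + e)"
  let ?f = "\<lambda>\<eta>. \<phi> \<eta> - M \<eta>0 * \<eta>"
  have lipW: "L-lipschitz_on W ?f"
  proof (rule lipschitz_onI)
    fix x y assume xy: "x \<in> W" "y \<in> W"
    have "norm (?f x - ?f y) \<le> L * norm (x - y)"
    proof (rule field_differentiable_bound[where S=W and f' = "\<lambda>\<eta>. \<phi>' \<eta> - M \<eta>0"])
      show "convex W" unfolding W_def by (intro convex_Int convex_ball)
      fix w assume w: "w \<in> W"
      then have "w \<in> ball 1 1" by (simp add: W_def)
      then have "(?f has_field_derivative \<phi>' w - M \<eta>0) (at w)"
        by (intro DERIV_diff der) (auto intro!: derivative_eq_intros)
      then show "(?f has_field_derivative \<phi>' w - M \<eta>0) (at w within W)"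
        by (rule has_field_derivative_at_within)
      show "norm (\<phi>' w - M \<eta>0) \<le> L" using b[OF w] by (simp add: L_def le_max_iff_disj)
    qed (use xy in auto)
    then show "dist (?f x) (?f y) \<le> L * dist x y" by (simp add: dist_norm)
  qed (simp add: L_def)
  have "closure W \<subseteq> cball 1 1" unfolding W_def using closure_mono[of "ball 1 1 \<inter> ball \<eta>0 d" "ball 1 1"] by auto
  then have "continuous_on (closure W) ?f"
    by (intro continuous_intros continuous_on_subset[OF cont(1)])
  with lipW have lc: "L-lipschitz_on (closure W) ?f" by (rule lipschitz_on_closure)
  have sub: "cball 1 1 \<inter> ball \<eta>0 d \<subseteq> closure W"
    using open_Int_closure_subset[of "ball \<eta>0 d" "ball (1::complex) 1"] by (auto simp: W_def Int_commute)
  have "d > 0" using d1 d2 by (auto simp: d_def)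
  have pos: "r \<eta>0 + e \<ge> 0"
  proof -
    have "\<eta>0 \<in> closure W" using \<eta>0 \<open>d > 0\<close> sub by auto
    then have "W \<noteq> {}" by auto
    then show ?thesis using b norm_ge_zero order_trans by blast
  qed
  show thesis
  proof (rule that[OF \<open>d > 0\<close>])
    fix \<eta>1 \<eta>2 assume "\<eta>1 \<in> cball 1 1 \<inter> ball \<eta>0 d" "\<eta>2 \<in> cball 1 1 \<inter> ball \<eta>0 d"
    then have "\<eta>1 \<in> closure W" "\<eta>2 \<in> closure W" using sub by blast+
    then have "dist (?f \<eta>1) (?f \<eta>2) \<le> L * dist \<eta>1 \<eta>2" using lc unfolding lipschitz_on_def by blast
    then show "cmod (\<phi> \<eta>1 - \<phi> \<eta>2 - M \<eta>0 * (\<eta>1 - \<eta>2)) \<le> (r \<eta>0 + e) * cmod (\<eta>1 - \<eta>2)"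
      using pos by (simp add: L_def dist_norm algebra_simps)
  qed
qed

section \<open>The radial extension\<close>

text \<open>The two conditions in the variable \<open>\<eta>\<close>. Here \<open>exp (l \<eta>)\<close> stands for \<open>1 / (\<eta> f(z))\<close>, and \<open>\<alpha>\<close>, \<open>\<beta>\<close> are the
normalised points of \<open>D\<close> given by conditions (A) and (B).\<close>
locale radial_extension =
  fixes k :: real and H l \<alpha> \<beta> :: "complex \<Rightarrow> complex"
  assumes k: "0 \<le> k" "k < 1"
    and contH: "continuous_on (cball 1 1) H" and contl: "continuous_on (cball 1 1) l"
    and \<alpha>: "\<And>\<eta>. \<eta> \<in> ball 1 1 \<Longrightarrow> \<alpha> \<eta> \<in> dil_disc k"
    and \<beta>: "\<And>\<eta>. \<eta> \<in> ball 1 1 \<Longrightarrow> \<beta> \<eta> \<in> dil_disc k"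
    and derl: "\<And>\<eta>. \<eta> \<in> ball 1 1 \<Longrightarrow> (l has_field_derivative - \<alpha> \<eta> / (1 + \<alpha> \<eta> * \<eta>)) (at \<eta>)"
    and derH: "\<And>\<eta>. \<eta> \<in> ball 1 1 \<Longrightarrow> (H has_field_derivative - exp (l \<eta>) / (1 + \<beta> \<eta> * \<eta>)) (at \<eta>)"
begin

definition \<gamma> where "\<gamma> \<eta> = exp (l \<eta>)"

definition g where "g \<eta> = \<eta> * \<gamma> \<eta>"

text \<open>In the right half-plane outside the disc, \<open>1 + \<xi> / cnj \<xi>\<close> is the point where the segment from \<open>0\<close> to \<open>\<xi>\<close> meets the circle.\<close>
definition retract where
  "retract \<xi> = (if \<xi> \<in> cball 1 1 then \<xi> else if 0 < Re \<xi> then 1 + \<xi> / cnj \<xi> else 0)"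

text \<open>On the disc this is \<open>H\<close>. At \<open>\<xi> = s \<eta>\<close> with \<open>s \<ge> 1\<close> and \<open>\<eta> \<noteq> 0\<close> on the circle it is \<open>H \<eta> - (s - 1) * g \<eta>\<close>.\<close>
definition G where "G \<xi> = H (retract \<xi>) - (\<xi> - retract \<xi>) * \<gamma> (retract \<xi>)"

lemma ball_cball: "\<eta> \<in> ball 1 1 \<Longrightarrow> \<eta> \<in> cball 1 1" for \<eta> :: complex by simp

lemma cont\<gamma>: "continuous_on (cball 1 1) \<gamma>" unfolding \<gamma>_def[abs_def] by (intro continuous_intros contl)

lemma contg: "continuous_on (cball 1 1) g" unfolding g_def[abs_def] by (intro continuous_intros cont\<gamma>)

lemma \<gamma>_nonzero: "\<gamma> \<eta> \<noteq> 0" by (simp add: \<gamma>_def)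

lemma derg:
  assumes "\<eta> \<in> ball 1 1"
  shows "(g has_field_derivative \<gamma> \<eta> * (1 / (1 + \<alpha> \<eta> * \<eta>))) (at \<eta>)"
proof -
  note nz = one_plus_dil_bound(2)[OF k \<alpha>[OF assms] ball_cball[OF assms]]
  have "(g has_field_derivative \<gamma> \<eta> + (exp (l \<eta>) * (- \<alpha> \<eta> / (1 + \<alpha> \<eta> * \<eta>))) * \<eta>) (at \<eta>)"
    unfolding g_def[abs_def] \<gamma>_def[abs_def] using derl[OF assms] by (auto intro!: derivative_eq_intros)
  also have "\<gamma> \<eta> + (exp (l \<eta>) * (- \<alpha> \<eta> / (1 + \<alpha> \<eta> * \<eta>))) * \<eta> = \<gamma> \<eta> * (1 / (1 + \<alpha> \<eta> * \<eta>))"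
    using nz by (simp add: \<gamma>_def field_simps)
  finally show ?thesis .
qed

text \<open>Increments of \<open>H\<close> and \<open>g\<close> are multiples of the increment of \<open>\<eta>\<close> by points of the limiting disc, up to an
arbitrarily small relative error. The sign \<open>a\<close> covers both functions.\<close>
lemma speed_increment:
  assumes \<eta>0: "\<eta>0 \<in> cball 1 1" and e: "e > 0"
    and der: "\<And>\<eta>. \<eta> \<in> ball 1 1 \<Longrightarrow> (\<phi> has_field_derivative a * \<gamma> \<eta> * v \<eta>) (at \<eta>)"
    and v: "\<And>\<eta>. \<eta> \<in> ball 1 1 \<Longrightarrow> v \<eta> \<in> speed_disc k \<eta>"
    and cont: "continuous_on (cball 1 1) \<phi>" and a: "cmod a = 1"
  obtains d where "d > 0" "\<And>\<eta>1 \<eta>2. \<eta>1 \<in> cball 1 1 \<inter> ball \<eta>0 d \<Longrightarrow> \<eta>2 \<in> cball 1 1 \<inter> ball \<eta>0 d \<Longrightarrow>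
     \<exists>u\<in>speed_disc k \<eta>0. cmod (\<phi> \<eta>1 - \<phi> \<eta>2 - a * \<gamma> \<eta>0 * u * (\<eta>1 - \<eta>2)) \<le> e * cmod (\<eta>1 - \<eta>2)"
proof -
  let ?M = "\<lambda>\<eta>. a * \<gamma> \<eta> * speed_centre k \<eta>" and ?r = "\<lambda>\<eta>. cmod (\<gamma> \<eta>) * speed_radius k \<eta>"
  have bd: "cmod (a * \<gamma> \<eta> * v \<eta> - ?M \<eta>) \<le> ?r \<eta>" if "\<eta> \<in> ball 1 1" for \<eta>
  proof -
    have "cmod (v \<eta> - speed_centre k \<eta>) \<le> speed_radius k \<eta>"
      using v[OF that] speed_disc_eq_cball[OF k ball_cball[OF that]] by (simp add: dist_norm norm_minus_commute)
    moreover have "a * \<gamma> \<eta> * v \<eta> - ?M \<eta> = a * (\<gamma> \<eta> * (v \<eta> - speed_centre k \<eta>))" by (simp add: algebra_simps)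
    ultimately show ?thesis using a by (simp only: norm_mult) (simp add: mult_left_mono)
  qed
  obtain d where d: "d > 0" "\<And>\<eta>1 \<eta>2. \<eta>1 \<in> cball 1 1 \<inter> ball \<eta>0 d \<Longrightarrow> \<eta>2 \<in> cball 1 1 \<inter> ball \<eta>0 d \<Longrightarrow>
     cmod (\<phi> \<eta>1 - \<phi> \<eta>2 - ?M \<eta>0 * (\<eta>1 - \<eta>2)) \<le> (?r \<eta>0 + e) * cmod (\<eta>1 - \<eta>2)"
    by (rule derivative_disc_mean_value[OF cont _ _ der bd \<eta>0 e])
       (auto intro!: continuous_intros cont\<gamma> continuous_on_speed_centre[OF k] continuous_on_speed_radius[OF k])
  show thesis
  proof (rule that[OF d(1)])
    fix \<eta>1 \<eta>2 assume E: "\<eta>1 \<in> cball 1 1 \<inter> ball \<eta>0 d" "\<eta>2 \<in> cball 1 1 \<inter> ball \<eta>0 d"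
    have one: "1 \<in> speed_disc k \<eta>0" using k by (simp add: speed_disc_def)
    show "\<exists>u\<in>speed_disc k \<eta>0. cmod (\<phi> \<eta>1 - \<phi> \<eta>2 - a * \<gamma> \<eta>0 * u * (\<eta>1 - \<eta>2)) \<le> e * cmod (\<eta>1 - \<eta>2)"
    proof (cases "\<eta>1 = \<eta>2")
      case True
      then show ?thesis using one by (intro bexI[of _ 1]) auto
    next
      case False
      define y where "y = \<eta>1 - \<eta>2"
      have y: "y \<noteq> 0" using False by (simp add: y_def)
      have a0: "a \<noteq> 0" "\<gamma> \<eta>0 \<noteq> 0" using a \<gamma>_nonzero by auto
      define w where "w = (\<phi> \<eta>1 - \<phi> \<eta>2) / (a * \<gamma> \<eta>0 * y)"
      have weq: "\<phi> \<eta>1 - \<phi> \<eta>2 = a * \<gamma> \<eta>0 * y * w" using y a0 by (simp add: w_def)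
      have "\<phi> \<eta>1 - \<phi> \<eta>2 - ?M \<eta>0 * y = a * (\<gamma> \<eta>0 * (y * (w - speed_centre k \<eta>0)))" unfolding weq by (simp add: algebra_simps)
      then have "cmod (\<gamma> \<eta>0) * (cmod y * cmod (w - speed_centre k \<eta>0)) \<le> (?r \<eta>0 + e) * cmod y"
        using d(2)[OF E] a unfolding y_def[symmetric] by (simp add: norm_mult)
      then have "cmod y * (cmod (\<gamma> \<eta>0) * cmod (w - speed_centre k \<eta>0)) \<le> cmod y * (?r \<eta>0 + e)" by (simp add: mult_ac)
      then have "cmod (\<gamma> \<eta>0) * cmod (w - speed_centre k \<eta>0) \<le> ?r \<eta>0 + e" using y by simp
      then have "cmod (w - speed_centre k \<eta>0) \<le> speed_radius k \<eta>0 + e / cmod (\<gamma> \<eta>0)"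
        using a0 by (simp add: field_simps)
      moreover have "0 \<le> speed_radius k \<eta>0"
        using one unfolding speed_disc_eq_cball[OF k \<eta>0] mem_cball by (rule order_trans[OF zero_le_dist])
      ultimately obtain u where u: "u \<in> cball (speed_centre k \<eta>0) (speed_radius k \<eta>0)" "cmod (w - u) \<le> e / cmod (\<gamma> \<eta>0)"
      proof (rule cball_approx)
        show "0 < e / cmod (\<gamma> \<eta>0)" using e a0 by simp
      qed
      have "\<phi> \<eta>1 - \<phi> \<eta>2 - a * \<gamma> \<eta>0 * u * y = a * (\<gamma> \<eta>0 * (w - u)) * y" unfolding weq by (simp add: algebra_simps)
      moreover have "cmod (\<gamma> \<eta>0 * (w - u)) \<le> e"
        using u(2) a0 unfolding norm_mult by (simp add: field_simps)
      ultimately have "cmod (\<phi> \<eta>1 - \<phi> \<eta>2 - a * \<gamma> \<eta>0 * u * y) \<le> e * cmod y"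
        using a by (simp add: norm_mult mult_right_mono)
      then show ?thesis using u(1) speed_disc_eq_cball[OF k \<eta>0] unfolding y_def by blast
    qed
  qed
qed

lemma H_increment:
  assumes "\<eta>0 \<in> cball 1 1" "e > 0"
  obtains d where "d > 0" "\<And>\<eta>1 \<eta>2. \<eta>1 \<in> cball 1 1 \<inter> ball \<eta>0 d \<Longrightarrow> \<eta>2 \<in> cball 1 1 \<inter> ball \<eta>0 d \<Longrightarrow>
     \<exists>u\<in>speed_disc k \<eta>0. cmod (H \<eta>1 - H \<eta>2 + \<gamma> \<eta>0 * u * (\<eta>1 - \<eta>2)) \<le> e * cmod (\<eta>1 - \<eta>2)"
proof -
  have "(H has_field_derivative - 1 * \<gamma> \<eta> * (1 / (1 + \<beta> \<eta> * \<eta>))) (at \<eta>)" if "\<eta> \<in> ball 1 1" for \<eta>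
    using derH[OF that] by (simp add: \<gamma>_def)
  from speed_increment[OF assms this _ contH] speed_in_disc[OF k \<beta> ball_cball]
  obtain d where "d > 0" "\<And>\<eta>1 \<eta>2. \<eta>1 \<in> cball 1 1 \<inter> ball \<eta>0 d \<Longrightarrow> \<eta>2 \<in> cball 1 1 \<inter> ball \<eta>0 d \<Longrightarrow>
     \<exists>u\<in>speed_disc k \<eta>0. cmod (H \<eta>1 - H \<eta>2 - -1 * \<gamma> \<eta>0 * u * (\<eta>1 - \<eta>2)) \<le> e * cmod (\<eta>1 - \<eta>2)"
    by (metis (no_types, lifting) norm_minus_cancel norm_one)
  then show thesis by (intro that[of d]) auto
qed

lemma g_increment:
  assumes "\<eta>0 \<in> cball 1 1" "e > 0"
  obtains d where "d > 0" "\<And>\<eta>1 \<eta>2. \<eta>1 \<in> cball 1 1 \<inter> ball \<eta>0 d \<Longrightarrow> \<eta>2 \<in> cball 1 1 \<inter> ball \<eta>0 d \<Longrightarrow>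
     \<exists>u\<in>speed_disc k \<eta>0. cmod (g \<eta>1 - g \<eta>2 - \<gamma> \<eta>0 * u * (\<eta>1 - \<eta>2)) \<le> e * cmod (\<eta>1 - \<eta>2)"
proof -
  have "(g has_field_derivative 1 * \<gamma> \<eta> * (1 / (1 + \<alpha> \<eta> * \<eta>))) (at \<eta>)" if "\<eta> \<in> ball 1 1" for \<eta>
    using derg[OF that] by simp
  from speed_increment[OF assms this _ contg] speed_in_disc[OF k \<alpha> ball_cball]
  obtain d where "d > 0" "\<And>\<eta>1 \<eta>2. \<eta>1 \<in> cball 1 1 \<inter> ball \<eta>0 d \<Longrightarrow> \<eta>2 \<in> cball 1 1 \<inter> ball \<eta>0 d \<Longrightarrow>
     \<exists>u\<in>speed_disc k \<eta>0. cmod (g \<eta>1 - g \<eta>2 - 1 * \<gamma> \<eta>0 * u * (\<eta>1 - \<eta>2)) \<le> e * cmod (\<eta>1 - \<eta>2)"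
    by (metis (no_types, lifting) norm_one)
  then show thesis by (intro that[of d]) auto
qed

lemma retract_disc [simp]: "\<xi> \<in> cball 1 1 \<Longrightarrow> retract \<xi> = \<xi>" by (simp add: retract_def)

lemma outside_iff: "1 \<le> cmod (\<xi> - 1) \<longleftrightarrow> 2 * Re \<xi> \<le> (cmod \<xi>)\<^sup>2"
proof -
  have "1 \<le> cmod (\<xi> - 1) \<longleftrightarrow> 1\<^sup>2 \<le> (cmod (\<xi> - 1))\<^sup>2" by (simp add: abs_square_le_1 power2_nonneg_ge_1_iff)
  then show ?thesis unfolding cmod_power2 by (simp add: power2_eq_square algebra_simps)
qed

lemma one_plus_unimodular: "\<xi> \<noteq> 0 \<Longrightarrow> 1 + \<xi> / cnj \<xi> = of_real (2 * Re \<xi>) / cnj \<xi>"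
  by (simp only: complex_add_cnj[symmetric]) (simp add: field_simps)

lemma retract_outside:
  assumes "1 \<le> cmod (\<xi> - 1)" "0 < Re \<xi>"
  shows "retract \<xi> = 1 + \<xi> / cnj \<xi>"
proof (cases "\<xi> \<in> cball 1 1")
  case True
  then have "cmod (\<xi> - 1) = 1" using assms by (simp add: dist_norm norm_minus_commute)
  then have "(cmod (\<xi> - 1))\<^sup>2 = 1" by simp
  then have "(cmod \<xi>)\<^sup>2 = 2 * Re \<xi>" unfolding cmod_power2 by (simp add: power2_eq_square algebra_simps)
  then have "\<xi> * cnj \<xi> = of_real (2 * Re \<xi>)" by (metis complex_norm_square)
  moreover have "\<xi> \<noteq> 0" using assms by auto
  ultimately show ?thesis using True one_plus_unimodular by (simp add: field_simps)
qed (use assms in \<open>simp add: retract_def\<close>)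

lemma retract_left: "Re \<xi> \<le> 0 \<Longrightarrow> retract \<xi> = 0"
proof (cases "\<xi> \<in> cball 1 1")
  case True
  assume re: "Re \<xi> \<le> 0"
  have "(cmod (\<xi> - 1))\<^sup>2 \<le> 1" using True by (simp add: dist_norm norm_minus_commute abs_square_le_1)
  then have "(Re \<xi>)\<^sup>2 + (Im \<xi>)\<^sup>2 \<le> 2 * Re \<xi>" unfolding cmod_power2 by (simp add: power2_eq_square algebra_simps)
  then have "(Re \<xi>)\<^sup>2 + (Im \<xi>)\<^sup>2 \<le> 0" using re by linarith
  then have "\<xi> = 0" by (simp add: complex_eq_iff sum_power2_le_zero_iff)
  then show ?thesis by (simp add: retract_def)
qed (simp add: retract_def)

lemma retract_in_disc: "retract \<xi> \<in> cball 1 1"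
proof -
  have "cmod (\<xi> / cnj \<xi>) \<le> 1" by (simp add: norm_divide)
  then show ?thesis by (auto simp: retract_def dist_norm)
qed

lemma retract_norm_le: "cmod (retract \<xi>) \<le> 2"
  using norm_triangle_ineq[of "retract \<xi> - 1" 1] retract_in_disc[of \<xi>] by (simp add: dist_norm norm_minus_commute)

definition outer where "outer = {\<xi>. 0 \<le> Re \<xi> \<and> 1 \<le> cmod (\<xi> - 1)}"

lemma retract_outer: "\<xi> \<in> outer \<Longrightarrow> \<xi> \<noteq> 0 \<Longrightarrow> retract \<xi> = 1 + \<xi> / cnj \<xi>"
proof (cases "Re \<xi> = 0")
  case True
  assume "\<xi> \<noteq> 0"
  then show ?thesis using True retract_left[of \<xi>] one_plus_unimodular[of \<xi>] by simp
qed (auto simp: outer_def retract_outside)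

lemma retract_outer_le: "\<xi> \<in> outer \<Longrightarrow> cmod (retract \<xi>) \<le> cmod \<xi>"
proof (cases "\<xi> = 0")
  case False
  assume o: "\<xi> \<in> outer"
  have "cmod (retract \<xi>) = 2 * Re \<xi> / cmod \<xi>"
    using o unfolding retract_outer[OF o False] one_plus_unimodular[OF False] by (simp add: norm_divide outer_def)
  also have "\<dots> \<le> cmod \<xi>" using o False outside_iff[of \<xi>] by (simp add: outer_def field_simps power2_eq_square)
  finally show ?thesis .
qed (simp add: retract_left)

text \<open>The retraction onto the circle depends on the direction of \<open>\<xi>\<close> only, so its Lipschitz constant at \<open>\<xi>\<close>
grows like \<open>1 / \<bar>\<xi>\<bar>\<close>.\<close>
lemma retract_outer_Lipschitz:
  assumes "\<xi>1 \<in> outer" "\<xi>2 \<in> outer"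
  shows "cmod (retract \<xi>1 - retract \<xi>2) * cmod \<xi>2 \<le> 2 * cmod (\<xi>1 - \<xi>2)"
proof (cases "\<xi>1 = 0 \<or> \<xi>2 = 0")
  case True
  then show ?thesis
  proof
    assume "\<xi>1 = 0"
    then show ?thesis using retract_norm_le[of \<xi>2] by (simp add: retract_left mult_right_mono)
  qed simp
next
  case False
  have "retract \<xi>1 - retract \<xi>2 = (\<xi>1 * (cnj \<xi>2 - cnj \<xi>1) + cnj \<xi>1 * (\<xi>1 - \<xi>2)) / (cnj \<xi>1 * cnj \<xi>2)"
    using False assms by (simp add: retract_outer field_simps)
  then have "cmod (retract \<xi>1 - retract \<xi>2) = cmod (\<xi>1 * (cnj \<xi>2 - cnj \<xi>1) + cnj \<xi>1 * (\<xi>1 - \<xi>2)) / (cmod \<xi>1 * cmod \<xi>2)"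
    by (simp only: norm_divide norm_mult complex_mod_cnj)
  also have "\<dots> \<le> (2 * cmod \<xi>1 * cmod (\<xi>1 - \<xi>2)) / (cmod \<xi>1 * cmod \<xi>2)"
  proof (rule divide_right_mono)
    have "cmod (\<xi>1 * (cnj \<xi>2 - cnj \<xi>1) + cnj \<xi>1 * (\<xi>1 - \<xi>2)) \<le> cmod (\<xi>1 * (cnj \<xi>2 - cnj \<xi>1)) + cmod (cnj \<xi>1 * (\<xi>1 - \<xi>2))"
      by (rule norm_triangle_ineq)
    also have "cmod (cnj \<xi>2 - cnj \<xi>1) = cmod (\<xi>1 - \<xi>2)" by (metis complex_cnj_diff complex_mod_cnj norm_minus_commute)
    then have "cmod (\<xi>1 * (cnj \<xi>2 - cnj \<xi>1)) + cmod (cnj \<xi>1 * (\<xi>1 - \<xi>2)) = 2 * cmod \<xi>1 * cmod (\<xi>1 - \<xi>2)"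
      by (simp add: norm_mult)
    finally show "cmod (\<xi>1 * (cnj \<xi>2 - cnj \<xi>1) + cnj \<xi>1 * (\<xi>1 - \<xi>2)) \<le> 2 * cmod \<xi>1 * cmod (\<xi>1 - \<xi>2)" .
  qed simp
  also have "\<dots> = 2 * cmod (\<xi>1 - \<xi>2) / cmod \<xi>2" using False by simp
  finally show ?thesis using False by (simp add: field_simps)
qed

lemma Lipschitz_of_derivative_bound:
  assumes cont: "continuous_on (cball 1 1) \<phi>" and B: "0 \<le> B"
    and W: "convex W" "open W"
    and der: "\<And>\<eta>. \<eta> \<in> ball 1 1 \<inter> W \<Longrightarrow> (\<phi> has_field_derivative \<phi>' \<eta>) (at \<eta>) \<and> cmod (\<phi>' \<eta>) \<le> B"
  shows "B-lipschitz_on (cball 1 1 \<inter> W) \<phi>"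
proof -
  have "B-lipschitz_on (ball 1 1 \<inter> W) \<phi>"
  proof (rule lipschitz_onI)
    fix x y assume xy: "x \<in> ball 1 1 \<inter> W" "y \<in> ball 1 1 \<inter> W"
    have "norm (\<phi> x - \<phi> y) \<le> B * norm (x - y)"
    proof (rule field_differentiable_bound[where S="ball 1 1 \<inter> W" and f'=\<phi>'])
      show "convex (ball 1 1 \<inter> W)" using W by (intro convex_Int convex_ball)
      fix w assume w: "w \<in> ball 1 1 \<inter> W"
      show "(\<phi> has_field_derivative \<phi>' w) (at w within ball 1 1 \<inter> W)"
        by (rule has_field_derivative_at_within) (use der[OF w] in blast)
      show "cmod (\<phi>' w) \<le> B" using der[OF w] by blast
    qed (use xy in auto)
    then show "dist (\<phi> x) (\<phi> y) \<le> B * dist x y" by (simp add: dist_norm)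
  qed (rule B)
  moreover have "closure (ball 1 1 \<inter> W) \<subseteq> cball 1 1" using closure_mono[of "ball 1 1 \<inter> W" "ball 1 1"] by auto
  then have "continuous_on (closure (ball 1 1 \<inter> W)) \<phi>" by (rule continuous_on_subset[OF cont])
  ultimately have "B-lipschitz_on (closure (ball 1 1 \<inter> W)) \<phi>" by (rule lipschitz_on_closure)
  then show ?thesis
    by (rule lipschitz_on_subset) (use open_Int_closure_subset[OF W(2), of "ball (1::complex) 1"] in \<open>auto simp: Int_commute\<close>)
qed

text \<open>The part of \<open>G\<close> outside the disc that does not grow with \<open>\<xi>\<close>.\<close>
definition cap where "cap \<eta> = H \<eta> + g \<eta>"

lemma G_outer: "G \<xi> = cap (retract \<xi>) - \<xi> * \<gamma> (retract \<xi>)"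
  by (simp add: G_def cap_def g_def algebra_simps)

text \<open>The last estimate holds because the derivative of \<open>cap\<close> is
\<open>\<gamma> (1 / (1 + \<alpha> \<eta>) - 1 / (1 + \<beta> \<eta>))\<close>, which is \<open>O(\<eta>)\<close>. It compensates for the retraction not being
Lipschitz at \<open>0\<close>.\<close>
lemma bounds:
  obtains C0 C1 C2 where "C0 > 0" "C1 > 0" "C2 > 0"
    "\<And>\<eta>. \<eta> \<in> cball 1 1 \<Longrightarrow> cmod (\<gamma> \<eta>) \<le> C0 \<and> 1 / C0 \<le> cmod (\<gamma> \<eta>) \<and> cmod (H \<eta>) \<le> C0 \<and> cmod (cap \<eta>) \<le> C0"
    "C1-lipschitz_on (cball 1 1) H" "C1-lipschitz_on (cball 1 1) \<gamma>" "C1-lipschitz_on (cball 1 1) cap"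
    "\<And>\<eta>1 \<eta>2. \<eta>1 \<in> cball 1 1 \<Longrightarrow> \<eta>2 \<in> cball 1 1 \<Longrightarrow> cmod (cap \<eta>1 - cap \<eta>2) \<le> C2 * max (cmod \<eta>1) (cmod \<eta>2) * cmod (\<eta>1 - \<eta>2)"
proof -
  have contK: "continuous_on (cball 1 1) cap" unfolding cap_def[abs_def] by (intro continuous_intros contH contg)
  obtain B1 where B1: "\<And>\<eta>. \<eta> \<in> cball 1 1 \<Longrightarrow> cmod (\<gamma> \<eta>) \<le> B1" using continuous_on_compact_bound[OF cont\<gamma>] by auto
  obtain B2 where B2: "\<And>\<eta>. \<eta> \<in> cball 1 1 \<Longrightarrow> cmod (1 / \<gamma> \<eta>) \<le> B2"
  proof -
    have "continuous_on (cball 1 1) (\<lambda>\<eta>. 1 / \<gamma> \<eta>)" using \<gamma>_nonzero by (intro continuous_intros cont\<gamma>) auto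
    then show ?thesis using continuous_on_compact_bound[of "cball 1 1" "\<lambda>\<eta>. 1 / \<gamma> \<eta>"] that by auto
  qed
  obtain B3 where B3: "\<And>\<eta>. \<eta> \<in> cball 1 1 \<Longrightarrow> cmod (H \<eta>) \<le> B3" using continuous_on_compact_bound[OF contH] by auto
  obtain B4 where B4: "\<And>\<eta>. \<eta> \<in> cball 1 1 \<Longrightarrow> cmod (cap \<eta>) \<le> B4" using continuous_on_compact_bound[OF contK] by auto
  define C0 where "C0 = max 1 (max (max B1 B2) (max B3 B4))"
  have C0: "C0 > 0" by (auto simp: C0_def)
  have c0: "cmod (\<gamma> \<eta>) \<le> C0 \<and> 1 / C0 \<le> cmod (\<gamma> \<eta>) \<and> cmod (H \<eta>) \<le> C0 \<and> cmod (cap \<eta>) \<le> C0" if \<eta>: "\<eta> \<in> cball 1 1" for \<eta>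
  proof (intro conjI)
    have "cmod (1 / \<gamma> \<eta>) \<le> C0" using B2[OF \<eta>] by (auto simp: C0_def)
    then show "1 / C0 \<le> cmod (\<gamma> \<eta>)" using C0 \<gamma>_nonzero by (simp add: norm_divide field_simps)
  qed (use B1[OF \<eta>] B3[OF \<eta>] B4[OF \<eta>] in \<open>auto simp: C0_def\<close>)
  define q where "q = 2 / (1 - k)"
  have q: "q > 0" using k by (simp add: q_def)
  have inv: "cmod (1 / (1 + \<delta> * \<eta>)) \<le> q" if "\<delta> \<in> dil_disc k" "\<eta> \<in> cball 1 1" for \<delta> \<eta>
    unfolding q_def by (rule speed_disc_bounds(2)[OF k speed_in_disc[OF k that] that(2)])
  have dq: "cmod (\<delta> / (1 + \<delta> * \<eta>)) \<le> q * q" if "\<delta> \<in> dil_disc k" "\<eta> \<in> cball 1 1" for \<delta> \<eta>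
  proof -
    have "1 / (1 - k) \<le> q" using k unfolding q_def by (intro divide_right_mono) auto
    with dil_disc_bounds(1)[OF k that(1)] have "cmod \<delta> \<le> q" by (rule order_trans)
    then have "cmod \<delta> * cmod (1 / (1 + \<delta> * \<eta>)) \<le> q * q" using inv[OF that] q by (intro mult_mono) auto
    then show ?thesis by (simp add: norm_divide)
  qed
  have lH: "(C0 * q)-lipschitz_on (cball 1 1 \<inter> UNIV) H"
  proof (rule Lipschitz_of_derivative_bound[OF contH])
    fix \<eta> :: complex assume \<eta>: "\<eta> \<in> ball 1 1 \<inter> UNIV"
    have "cmod (\<gamma> \<eta>) * cmod (1 / (1 + \<beta> \<eta> * \<eta>)) \<le> C0 * q"
      using c0[of \<eta>] inv[OF \<beta>, of \<eta> \<eta>] \<eta> C0 by (intro mult_mono) auto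
    then show "(H has_field_derivative - exp (l \<eta>) / (1 + \<beta> \<eta> * \<eta>)) (at \<eta>) \<and> cmod (- exp (l \<eta>) / (1 + \<beta> \<eta> * \<eta>)) \<le> C0 * q"
      using derH[of \<eta>] \<eta> by (auto simp: norm_divide \<gamma>_def)
  qed (use C0 q in auto)
  have lg: "(C0 * (q * q))-lipschitz_on (cball 1 1 \<inter> UNIV) \<gamma>"
  proof (rule Lipschitz_of_derivative_bound[OF cont\<gamma>])
    fix \<eta> :: complex assume \<eta>: "\<eta> \<in> ball 1 1 \<inter> UNIV"
    have "cmod (\<gamma> \<eta>) * cmod (\<alpha> \<eta> / (1 + \<alpha> \<eta> * \<eta>)) \<le> C0 * (q * q)"
      using c0[of \<eta>] dq[OF \<alpha>, of \<eta> \<eta>] \<eta> C0 by (intro mult_mono) auto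
    then show "(\<gamma> has_field_derivative \<gamma> \<eta> * (- \<alpha> \<eta> / (1 + \<alpha> \<eta> * \<eta>))) (at \<eta>) \<and> cmod (\<gamma> \<eta> * (- \<alpha> \<eta> / (1 + \<alpha> \<eta> * \<eta>))) \<le> C0 * (q * q)"
      using derl[of \<eta>] \<eta> unfolding \<gamma>_def[abs_def] by (auto simp: norm_divide norm_mult intro!: derivative_eq_intros)
  qed (use C0 q in auto)
  define Kd where "Kd \<eta> = \<gamma> \<eta> * (1 / (1 + \<alpha> \<eta> * \<eta>) - 1 / (1 + \<beta> \<eta> * \<eta>))" for \<eta>
  have Kd: "(cap has_field_derivative Kd \<eta>) (at \<eta>)" "cmod (Kd \<eta>) \<le> C0 * (2 * (q * q)) * cmod \<eta>" if \<eta>: "\<eta> \<in> ball 1 1" for \<eta>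
  proof -
    show "(cap has_field_derivative Kd \<eta>) (at \<eta>)"
      unfolding cap_def[abs_def] Kd_def using derH[OF \<eta>] derg[OF \<eta>]
      by (auto intro!: derivative_eq_intros simp: \<gamma>_def algebra_simps)
    have i: "1 / (1 + \<delta> * \<eta>) = 1 - (\<delta> / (1 + \<delta> * \<eta>)) * \<eta>" if "\<delta> \<in> dil_disc k" for \<delta>
      using one_plus_dil_bound(2)[OF k that ball_cball[OF \<eta>]] by (simp add: field_simps)
    have "1 / (1 + \<alpha> \<eta> * \<eta>) - 1 / (1 + \<beta> \<eta> * \<eta>) = (\<beta> \<eta> / (1 + \<beta> \<eta> * \<eta>) - \<alpha> \<eta> / (1 + \<alpha> \<eta> * \<eta>)) * \<eta>"
      by (simp only: i[OF \<alpha>[OF \<eta>]] i[OF \<beta>[OF \<eta>]] left_diff_distrib) simp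
    then have eq: "cmod (Kd \<eta>) = cmod (\<gamma> \<eta>) * cmod (\<beta> \<eta> / (1 + \<beta> \<eta> * \<eta>) - \<alpha> \<eta> / (1 + \<alpha> \<eta> * \<eta>)) * cmod \<eta>"
      by (simp add: Kd_def norm_mult)
    have "cmod (\<beta> \<eta> / (1 + \<beta> \<eta> * \<eta>) - \<alpha> \<eta> / (1 + \<alpha> \<eta> * \<eta>)) \<le> q * q + q * q"
      using dq[OF \<alpha>[OF \<eta>] ball_cball[OF \<eta>]] dq[OF \<beta>[OF \<eta>] ball_cball[OF \<eta>]] by (intro order_trans[OF norm_triangle_ineq4] add_mono)
    then show "cmod (Kd \<eta>) \<le> C0 * (2 * (q * q)) * cmod \<eta>"
      unfolding eq using c0[OF ball_cball[OF \<eta>]] C0 by (intro mult_right_mono mult_mono) auto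
  qed
  define C2 where "C2 = 2 * (C0 * (2 * (q * q)))"
  have C2: "C2 > 0" using C0 q by (simp add: C2_def)
  have lKW: "(C0 * (2 * (q * q)) * \<rho>)-lipschitz_on (cball 1 1 \<inter> ball 0 \<rho>) cap" if "\<rho> > 0" for \<rho>
  proof (rule Lipschitz_of_derivative_bound[OF contK])
    fix \<eta> :: complex assume \<eta>: "\<eta> \<in> ball 1 1 \<inter> ball 0 \<rho>"
    then have "C0 * (2 * (q * q)) * cmod \<eta> \<le> C0 * (2 * (q * q)) * \<rho>" using C0 q by (intro mult_left_mono) auto
    with Kd(2)[of \<eta>] \<eta> have "cmod (Kd \<eta>) \<le> C0 * (2 * (q * q)) * \<rho>" by (meson IntD1 order_trans)
    then show "(cap has_field_derivative Kd \<eta>) (at \<eta>) \<and> cmod (Kd \<eta>) \<le> C0 * (2 * (q * q)) * \<rho>"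
      using Kd(1)[of \<eta>] \<eta> by blast
  qed (use C0 q that in auto)
  have c2: "cmod (cap \<eta>1 - cap \<eta>2) \<le> C2 * max (cmod \<eta>1) (cmod \<eta>2) * cmod (\<eta>1 - \<eta>2)" if "\<eta>1 \<in> cball 1 1" "\<eta>2 \<in> cball 1 1" for \<eta>1 \<eta>2
  proof (cases "\<eta>1 = 0 \<and> \<eta>2 = 0")
    case False
    define \<rho> where "\<rho> = 2 * max (cmod \<eta>1) (cmod \<eta>2)"
    have m: "max (cmod \<eta>1) (cmod \<eta>2) > 0" using False by (auto simp: less_max_iff_disj)
    then have "\<rho> > 0" by (simp add: \<rho>_def)
    moreover have "cmod \<eta>1 < \<rho>" "cmod \<eta>2 < \<rho>" using m unfolding \<rho>_def by linarith+
    ultimately have "dist (cap \<eta>1) (cap \<eta>2) \<le> (C0 * (2 * (q * q)) * \<rho>) * dist \<eta>1 \<eta>2"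
      using lipschitz_onD[OF lKW[of \<rho>], of \<eta>1 \<eta>2] that by auto
    then show ?thesis by (simp add: C2_def \<rho>_def dist_norm mult_ac)
  qed simp
  have lK: "(C0 * (2 * (q * q)) * 3)-lipschitz_on (cball 1 1) cap"
  proof (rule lipschitz_on_subset[OF lKW])
    show "cball 1 1 \<subseteq> cball 1 1 \<inter> ball (0::complex) 3"
    proof
      fix x :: complex assume x: "x \<in> cball 1 1"
      then show "x \<in> cball 1 1 \<inter> ball 0 3" using norm_triangle_ineq[of "x - 1" 1] by (simp add: dist_norm norm_minus_commute)
    qed
  qed simp
  define C1 where "C1 = max 1 (max (C0 * q) (max (C0 * (q * q)) (C0 * (2 * (q * q)) * 3)))"
  show thesis
  proof (rule that[OF C0 _ C2 c0])
    show "C1 > 0" by (auto simp: C1_def)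
    show "C1-lipschitz_on (cball 1 1) H" by (rule lipschitz_on_mono[OF lH]) (auto simp: C1_def)
    show "C1-lipschitz_on (cball 1 1) \<gamma>" by (rule lipschitz_on_mono[OF lg]) (auto simp: C1_def)
    show "C1-lipschitz_on (cball 1 1) cap" by (rule lipschitz_on_mono[OF lK]) (auto simp: C1_def)
  qed (use c2 in auto)
qed

text \<open>On the disc \<open>G = H\<close>, on the left half-plane \<open>G\<close> is affine, and on \<open>outer\<close> the growth of the Lipschitz
constant of \<open>retract\<close> near \<open>0\<close> is absorbed by the factors \<open>\<xi>\<close> and \<open>O(\<eta>)\<close>. Segments glue the three sets.\<close>
lemma G_Lipschitz: obtains M where "M-lipschitz_on UNIV G"
proof -
  obtain C0 C1 C2 where C: "C0 > 0" "C1 > 0" "C2 > 0"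
    and c0: "\<And>\<eta>. \<eta> \<in> cball 1 1 \<Longrightarrow> cmod (\<gamma> \<eta>) \<le> C0 \<and> 1 / C0 \<le> cmod (\<gamma> \<eta>) \<and> cmod (H \<eta>) \<le> C0 \<and> cmod (cap \<eta>) \<le> C0"
    and lip: "C1-lipschitz_on (cball 1 1) H" "C1-lipschitz_on (cball 1 1) \<gamma>"
    and K: "\<And>\<eta>1 \<eta>2. \<eta>1 \<in> cball 1 1 \<Longrightarrow> \<eta>2 \<in> cball 1 1 \<Longrightarrow> cmod (cap \<eta>1 - cap \<eta>2) \<le> C2 * max (cmod \<eta>1) (cmod \<eta>2) * cmod (\<eta>1 - \<eta>2)"
    using bounds by metis
  define M where "M = C0 + C1 + C1 * 2 + C2 * 2"
  have M: "M \<ge> 0" "C0 \<le> M" "C1 \<le> M" "C2 * 2 + C0 + C1 * 2 \<le> M" using C by (auto simp: M_def)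
  have disc: "M-lipschitz_on (cball 1 1) G"
  proof (rule lipschitz_on_transform)
    show "M-lipschitz_on (cball 1 1) H" by (rule lipschitz_on_mono[OF lip(1)]) (use M in auto)
  qed (simp add: G_def)
  have left: "M-lipschitz_on {\<xi>. Re \<xi> \<le> 0} G"
  proof (rule lipschitz_onI)
    fix x y assume "x \<in> {\<xi>. Re \<xi> \<le> 0}" "y \<in> {\<xi>. Re \<xi> \<le> 0}"
    then have "G x - G y = (y - x) * \<gamma> 0" by (simp add: G_def retract_left algebra_simps)
    then have "cmod (G x - G y) = cmod (\<gamma> 0) * cmod (x - y)" by (simp add: norm_mult norm_minus_commute)
    also have "\<dots> \<le> M * cmod (x - y)" using c0[of 0] M by (intro mult_right_mono) auto
    finally show "dist (G x) (G y) \<le> M * dist x y" by (simp add: dist_norm)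
  qed (rule M)
  have outer: "M-lipschitz_on outer G"
  proof (rule lipschitz_onI)
    fix x y assume xy: "x \<in> outer" "y \<in> outer"
    define \<eta>1 \<eta>2 where "\<eta>1 = retract x" and "\<eta>2 = retract y"
    have \<eta>: "\<eta>1 \<in> cball 1 1" "\<eta>2 \<in> cball 1 1" using retract_in_disc by (auto simp: \<eta>1_def \<eta>2_def)
    have r1: "cmod (\<eta>1 - \<eta>2) * cmod y \<le> 2 * cmod (x - y)"
      using retract_outer_Lipschitz[OF xy] by (simp add: \<eta>1_def \<eta>2_def)
    have r2: "cmod (\<eta>1 - \<eta>2) * cmod x \<le> 2 * cmod (x - y)"
      using retract_outer_Lipschitz[OF xy(2,1)] by (simp add: \<eta>1_def \<eta>2_def norm_minus_commute)
    have "max (cmod \<eta>1) (cmod \<eta>2) \<le> max (cmod x) (cmod y)"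
      using retract_outer_le[OF xy(1)] retract_outer_le[OF xy(2)] by (auto simp: \<eta>1_def \<eta>2_def)
    then have "max (cmod \<eta>1) (cmod \<eta>2) * cmod (\<eta>1 - \<eta>2) \<le> max (cmod x) (cmod y) * cmod (\<eta>1 - \<eta>2)"
      by (intro mult_right_mono) auto
    also have "\<dots> \<le> 2 * cmod (x - y)" using r1 r2 by (simp add: max_def mult.commute)
    finally have "C2 * (max (cmod \<eta>1) (cmod \<eta>2) * cmod (\<eta>1 - \<eta>2)) \<le> C2 * (2 * cmod (x - y))" using C by (intro mult_left_mono) auto
    then have KK: "cmod (cap \<eta>1 - cap \<eta>2) \<le> C2 * 2 * cmod (x - y)" using K[OF \<eta>] by (simp add: mult.assoc)
    have "G x - G y = (cap \<eta>1 - cap \<eta>2) - ((x - y) * \<gamma> \<eta>1 + y * (\<gamma> \<eta>1 - \<gamma> \<eta>2))"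
      by (simp add: G_outer \<eta>1_def \<eta>2_def algebra_simps)
    then have "cmod (G x - G y) \<le> cmod (cap \<eta>1 - cap \<eta>2) + (cmod (x - y) * cmod (\<gamma> \<eta>1) + cmod y * cmod (\<gamma> \<eta>1 - \<gamma> \<eta>2))"
      using norm_triangle_ineq4[of "cap \<eta>1 - cap \<eta>2" "(x - y) * \<gamma> \<eta>1 + y * (\<gamma> \<eta>1 - \<gamma> \<eta>2)"]
        norm_triangle_ineq[of "(x - y) * \<gamma> \<eta>1" "y * (\<gamma> \<eta>1 - \<gamma> \<eta>2)"] unfolding norm_mult by simp
    moreover have "cmod (x - y) * cmod (\<gamma> \<eta>1) \<le> cmod (x - y) * C0" using c0[OF \<eta>(1)] by (intro mult_left_mono) auto
    moreover have "cmod y * cmod (\<gamma> \<eta>1 - \<gamma> \<eta>2) \<le> cmod y * (C1 * cmod (\<eta>1 - \<eta>2))"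
      using lipschitz_onD[OF lip(2) \<eta>] by (intro mult_left_mono) (auto simp: dist_norm)
    moreover have "cmod y * (C1 * cmod (\<eta>1 - \<eta>2)) \<le> C1 * (2 * cmod (x - y))"
      using mult_left_mono[OF r1, of C1] C by (simp add: mult_ac)
    ultimately have "cmod (G x - G y) \<le> (C2 * 2 + C0 + C1 * 2) * cmod (x - y)" using KK by (simp add: algebra_simps)
    also have "\<dots> \<le> M * cmod (x - y)" using M by (intro mult_right_mono) auto
    finally show "dist (G x) (G y) \<le> M * dist x y" by (simp add: dist_norm)
  qed (rule M)
  have "M-lipschitz_on UNIV G"
  proof (rule lipschitz_onI)
    fix x y :: complex
    define U where "U = (\<lambda>i::nat. {t::real. x + of_real t * (y - x) \<in> (if i = 0 then cball 1 1 else if i = 1 then {\<xi>. Re \<xi> \<le> 0} else outer)})"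
    define p where "p t = x + of_real t * (y - x)" for t :: real
    have "(M * cmod (y - x))-lipschitz_on {0..1::real} (\<lambda>t. G (p t))"
    proof (rule lipschitz_on_closed_Union[where I="{0,1,2::nat}" and U=U])
      have cp: "continuous_on UNIV p" unfolding p_def[abs_def] by (intro continuous_intros)
      have co: "closed outer"
      proof -
        have eq: "outer = {\<xi>. 0 \<le> Re \<xi>} \<inter> {\<xi>. 1 \<le> cmod (\<xi> - 1)}" by (auto simp: outer_def)
        show ?thesis unfolding eq by (intro closed_Int closed_Collect_le continuous_intros)
      qed
      have cl: "closed (p -` S)" if "closed S" for S using continuous_closed_vimage[OF that, of p] cp
        by (simp add: continuous_on_eq_continuous_at)
      have Ue: "U 0 = p -` cball 1 1" "U 1 = p -` {\<xi>. Re \<xi> \<le> 0}" "U 2 = p -` outer" by (auto simp: U_def p_def)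
      have "closed {\<xi>. Re \<xi> \<le> 0}" by (intro closed_Collect_le continuous_intros)
      then have "closed (U 0)" "closed (U 1)" "closed (U 2)" unfolding Ue using cl co by blast+
      then show "closed (U i)" if "i \<in> {0,1,2}" for i using that by blast
      have pl: "dist (p s) (p t) = cmod (y - x) * dist s t" for s t
      proof -
        have "p s - p t = of_real (s - t) * (y - x)" by (simp add: p_def algebra_simps)
        then show ?thesis by (simp add: dist_norm norm_mult del: of_real_diff)
      qed
      have lipS: "(M * cmod (y - x))-lipschitz_on (p -` S) (\<lambda>t. G (p t))" if "M-lipschitz_on S G" for S
      proof (rule lipschitz_onI)
        fix s t assume "s \<in> p -` S" "t \<in> p -` S"
        then have "dist (G (p s)) (G (p t)) \<le> M * dist (p s) (p t)" using that by (auto simp: lipschitz_on_def)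
        then show "dist (G (p s)) (G (p t)) \<le> M * cmod (y - x) * dist s t" by (simp add: pl)
      qed (use M in auto)
      show "(M * cmod (y - x))-lipschitz_on (U i) (\<lambda>t. G (p t))" if "i \<in> {0,1,2}" for i
      proof -
        have "(M * cmod (y - x))-lipschitz_on (U 0) (\<lambda>t. G (p t))" "(M * cmod (y - x))-lipschitz_on (U 1) (\<lambda>t. G (p t))"
          "(M * cmod (y - x))-lipschitz_on (U 2) (\<lambda>t. G (p t))"
          unfolding Ue using lipS[OF disc] lipS[OF left] lipS[OF outer] by blast+
        then show ?thesis using that by blast
      qed
      show "{0..1} \<subseteq> (\<Union>i\<in>{0,1,2}. U i)"
        by (auto simp: U_def outer_def dist_norm norm_minus_commute)
    qed (use M in auto)
    then have "dist (G (p 0)) (G (p 1)) \<le> M * cmod (y - x) * dist (0::real) 1" by (rule lipschitz_onD) auto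
    then show "dist (G x) (G y) \<le> M * dist x y" by (simp add: p_def dist_norm norm_minus_commute)
  qed (rule M)
  then show thesis by (rule that)
qed

lemma contG: "continuous_on UNIV G"
  using G_Lipschitz lipschitz_on_continuous_on by metis

lemma G_lower:
  obtains m R where "m > 0" "R > 0" "\<And>\<xi>. R \<le> cmod \<xi> \<Longrightarrow> m * cmod \<xi> \<le> cmod (G \<xi>)"
proof -
  obtain C0 where C: "C0 > 0"
    and c0: "\<And>\<eta>. \<eta> \<in> cball 1 1 \<Longrightarrow> cmod (\<gamma> \<eta>) \<le> C0 \<and> 1 / C0 \<le> cmod (\<gamma> \<eta>) \<and> cmod (H \<eta>) \<le> C0 \<and> cmod (cap \<eta>) \<le> C0"
    using bounds by metis
  define m where "m = 1 / (2 * C0)"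
  define R where "R = C0 / m"
  have mR: "m > 0" "R > 0" using C by (auto simp: m_def R_def)
  show thesis
  proof (rule that[OF mR])
    fix \<xi> assume \<xi>: "R \<le> cmod \<xi>"
    note c = c0[OF retract_in_disc[of \<xi>]]
    have "cmod (\<xi> * \<gamma> (retract \<xi>)) - cmod (cap (retract \<xi>)) \<le> cmod (G \<xi>)"
      using norm_triangle_ineq2[of "\<xi> * \<gamma> (retract \<xi>)" "cap (retract \<xi>)"] by (simp add: G_outer norm_minus_commute)
    moreover have "cmod \<xi> * (1 / C0) \<le> cmod (\<xi> * \<gamma> (retract \<xi>))" unfolding norm_mult using c by (intro mult_left_mono) auto
    moreover have "cmod \<xi> * (1 / C0) = 2 * m * cmod \<xi>" by (simp add: m_def)
    moreover have "C0 \<le> m * cmod \<xi>" using \<xi> mR C by (simp add: R_def field_simps)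
    ultimately show "m * cmod \<xi> \<le> cmod (G \<xi>)" using c by linarith
  qed
qed

text \<open>The boundary curve \<open>g(1 + e\<^sup>2\<^sup>i\<^sup>\<phi>)\<close> turns monotonically about \<open>0\<close>: its argument \<open>\<phi> + Im l\<close>, read on the smaller
circles through \<open>0\<close>, has derivative \<open>2 Re X - 1\<close> with \<open>X = (1 + \<delta> \<rho>) / (1 + \<delta> q)\<close>, and \<open>Re X \<ge> 1/2\<close> amounts to
\<open>\<bar>1 / X - 1\<bar> \<le> 1\<close>, that is, to \<open>\<bar>\<delta> \<rho>\<bar> \<le> \<bar>1 + \<delta> \<rho>\<bar>\<close>. At the ends \<open>\<phi> = \<plusminus>\<pi>/2\<close> the argument is that of \<open>\<plusminus>\<i> \<gamma>(0)\<close>.\<close>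
lemma half_plane_image:
  assumes "0 < Re \<xi>" "1 \<le> cmod (\<xi> - 1)"
  shows "0 \<le> Re (\<xi> * \<gamma> (retract \<xi>) / \<gamma> 0)"
proof -
  have cz: "(cmod (of_real \<rho> * z - 1))\<^sup>2 = \<rho>\<^sup>2 * (cmod z)\<^sup>2 - 2 * \<rho> * Re z + 1" for \<rho> z
    unfolding cmod_power2 by (simp add: power2_eq_square algebra_simps)
  have c1: "(cmod (1 + cis t))\<^sup>2 = 2 + 2 * cos t" for t
  proof -
    have "(cmod (1 + cis t))\<^sup>2 = 1 + 2 * cos t + ((cos t)\<^sup>2 + (sin t)\<^sup>2)"
      unfolding cmod_power2 by (simp add: power2_eq_square algebra_simps)
    then show ?thesis by simp
  qed
  define u where "u \<rho> \<phi> = \<phi> + Im (l (of_real \<rho> * (1 + cis (2 * \<phi>))))" for \<rho> \<phi> :: real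
  have indisc: "of_real \<rho> * (1 + cis (2 * \<phi>)) \<in> ball 1 1" if "0 < \<rho>" "\<rho> < 1" "-pi/2 < \<phi>" "\<phi> < pi/2" for \<rho> \<phi> :: real
  proof -
    have c: "cos \<phi> > 0" using that by (intro cos_gt_zero_pi) auto
    have re: "Re (1 + cis (2 * \<phi>)) = 2 * (cos \<phi>)\<^sup>2" by (simp add: cos_double_cos)
    have nn: "(cmod (1 + cis (2 * \<phi>)))\<^sup>2 = 4 * (cos \<phi>)\<^sup>2" unfolding c1 by (simp add: cos_double_cos)
    have "(cmod (of_real \<rho> * (1 + cis (2 * \<phi>)) - 1))\<^sup>2 = \<rho>\<^sup>2 * (cmod (1 + cis (2 * \<phi>)))\<^sup>2 - 2 * \<rho> * Re (1 + cis (2 * \<phi>)) + 1"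
      by (rule cz)
    also have "\<dots> = 1 - 4 * \<rho> * (1 - \<rho>) * (cos \<phi>)\<^sup>2" unfolding nn re by (simp add: power2_eq_square algebra_simps)
    also have "\<dots> < 1" using that c by simp
    finally have "cmod (of_real \<rho> * (1 + cis (2 * \<phi>)) - 1) < 1" by (simp add: power_less_one_iff abs_square_less_1)
    then show ?thesis by (simp add: dist_norm norm_minus_commute)
  qed
  have oncirc: "1 + cis (2 * \<phi>) \<in> cball 1 1" for \<phi> by (simp add: dist_norm)
  have mono: "u \<rho> a \<le> u \<rho> b" if \<rho>: "0 < \<rho>" "\<rho> < 1" and ab: "-pi/2 < a" "a \<le> b" "b < pi/2" for \<rho> a b
  proof (rule DERIV_nonneg_imp_nondecreasing[OF ab(2)])
    fix \<phi> assume \<phi>: "a \<le> \<phi>" "\<phi> \<le> b"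
    define q where "q = of_real \<rho> * (1 + cis (2 * \<phi>))"
    have q: "q \<in> ball 1 1" unfolding q_def using indisc \<rho> ab \<phi> by auto
    define \<delta> where "\<delta> = \<alpha> q"
    have \<delta>: "\<delta> \<in> dil_disc k" using \<alpha>[OF q] by (simp add: \<delta>_def)
    have nz: "1 + \<delta> * q \<noteq> 0" using one_plus_dil_bound(2)[OF k \<delta> ball_cball[OF q]] .
    have \<rho>c: "of_real \<rho> \<in> cball (1::complex) 1"
      using \<rho> dist_of_real[of 1 \<rho>, where 'a=complex] by (simp add: dist_real_def)
    have nz\<rho>: "1 + \<delta> * of_real \<rho> \<noteq> 0" using one_plus_dil_bound(2)[OF k \<delta> \<rho>c] .
    have dq: "((\<lambda>\<phi>. of_real \<rho> * (1 + cis (2 * \<phi>))) has_vector_derivative (2 * \<i> * (q - of_real \<rho>))) (at \<phi>)"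
    proof -
      have "((\<lambda>\<phi>. of_real \<rho> * (1 + exp (\<i> * (2 * of_real \<phi>)))) has_vector_derivative (2 * \<i> * (q - of_real \<rho>))) (at \<phi>)"
        by (rule has_vector_derivative_real_field)
           (auto intro!: derivative_eq_intros simp: q_def cis_conv_exp algebra_simps)
      then show ?thesis by (simp add: cis_conv_exp)
    qed
    have "((\<lambda>\<phi>. l (of_real \<rho> * (1 + cis (2 * \<phi>)))) has_vector_derivative (2 * \<i> * (q - of_real \<rho>)) * (- \<delta> / (1 + \<delta> * q))) (at \<phi>)"
      using field_vector_diff_chain_at[OF dq, of l "- \<delta> / (1 + \<delta> * q)"] derl[OF q]
      by (simp add: q_def[symmetric] \<delta>_def o_def)
    then have "((\<lambda>\<phi>. Im (l (of_real \<rho> * (1 + cis (2 * \<phi>))))) has_real_derivative Im ((2 * \<i> * (q - of_real \<rho>)) * (- \<delta> / (1 + \<delta> * q)))) (at \<phi>)"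
      by (rule has_field_derivative_Im)
    then have "(u \<rho> has_real_derivative 1 + Im ((2 * \<i> * (q - of_real \<rho>)) * (- \<delta> / (1 + \<delta> * q)))) (at \<phi>)"
      unfolding u_def by (intro DERIV_add DERIV_ident)
    moreover have "0 \<le> 1 + Im ((2 * \<i> * (q - of_real \<rho>)) * (- \<delta> / (1 + \<delta> * q)))"
    proof -
      define X where "X = (1 + \<delta> * of_real \<rho>) / (1 + \<delta> * q)"
      have "(2 * \<i> * (q - of_real \<rho>)) * (- \<delta> / (1 + \<delta> * q)) = 2 * \<i> * (X - 1)"
        using nz by (simp add: X_def field_simps)
      then have e: "1 + Im ((2 * \<i> * (q - of_real \<rho>)) * (- \<delta> / (1 + \<delta> * q))) = 2 * Re X - 1" by simp
      have qr: "cmod (q - of_real \<rho>) = \<rho>"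
      proof -
        have "q - of_real \<rho> = of_real \<rho> * cis (2 * \<phi>)" by (simp add: q_def algebra_simps)
        then show ?thesis using \<rho> by (simp add: norm_mult)
      qed
      have r1: "cmod (\<delta> * of_real \<rho>) \<le> cmod (1 + \<delta> * of_real \<rho>)"
      proof -
        have "0 \<le> (1 - k\<^sup>2) / 4" using k by (simp add: abs_square_le_1)
        then have "0 \<le> 1 + 2 * Re \<delta>" using dil_disc_bounds(3)[OF k \<delta>] by linarith
        then have "\<rho> * (- 1 / 2) \<le> \<rho> * Re \<delta>" using \<rho> by (intro mult_left_mono) auto
        then have "0 \<le> 1 + 2 * \<rho> * Re \<delta>" using \<rho> by linarith
        moreover have "(cmod (1 + \<delta> * of_real \<rho>))\<^sup>2 - (cmod (\<delta> * of_real \<rho>))\<^sup>2 = 1 + 2 * \<rho> * Re \<delta>"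
          unfolding cmod_power2 by (simp add: power2_eq_square algebra_simps)
        ultimately have "(cmod (\<delta> * of_real \<rho>))\<^sup>2 \<le> (cmod (1 + \<delta> * of_real \<rho>))\<^sup>2" by linarith
        then show ?thesis by (rule power2_le_imp_le) simp
      qed
      have X0: "X \<noteq> 0" using nz nz\<rho> by (simp add: X_def)
      have "1 / X - 1 = \<delta> * (q - of_real \<rho>) / (1 + \<delta> * of_real \<rho>)" using nz nz\<rho> by (simp add: X_def field_simps)
      then have "cmod (1 / X - 1) = cmod (\<delta> * of_real \<rho>) / cmod (1 + \<delta> * of_real \<rho>)"
        using \<rho> by (simp add: norm_divide norm_mult qr)
      also have "\<dots> \<le> 1" using r1 nz\<rho> by (simp add: divide_le_eq)
      finally have "cmod (1 / X - 1) \<le> 1" .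
      moreover have "1 / X - 1 = (1 - X) / X" using X0 by (simp add: field_simps)
      ultimately have "cmod (1 - X) \<le> cmod X" using X0 by (simp add: norm_divide divide_le_eq)
      then have "(cmod (1 - X))\<^sup>2 \<le> (cmod X)\<^sup>2" by (intro power_mono) auto
      then have "1 \<le> 2 * Re X" unfolding cmod_power2 by (simp add: power2_eq_square algebra_simps)
      then show ?thesis unfolding e by linarith
    qed
    ultimately show "\<exists>y. (u \<rho> has_real_derivative y) (at \<phi>) \<and> 0 \<le> y" by blast
  qed
  have cont_u: "continuous_on UNIV (\<lambda>\<phi>. u 1 \<phi>)"
  proof -
    have "continuous_on UNIV (\<lambda>\<phi>. l (1 + cis (2 * \<phi>)))"
      by (rule continuous_on_compose2[OF contl]) (use oncirc in \<open>auto intro!: continuous_intros\<close>)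
    then show ?thesis unfolding u_def by (auto intro!: continuous_intros)
  qed
  have mono1: "u 1 a \<le> u 1 b" if ab: "-pi/2 < a" "a \<le> b" "b < pi/2" for a b
  proof (rule tendsto_le)
    have lim: "((\<lambda>\<rho>. u \<rho> c) \<longlongrightarrow> u 1 c) (at_left 1)" if c: "-pi/2 < c" "c < pi/2" for c
    proof -
      have "((\<lambda>\<rho>. l (of_real \<rho> * (1 + cis (2 * c)))) \<longlongrightarrow> l (1 + cis (2 * c))) (at_left (1::real))"
      proof (rule continuous_on_tendsto_compose[OF contl])
        have "((\<lambda>\<rho>. of_real \<rho> * (1 + cis (2 * c))) \<longlongrightarrow> of_real 1 * (1 + cis (2 * c))) (at_left (1::real))"
          by (intro tendsto_intros)
        then show "((\<lambda>\<rho>. of_real \<rho> * (1 + cis (2 * c))) \<longlongrightarrow> 1 + cis (2 * c)) (at_left (1::real))" by simp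
        have "eventually (\<lambda>\<rho>::real. \<rho> \<in> {0<..<1}) (at_left 1)" by (intro eventually_at_left_real) simp
        then show "eventually (\<lambda>\<rho>. of_real \<rho> * (1 + cis (2 * c)) \<in> cball 1 1) (at_left (1::real))"
          by eventually_elim (use indisc[of _ c] c in \<open>auto intro: less_imp_le\<close>)
      qed (rule oncirc)
      then show ?thesis unfolding u_def by (auto intro!: tendsto_intros)
    qed
    show "((\<lambda>\<rho>. u \<rho> b) \<longlongrightarrow> u 1 b) (at_left 1)" "((\<lambda>\<rho>. u \<rho> a) \<longlongrightarrow> u 1 a) (at_left 1)" using lim ab by auto
    have "eventually (\<lambda>\<rho>::real. \<rho> \<in> {0<..<1}) (at_left 1)" by (intro eventually_at_left_real) simp
    then show "eventually (\<lambda>\<rho>. u \<rho> a \<le> u \<rho> b) (at_left (1::real))" by eventually_elim (use mono ab in auto)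
  qed simp
  define r \<phi> where "r = cmod \<xi>" and "\<phi> = Arg \<xi>"
  have \<xi>0: "\<xi> \<noteq> 0" using assms by auto
  have \<xi>: "\<xi> = of_real r * cis \<phi>" by (simp add: r_def \<phi>_def rcis_cmod_Arg flip: rcis_def)
  have r: "r > 0" using \<xi>0 by (simp add: r_def)
  have \<phi>: "-pi/2 < \<phi>" "\<phi> < pi/2" using Arg_Re_pos[of \<xi>] assms(1) unfolding \<phi>_def by auto
  have ret: "retract \<xi> = 1 + cis (2 * \<phi>)"
  proof -
    have "\<xi> / cnj \<xi> = cis \<phi> / cis (- \<phi>)" unfolding \<xi> using r by (simp add: cis_cnj)
    also have "\<dots> = cis (2 * \<phi>)" by (simp add: cis_divide)
    finally show ?thesis using retract_outside[OF assms(2,1)] by simp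
  qed
  have "cis (2 * (-pi/2)) = -1" by (simp add: complex_eq_iff)
  then have e1: "u 1 (pi/2) = pi/2 + Im (l 0)" "u 1 (-pi/2) = -pi/2 + Im (l 0)"
    by (simp_all only: u_def) simp_all
  have cu: "(u 1 \<longlongrightarrow> u 1 c) (at c within S)" for c S
    by (meson cont_u continuous_on_def UNIV_I subset_UNIV tendsto_within_subset)
  have up: "u 1 \<phi> \<le> pi/2 + Im (l 0)"
  proof -
    have "eventually (\<lambda>b. b \<in> {\<phi><..<pi/2}) (at_left (pi/2))" using \<phi> by (intro eventually_at_left_real) simp
    then have "eventually (\<lambda>b. u 1 \<phi> \<le> u 1 b) (at_left (pi/2))" by eventually_elim (use mono1 \<phi> in auto)
    from tendsto_lowerbound[OF cu this] show ?thesis by (simp add: e1)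
  qed
  have low: "-pi/2 + Im (l 0) \<le> u 1 \<phi>"
  proof -
    have "eventually (\<lambda>b. b \<in> {-pi/2<..<\<phi>}) (at_right (-pi/2))" using \<phi> by (intro eventually_at_right_real) simp
    then have "eventually (\<lambda>b. u 1 b \<le> u 1 \<phi>) (at_right (-pi/2))" by eventually_elim (use mono1 \<phi> in auto)
    from tendsto_upperbound[OF cu this] show ?thesis unfolding e1 by simp
  qed
  define \<eta> where "\<eta> = retract \<xi>"
  have "\<xi> * \<gamma> \<eta> / \<gamma> 0 = of_real r * (cis \<phi> * exp (l \<eta> - l 0))" unfolding \<xi> \<gamma>_def by (simp add: exp_diff)
  also have "\<dots> = of_real (r * exp (Re (l \<eta> - l 0))) * cis (\<phi> + Im (l \<eta> - l 0))"
    by (simp add: exp_eq_polar[of "l \<eta> - l 0"] cis_mult[symmetric] mult_ac)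
  finally have "Re (\<xi> * \<gamma> \<eta> / \<gamma> 0) = r * exp (Re (l \<eta> - l 0)) * cos (\<phi> + Im (l \<eta> - l 0))" by simp
  moreover have "\<phi> + Im (l \<eta> - l 0) = u 1 \<phi> - Im (l 0)" by (simp add: u_def \<eta>_def ret)
  then have "0 \<le> cos (\<phi> + Im (l \<eta> - l 0))" using up low by (intro cos_ge_zero) auto
  ultimately show ?thesis using r unfolding \<eta>_def by simp
qed

text \<open>Outside the disc and in the right half-plane, \<open>G \<xi>\<close> is \<open>- \<xi> * \<gamma> (retract \<xi>)\<close> up to a bounded term, and by
the preceding lemma it cannot come near a far point in direction \<open>\<gamma> 0\<close>.\<close>
lemma unique_far_point:
  obtains R where "R > 0" "\<And>\<xi>. G \<xi> = H 0 + of_real R * \<gamma> 0 \<Longrightarrow> \<xi> = - of_real R"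
proof -
  obtain C0 where C: "C0 > 0"
    and c0: "\<And>\<eta>. \<eta> \<in> cball 1 1 \<Longrightarrow> cmod (\<gamma> \<eta>) \<le> C0 \<and> 1 / C0 \<le> cmod (\<gamma> \<eta>) \<and> cmod (H \<eta>) \<le> C0 \<and> cmod (cap \<eta>) \<le> C0"
    using bounds by metis
  define R where "R = 2 * C0 * C0 + 1"
  have R: "R > 0" using C by (simp add: R_def add_pos_pos)
  have g0: "cmod (x / \<gamma> 0) < R" if "cmod x \<le> 2 * C0" for x
  proof -
    have "1 / cmod (\<gamma> 0) \<le> C0" using c0[of 0] C \<gamma>_nonzero[of 0] by (simp add: field_simps)
    then have "cmod x * (1 / cmod (\<gamma> 0)) \<le> (2 * C0) * C0" using that C by (intro mult_mono) auto
    then show ?thesis by (simp add: R_def norm_divide)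
  qed
  show thesis
  proof (rule that[OF R])
    fix \<xi> assume eq: "G \<xi> = H 0 + of_real R * \<gamma> 0"
    show "\<xi> = - of_real R"
    proof (cases "\<xi> \<in> cball 1 1")
      case True
      then have "(H \<xi> - H 0) / \<gamma> 0 = of_real R" using eq \<gamma>_nonzero by (simp add: G_def)
      moreover have "cmod (H \<xi> - H 0) \<le> 2 * C0" using norm_triangle_ineq4[of "H \<xi>" "H 0"] c0[OF True] c0[of 0] by simp
      ultimately show ?thesis using g0 R by fastforce
    next
      case False
      show ?thesis
      proof (cases "0 < Re \<xi>")
        case True
        have "(cap (retract \<xi>) - H 0) / \<gamma> 0 = of_real R + \<xi> * \<gamma> (retract \<xi>) / \<gamma> 0"
          using eq \<gamma>_nonzero[of 0] by (simp add: G_outer field_simps)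
        then have "R \<le> Re ((cap (retract \<xi>) - H 0) / \<gamma> 0)"
          using half_plane_image[OF True] False by (simp add: dist_norm norm_minus_commute)
        also have "\<dots> \<le> cmod ((cap (retract \<xi>) - H 0) / \<gamma> 0)" by (rule complex_Re_le_cmod)
        also have "\<dots> < R" using norm_triangle_ineq4[of "cap (retract \<xi>)" "H 0"] c0[OF retract_in_disc[of \<xi>]] c0[of 0] by (intro g0) simp
        finally show ?thesis by simp
      next
        case False
        then have "- \<xi> * \<gamma> 0 = of_real R * \<gamma> 0" using eq by (simp add: G_def retract_left)
        then have "- \<xi> = of_real R" using \<gamma>_nonzero[of 0] by (metis mult_right_cancel)
        then show ?thesis by (metis minus_minus)
      qed
    qed
  qed
qed

end

section \<open>Injectivity and dilatation of the radial extension\<close>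

text \<open>The set of values taken at least twice, \<open>G 0\<close> excluded, is open by invariance of domain, and closed
since two distinct preimages cannot merge at a point of local injectivity. The exceptional point \<open>0\<close> is
recovered from openness of \<open>G\<close> at a second preimage of \<open>G 0\<close>.\<close>
lemma proper_locally_injective_imp_injective:
  fixes G :: "complex \<Rightarrow> complex"
  assumes cont: "continuous_on UNIV G" and proper: "\<And>B. bounded {\<xi>. cmod (G \<xi>) \<le> B}"
    and loc: "\<And>\<xi>. \<xi> \<noteq> 0 \<Longrightarrow> \<exists>r>0. inj_on G (ball \<xi> r)"
    and unique: "\<omega> \<noteq> G 0" "\<And>x y. G x = \<omega> \<Longrightarrow> G y = \<omega> \<Longrightarrow> x = y"
  shows "inj G"
proof -
  have img: "open (G ` ball x r)" if "inj_on G (ball x r)" for x r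
    using that by (intro invariance_of_domain continuous_on_subset[OF cont]) auto
  have loc': "\<exists>r. 0 < r \<and> r \<le> R \<and> inj_on G (ball \<xi> r)" if nz: "\<xi> \<noteq> 0" and R: "R > 0" for \<xi> R
  proof -
    obtain r where "r > 0" "inj_on G (ball \<xi> r)" using loc[OF nz] by blast
    then show ?thesis using R by (intro exI[of _ "min r R"]) (auto elim: inj_on_subset)
  qed
  \<comment> \<open>The values other than \<open>G 0\<close> with two preimages.\<close>
  define A where "A = {w. w \<noteq> G 0 \<and> (\<exists>x y. x \<noteq> y \<and> G x = w \<and> G y = w)}"
  have "open A"
    unfolding open_subopen[of A]
  proof
    fix w assume "w \<in> A"
    then obtain x y where w: "w \<noteq> G 0" "x \<noteq> y" "G x = w" "G y = w" by (auto simp: A_def)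
    define R where "R = dist x y / 2"
    have R: "R > 0" using w by (simp add: R_def)
    have xy0: "x \<noteq> 0" "y \<noteq> 0" using w by auto
    obtain r1 where r1: "0 < r1" "r1 \<le> R" "inj_on G (ball x r1)" using loc'[OF xy0(1) R] by blast
    obtain r2 where r2: "0 < r2" "r2 \<le> R" "inj_on G (ball y r2)" using loc'[OF xy0(2) R] by blast
    have dis: "x' \<noteq> y'" if "x' \<in> ball x r1" "y' \<in> ball y r2" for x' y'
    proof
      assume "x' = y'"
      then have "dist x y < r1 + r2" using that dist_triangle[of x y x'] by (simp add: dist_commute)
      then show False using r1 r2 by (simp add: R_def)
    qed
    let ?T = "G ` ball x r1 \<inter> G ` ball y r2 \<inter> - {G 0}"
    have "open ?T" using img[OF r1(3)] img[OF r2(3)] by auto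
    moreover have "w \<in> G ` ball x r1" "w \<in> G ` ball y r2"
      using imageI[of x "ball x r1" G] imageI[of y "ball y r2" G] w r1 r2 by simp_all
    then have "w \<in> ?T" using w(1) by blast
    moreover have "?T \<subseteq> A"
    proof
      fix z assume z: "z \<in> ?T"
      then obtain x' y' where "x' \<in> ball x r1" "y' \<in> ball y r2" "G x' = z" "G y' = z" by auto
      then show "z \<in> A" unfolding A_def using z dis[of x' y'] by blast
    qed
    ultimately show "\<exists>T. open T \<and> w \<in> T \<and> T \<subseteq> A" by blast
  qed
  then have op: "openin (top_of_set (- {G 0})) A" by (auto simp: openin_open A_def)
  have cl: "closedin (top_of_set (- {G 0})) A"
    unfolding closedin_closed
  proof (intro exI[of _ "closure A"] conjI equalityI subsetI)
    show "x \<in> - {G 0} \<inter> closure A" if "x \<in> A" for x using that closure_subset[of A] by (auto simp: A_def)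
    fix l assume l: "l \<in> - {G 0} \<inter> closure A"
    then obtain w where wl: "(\<forall>n. w n \<in> A) \<and> l \<in> - {G 0} \<and> w \<longlonglongrightarrow> l" by (auto simp: closure_sequential)
    then have "\<forall>n. \<exists>p. fst p \<noteq> snd p \<and> G (fst p) = w n \<and> G (snd p) = w n" by (auto simp: A_def)
    then obtain p where p: "\<And>n. fst (p n) \<noteq> snd (p n) \<and> G (fst (p n)) = w n \<and> G (snd (p n)) = w n" by metis
    have "bounded (range w)" using wl by (intro convergent_imp_bounded) auto
    then obtain B where B: "\<And>n. cmod (w n) \<le> B" by (auto simp: bounded_iff)
    have "bounded (range p)"
      by (rule bounded_subset[OF bounded_Times[OF proper[of B] proper[of B]]])
         (use p B in \<open>simp add: image_subset_iff mem_Times_iff\<close>)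
    then obtain q r where qr: "strict_mono r" "(p \<circ> r) \<longlonglongrightarrow> q" using bounded_imp_convergent_subsequence by blast
    have lim: "(\<lambda>n. fst (p (r n))) \<longlonglongrightarrow> fst q" "(\<lambda>n. snd (p (r n))) \<longlonglongrightarrow> snd q"
      using tendsto_fst[OF qr(2)] tendsto_snd[OF qr(2)] by (auto simp: o_def)
    have cG: "isCont G z" for z using cont by (simp add: continuous_on_eq_continuous_at)
    have wr: "(\<lambda>n. w (r n)) \<longlonglongrightarrow> l" using wl qr(1) LIMSEQ_subseq_LIMSEQ[of w l r] by (simp add: o_def)
    have Gq: "G (fst q) = l" "G (snd q) = l"
      using isCont_tendsto_compose[OF cG lim(1)] isCont_tendsto_compose[OF cG lim(2)] p wr LIMSEQ_unique by auto
    have "fst q \<noteq> snd q"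
    proof
      assume eq: "fst q = snd q"
      have "fst q \<noteq> 0" using Gq wl by auto
      then obtain d where d: "d > 0" "inj_on G (ball (fst q) d)" using loc by blast
      have "eventually (\<lambda>n. fst (p (r n)) \<in> ball (fst q) d) sequentially"
        using lim(1) d(1) by (auto simp: tendsto_iff dist_commute)
      moreover have "eventually (\<lambda>n. snd (p (r n)) \<in> ball (fst q) d) sequentially"
        using lim(2) d(1) eq by (auto simp: tendsto_iff dist_commute)
      ultimately have "eventually (\<lambda>n. False) sequentially"
      proof eventually_elim
        fix n assume "fst (p (r n)) \<in> ball (fst q) d" "snd (p (r n)) \<in> ball (fst q) d"
        then show False using p[of "r n"] inj_on_eq_iff[OF d(2)] by metis
      qed
      then show False by simp
    qed
    then show "l \<in> A" using Gq wl by (auto simp: A_def)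
  qed simp
  have "connected (- {G 0})" by (intro connected_punctured_universe) simp
  then have "A = {} \<or> A = - {G 0}" using op cl by (simp add: connected_clopen)
  moreover have "\<omega> \<notin> A" using unique by (auto simp: A_def)
  ultimately have A: "A = {}" using unique(1) by blast
  have key: "z = 0" if z: "G z = G 0" for z
  proof (rule ccontr)
    assume z0: "z \<noteq> 0"
    then obtain r where r: "0 < r" "r \<le> cmod z / 2" "inj_on G (ball z r)" using loc'[of z "cmod z / 2"] by auto
    have "open (G -` (G ` ball z r))" using img[OF r(3)] cont by (intro open_vimage) auto
    moreover have "0 \<in> G -` (G ` ball z r)" using z r(1) by (auto intro!: image_eqI[of _ G z])
    ultimately obtain d where d: "d > 0" "ball 0 d \<subseteq> G -` (G ` ball z r)" using open_contains_ball by blast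
    define e where "e = min d (cmod z / 2)"
    have e: "e > 0" "e \<le> d" "e \<le> cmod z / 2" using d z0 by (auto simp: e_def)
    have const: "G x = G 0" if x: "x \<in> ball 0 e" for x
    proof (rule ccontr)
      assume ne: "G x \<noteq> G 0"
      have "x \<in> ball 0 d" using x e by auto
      then obtain x' where x': "x' \<in> ball z r" "G x' = G x" using d(2) by (metis imageE subsetD vimageE)
      have "x \<noteq> x'"
      proof
        assume "x = x'"
        then have "cmod z < e + r" using x x'(1) norm_triangle_ineq[of x "z - x"] by (simp add: dist_norm)
        then show False using e r by linarith
      qed
      then have "G x \<in> A" using ne x'(2) unfolding A_def by blast
      then show False using A by simp
    qed
    have e2: "complex_of_real (e / 2) \<noteq> 0" using e by simp
    obtain s where s: "0 < s" "s \<le> e / 2" "inj_on G (ball (of_real (e/2)) s)" using loc'[OF e2, of "e / 2"] e by auto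
    let ?a = "complex_of_real (e/2)" and ?b = "complex_of_real (e/2 + s/2)"
    have "dist ?a ?b = s/2" using s(1) dist_of_real[of "e/2" "e/2 + s/2", where 'a=complex] by (simp add: dist_real_def)
    then have "?a \<in> ball ?a s" "?b \<in> ball ?a s" using s(1) by (simp_all only: mem_ball dist_self)
    moreover have "?a \<in> ball 0 e" "?b \<in> ball 0 e" unfolding mem_ball dist_0_norm norm_of_real using s e by auto
    then have "G ?a = G ?b" using const[of ?a] const[of ?b] by (simp only:)
    ultimately have "?a = ?b" using inj_on_eq_iff[OF s(3)] by blast
    then have "e/2 = e/2 + s/2" by (simp only: of_real_eq_iff)
    then show False using s(1) by simp
  qed
  show "inj G"
  proof (rule injI, rule ccontr)
    fix x y assume xy: "G x = G y" "x \<noteq> y"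
    then have "G x = G 0" using A by (auto simp: A_def)
    then show False using key[of x] key[of y] xy by simp
  qed
qed

text \<open>From \<open>v Y \<approx> t w\<close> the direction of \<open>Y\<close> is that of \<open>w / v\<close>, provided the error is small against \<open>\<bar>Y\<bar>\<close>. Used
with \<open>w\<close> close to a boundary point \<open>\<eta>\<close> and \<open>e1\<close> the outer normal.\<close>
lemma outward_of_balance:
  fixes v Y e w e1 :: complex
  assumes t: "0 < t" and bal: "v * Y + e = of_real t * w" and e: "cmod e \<le> \<epsilon> * cmod Y" "0 \<le> \<epsilon>"
    and v: "a \<le> cmod v" "cmod v \<le> b" "0 < a" and w: "cmod w \<le> 3" and e1: "cmod e1 = 1"
    and q: "q / 2 \<le> Re (cnj v * (w * cnj e1))" and small: "\<epsilon> \<le> a / 2" "\<epsilon> * b * 6 / a < q / 2"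
  shows "0 < Re (Y * cnj e1)"
proof -
  have "cmod v * cmod Y = cmod (of_real t * w - e)" using bal by (metis add_diff_cancel_right' norm_mult)
  also have "\<dots> \<le> t * cmod w + cmod e" using norm_triangle_ineq4[of "of_real t * w" e] t by (simp add: norm_mult)
  also have "\<dots> \<le> t * 3 + a / 2 * cmod Y"
    using w t e small by (intro add_mono mult_left_mono order_trans[OF e(1)] mult_right_mono) auto
  finally have "a * cmod Y \<le> t * 3 + a / 2 * cmod Y" using mult_right_mono[OF v(1), of "cmod Y"] by simp
  then have Y: "cmod Y \<le> 6 * t / a" using v(3) by (simp add: field_simps)
  have "(cmod v)\<^sup>2 * Re (Y * cnj e1) = Re (cnj v * cnj e1 * (v * Y))"
  proof -
    have "cnj v * cnj e1 * (v * Y) = (v * cnj v) * (Y * cnj e1)" by (simp add: mult_ac)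
    also have "\<dots> = of_real ((cmod v)\<^sup>2) * (Y * cnj e1)" by (simp only: complex_norm_square)
    finally show ?thesis
      by (simp only: Re_complex_of_real Im_complex_of_real times_complex.sel mult_zero_left diff_zero)
  qed
  also have "v * Y = of_real t * w - e" using bal by (simp add: eq_diff_eq)
  also have "cnj v * cnj e1 * (of_real t * w - e) = of_real t * (cnj v * (w * cnj e1)) - cnj v * cnj e1 * e" by (simp add: algebra_simps)
  also have "Re \<dots> = t * Re (cnj v * (w * cnj e1)) - Re (cnj v * cnj e1 * e)" by simp
  finally have eq: "(cmod v)\<^sup>2 * Re (Y * cnj e1) = t * Re (cnj v * (w * cnj e1)) - Re (cnj v * cnj e1 * e)" .
  have "Re (cnj v * cnj e1 * e) \<le> cmod (cnj v * cnj e1 * e)" by (rule complex_Re_le_cmod)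
  also have "\<dots> = cmod v * cmod e" using e1 by (simp add: norm_mult)
  also have "\<dots> \<le> b * (\<epsilon> * (6 * t / a))"
    using v e Y by (intro mult_mono order_trans[OF e(1)] mult_left_mono) auto
  also have "\<dots> = t * (\<epsilon> * b * 6 / a)" by simp
  also have "\<dots> < t * (q / 2)" using small(2) t by (intro mult_strict_left_mono)
  also have "\<dots> \<le> t * Re (cnj v * (w * cnj e1))" using q t by (intro mult_left_mono) auto
  finally have "0 < (cmod v)\<^sup>2 * Re (Y * cnj e1)" unfolding eq by simp
  then show ?thesis by (simp add: zero_less_mult_iff)
qed

text \<open>Taking real parts of \<open>\<Delta> \<approx> - 2 \<delta> u\<close> gives \<open>u \<le> Re \<Delta> \<approx> - 2 u Re \<delta>\<close>, which contradicts \<open>1 + 2 Re \<delta> > 0\<close> unless \<open>u = 0\<close>.\<close>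
lemma collapse_of_balance:
  fixes \<Delta> \<delta> E :: complex
  assumes eq: "\<Delta> = - 2 * \<delta> * of_real u + E" and E: "cmod E \<le> \<theta> * (u + cmod \<Delta>)"
    and u: "0 \<le> u" "u \<le> Re \<Delta>" and d: "cmod \<delta> \<le> d" and q: "q \<le> 1 + 2 * Re \<delta>"
    and \<theta>: "0 \<le> \<theta>" "\<theta> \<le> 1/2" "\<theta> * (4 * d + 2) < q"
  shows "\<Delta> = 0"
proof -
  have "cmod \<Delta> \<le> cmod (- 2 * \<delta> * of_real u) + cmod E" unfolding eq by (rule norm_triangle_ineq)
  also have "cmod (- 2 * \<delta> * of_real u) = 2 * cmod \<delta> * u" using u by (simp add: norm_mult)
  also have "2 * cmod \<delta> * u \<le> 2 * d * u" using d u by (intro mult_right_mono) auto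
  finally have 1: "cmod \<Delta> \<le> 2 * d * u + cmod E" by simp
  have "\<theta> * (u + cmod \<Delta>) \<le> 1/2 * (u + cmod \<Delta>)" using \<theta> u by (intro mult_right_mono) auto
  then have D: "cmod \<Delta> \<le> (4 * d + 1) * u" using 1 E by (simp add: algebra_simps)
  have "u = 0"
  proof (rule ccontr)
    assume "u \<noteq> 0"
    then have up: "u > 0" using u by simp
    have "Re \<Delta> = - 2 * Re \<delta> * u + Re E" using arg_cong[OF eq, of Re] by simp
    moreover have "Re E \<le> \<theta> * (u + (4 * d + 1) * u)"
      using complex_Re_le_cmod[of E] E D \<theta> by (intro order_trans[OF complex_Re_le_cmod] order_trans[OF E] mult_left_mono) auto
    ultimately have "u * (1 + 2 * Re \<delta>) \<le> u * (\<theta> * (4 * d + 2))" using u by (simp add: algebra_simps)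
    moreover have "u * (\<theta> * (4 * d + 2)) < u * q" using up \<theta>(3) by simp
    moreover have "u * q \<le> u * (1 + 2 * Re \<delta>)" using up q by simp
    ultimately show False by linarith
  qed
  then show ?thesis using D by simp
qed

context radial_extension begin

lemma locally_injective_disc:
  assumes "\<xi>0 \<in> ball 1 1"
  shows "\<exists>r>0. inj_on G (ball \<xi>0 r)"
proof -
  define e where "e = cmod (\<gamma> \<xi>0) * ((1 - k) / 4)"
  have e: "e > 0" using k \<gamma>_nonzero by (simp add: e_def)
  obtain d where d: "d > 0" "\<And>\<eta>1 \<eta>2. \<eta>1 \<in> cball 1 1 \<inter> ball \<xi>0 d \<Longrightarrow> \<eta>2 \<in> cball 1 1 \<inter> ball \<xi>0 d \<Longrightarrow>
     \<exists>u\<in>speed_disc k \<xi>0. cmod (H \<eta>1 - H \<eta>2 + \<gamma> \<xi>0 * u * (\<eta>1 - \<eta>2)) \<le> e * cmod (\<eta>1 - \<eta>2)"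
    using H_increment[OF ball_cball[OF assms] e] by blast
  obtain s where s: "s > 0" "ball \<xi>0 s \<subseteq> ball 1 1" using assms open_contains_ball[of "ball 1 1"] by blast
  have "inj_on G (ball \<xi>0 (min d s))"
  proof (rule inj_onI)
    fix x y assume xy: "x \<in> ball \<xi>0 (min d s)" "y \<in> ball \<xi>0 (min d s)" "G x = G y"
    have "x \<in> ball \<xi>0 s" "y \<in> ball \<xi>0 s" using xy by auto
    then have c: "x \<in> cball 1 1" "y \<in> cball 1 1" using s(2) ball_cball by blast+
    then have "H x = H y" using xy(3) by (simp add: G_def)
    then obtain u where u: "u \<in> speed_disc k \<xi>0" "cmod (\<gamma> \<xi>0 * u * (x - y)) \<le> e * cmod (x - y)"
      using d(2)[of x y] c xy by auto
    have "(1 - k) / 2 \<le> cmod u" using speed_disc_bounds(1)[OF k u(1) ball_cball[OF assms]] .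
    then have "cmod (\<gamma> \<xi>0) * ((1 - k) / 2) * cmod (x - y) \<le> cmod (\<gamma> \<xi>0 * u * (x - y))"
      unfolding norm_mult by (intro mult_right_mono mult_left_mono) auto
    then have "cmod (\<gamma> \<xi>0) * ((1 - k) / 2) * cmod (x - y) \<le> e * cmod (x - y)" using u(2) by linarith
    moreover have "cmod (\<gamma> \<xi>0) * ((1 - k) / 2) = 2 * e" by (simp add: e_def)
    ultimately have "2 * e * cmod (x - y) \<le> e * cmod (x - y)" by simp
    then have "e * cmod (x - y) \<le> 0" by simp
    then show "x = y" using e by (simp add: mult_le_0_iff)
  qed
  then show ?thesis using d s by (intro exI[of _ "min d s"]) auto
qed

definition stretch where "stretch \<xi> = max 1 ((cmod \<xi>)\<^sup>2 / (2 * Re \<xi>))"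

lemma stretch_retract:
  assumes "0 < Re \<xi>"
  shows "\<xi> = of_real (stretch \<xi>) * retract \<xi>" "1 \<le> stretch \<xi>" "1 < stretch \<xi> \<Longrightarrow> cmod (retract \<xi> - 1) = 1"
    "G \<xi> = H (retract \<xi>) - of_real (stretch \<xi> - 1) * g (retract \<xi>)"
proof -
  have x0: "\<xi> \<noteq> 0" using assms by auto
  show s1: "1 \<le> stretch \<xi>" by (simp add: stretch_def)
  have "\<xi> = of_real (stretch \<xi>) * retract \<xi> \<and> (1 < stretch \<xi> \<longrightarrow> cmod (retract \<xi> - 1) = 1)"
  proof (cases "1 \<le> cmod (\<xi> - 1)")
    case True
    then have "2 * Re \<xi> \<le> (cmod \<xi>)\<^sup>2" by (simp add: outside_iff)
    then have s: "stretch \<xi> = (cmod \<xi>)\<^sup>2 / (2 * Re \<xi>)" using assms by (simp add: stretch_def)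
    have r: "retract \<xi> = of_real (2 * Re \<xi>) / cnj \<xi>" using retract_outside[OF True assms] one_plus_unimodular[OF x0] by simp
    have "of_real (stretch \<xi>) * retract \<xi> = of_real ((cmod \<xi>)\<^sup>2) / cnj \<xi>"
      unfolding s r of_real_divide using assms by simp
    also have "\<dots> = \<xi>" using x0 by (simp only: complex_norm_square) simp
    finally have "of_real (stretch \<xi>) * retract \<xi> = \<xi>" .
    moreover have "cmod (retract \<xi> - 1) = 1" using retract_outside[OF True assms] x0 by (simp add: norm_divide)
    ultimately show ?thesis by simp
  next
    case False
    then have "(cmod \<xi>)\<^sup>2 < 2 * Re \<xi>" by (simp add: outside_iff)
    then have "stretch \<xi> = 1" using assms by (simp add: stretch_def max_def divide_le_eq)
    moreover have "retract \<xi> = \<xi>" using False by (intro retract_disc) (simp add: dist_norm norm_minus_commute)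
    ultimately show ?thesis by simp
  qed
  then show e: "\<xi> = of_real (stretch \<xi>) * retract \<xi>" and "1 < stretch \<xi> \<Longrightarrow> cmod (retract \<xi> - 1) = 1" by auto
  have "\<xi> - retract \<xi> = of_real (stretch \<xi> - 1) * retract \<xi>"
    by (subst (1) e) (simp add: algebra_simps)
  then show "G \<xi> = H (retract \<xi>) - of_real (stretch \<xi> - 1) * g (retract \<xi>)"
    by (simp add: G_def g_def mult.assoc)
qed

lemma isCont_retract:
  assumes "0 < Re \<xi>"
  shows "isCont retract \<xi>"
proof -
  have "isCont (\<lambda>\<xi>. \<xi> / of_real (stretch \<xi>)) \<xi>"
  proof -
    have "stretch \<xi> \<noteq> 0" using stretch_retract(2)[OF assms] by linarith
    then show ?thesis unfolding stretch_def using assms by (intro continuous_intros) auto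
  qed
  moreover have "eventually (\<lambda>x. x / of_real (stretch x) = retract x) (nhds \<xi>)"
  proof -
    have "eventually (\<lambda>x. x \<in> {x. 0 < Re x}) (nhds \<xi>)"
      using assms by (intro eventually_nhds_in_open open_Collect_less continuous_intros) auto
    then show ?thesis
    proof eventually_elim
      fix x assume "x \<in> {x. 0 < Re x}"
      then have x: "0 < Re x" by simp
      have "complex_of_real (stretch x) \<noteq> 0" using stretch_retract(2)[OF x] by simp
      then show "x / of_real (stretch x) = retract x" using stretch_retract(1)[OF x] by (metis nonzero_mult_div_cancel_left)
    qed
  qed
  ultimately show ?thesis by (simp add: isCont_cong)
qed

text \<open>Suppose \<open>G\<close> takes the same value at \<open>s1 \<eta>1\<close> and \<open>s2 \<eta>2\<close>, \<open>s1 \<ge> s2\<close>. Then \<open>(s1 - s2) g(\<eta>1)\<close> equals the increment of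
\<open>H - (s2 - 1) g\<close> from \<open>\<eta>2\<close> to \<open>\<eta>1\<close>, which is about \<open>s2 \<gamma> v (\<eta>2 - \<eta>1)\<close>. If \<open>s1 > s2\<close>, then \<open>\<eta>1\<close> is on the circle
and \<open>\<eta>2 - \<eta>1\<close> is a positive multiple of about \<open>\<eta>1 / v\<close>; this points out of the disc, which contains \<open>\<eta>2\<close>.
So \<open>s1 = s2\<close>, and \<open>\<eta>1 = \<eta>2\<close> because \<open>v\<close> is bounded away from \<open>0\<close>.\<close>
lemma locally_injective_right:
  assumes re: "0 < Re \<xi>0" and out: "1 \<le> cmod (\<xi>0 - 1)"
  shows "\<exists>r>0. inj_on G (ball \<xi>0 r)"
proof -
  define \<eta>0 where "\<eta>0 = retract \<xi>0"
  have \<xi>00: "\<xi>0 \<noteq> 0" using re by auto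
  have \<eta>c: "\<eta>0 \<in> cball 1 1" using retract_in_disc by (simp add: \<eta>0_def)
  have \<eta>0: "cmod (\<eta>0 - 1) = 1" "\<eta>0 \<noteq> 0"
  proof -
    show "cmod (\<eta>0 - 1) = 1" using retract_outside[OF out re] \<xi>00 by (simp add: \<eta>0_def norm_divide)
    have "\<eta>0 = of_real (2 * Re \<xi>0) / cnj \<xi>0"
      unfolding \<eta>0_def retract_outside[OF out re] by (rule one_plus_unimodular[OF \<xi>00])
    then show "\<eta>0 \<noteq> 0" using re \<xi>00 by simp
  qed
  define a b where "a = (1 - k) / 2" and "b = 2 / (1 - k)"
  define q where "q = a\<^sup>2 * ((cmod \<eta>0)\<^sup>2 / 2 * ((1 - k\<^sup>2) / 4))"
  have ab: "0 < a" "0 < b" using k by (auto simp: a_def b_def)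
  have "0 < 1 - k\<^sup>2" using k by (simp add: power_less_one_iff abs_square_less_1)
  then have q: "0 < q" using ab \<eta>0 by (simp add: q_def)
  \<comment> \<open>The two smallness conditions of \<open>outward_of_balance\<close>.\<close>
  define \<epsilon> where "\<epsilon> = min (a / 2) (q * a / (24 * b))"
  have \<epsilon>: "0 < \<epsilon>" "\<epsilon> \<le> a / 2" "\<epsilon> * b * 6 / a < q / 2"
  proof -
    show "0 < \<epsilon>" "\<epsilon> \<le> a / 2" using ab q by (auto simp: \<epsilon>_def)
    have "\<epsilon> * b * 6 / a \<le> (q * a / (24 * b)) * b * 6 / a"
      using ab by (intro divide_right_mono mult_right_mono) (auto simp: \<epsilon>_def)
    also have "\<dots> = q / 4" using ab by (simp add: field_simps)
    finally show "\<epsilon> * b * 6 / a < q / 2" using q by linarith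
  qed
  define e where "e = cmod (\<gamma> \<eta>0) * \<epsilon>"
  have e: "e > 0" using \<epsilon> \<gamma>_nonzero by (simp add: e_def)
  obtain d1 where d1: "d1 > 0" "\<And>\<eta>1 \<eta>2. \<eta>1 \<in> cball 1 1 \<inter> ball \<eta>0 d1 \<Longrightarrow> \<eta>2 \<in> cball 1 1 \<inter> ball \<eta>0 d1 \<Longrightarrow>
     \<exists>u\<in>speed_disc k \<eta>0. cmod (H \<eta>1 - H \<eta>2 + \<gamma> \<eta>0 * u * (\<eta>1 - \<eta>2)) \<le> e * cmod (\<eta>1 - \<eta>2)"
    using H_increment[OF \<eta>c e] by blast
  obtain d2 where d2: "d2 > 0" "\<And>\<eta>1 \<eta>2. \<eta>1 \<in> cball 1 1 \<inter> ball \<eta>0 d2 \<Longrightarrow> \<eta>2 \<in> cball 1 1 \<inter> ball \<eta>0 d2 \<Longrightarrow>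
     \<exists>u\<in>speed_disc k \<eta>0. cmod (g \<eta>1 - g \<eta>2 - \<gamma> \<eta>0 * u * (\<eta>1 - \<eta>2)) \<le> e * cmod (\<eta>1 - \<eta>2)"
    using g_increment[OF \<eta>c e] by blast
  define X where "X \<eta> = g \<eta> / \<gamma> \<eta>0 * cnj (\<eta> - 1)" for \<eta>
  have X0: "X \<eta>0 = \<eta>0 * cnj (\<eta>0 - 1)" using \<gamma>_nonzero by (simp add: X_def g_def)
  have cX: "continuous_on (cball 1 1) X" unfolding X_def[abs_def] using \<gamma>_nonzero by (intro continuous_intros contg) auto
  have qb: "q / (2 * b) > 0" using q ab by simp
  obtain d3 where d3: "d3 > 0" "\<And>\<eta>. \<eta> \<in> cball 1 1 \<Longrightarrow> dist \<eta> \<eta>0 < d3 \<Longrightarrow> dist (X \<eta>) (X \<eta>0) < q / (2 * b)"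
    using cX \<eta>c qb unfolding continuous_on_iff by meson
  have cg: "continuous_on (cball 1 1) (\<lambda>\<eta>. g \<eta> / \<gamma> \<eta>0)" using \<gamma>_nonzero by (intro continuous_intros contg) auto
  obtain d4 where d4: "d4 > 0" "\<And>\<eta>. \<eta> \<in> cball 1 1 \<Longrightarrow> dist \<eta> \<eta>0 < d4 \<Longrightarrow> dist (g \<eta> / \<gamma> \<eta>0) (g \<eta>0 / \<gamma> \<eta>0) < 1"
    using cg \<eta>c unfolding continuous_on_iff by (meson zero_less_one)
  define d where "d = Min {d1, d2, d3, d4}"
  have d: "d > 0" "d \<le> d1" "d \<le> d2" "d \<le> d3" "d \<le> d4" using d1 d2 d3 d4 by (auto simp: d_def)
  obtain r1 where r1: "r1 > 0" "\<And>\<xi>. dist \<xi> \<xi>0 < r1 \<Longrightarrow> dist (retract \<xi>) \<eta>0 < d"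
    using isCont_retract[OF re] d(1) unfolding continuous_at_eps_delta \<eta>0_def by blast
  define r where "r = min r1 (Re \<xi>0)"
  have r: "r > 0" using r1 re by (simp add: r_def)
  have main: "\<xi>1 = \<xi>2" if \<xi>: "\<xi>1 \<in> ball \<xi>0 r" "\<xi>2 \<in> ball \<xi>0 r" "G \<xi>1 = G \<xi>2" "stretch \<xi>2 \<le> stretch \<xi>1" for \<xi>1 \<xi>2
  proof -
    have rpos: "0 < Re x" if "x \<in> ball \<xi>0 r" for x
    proof -
      have "\<bar>Re (\<xi>0 - x)\<bar> < Re \<xi>0" using that abs_Re_le_cmod[of "\<xi>0 - x"] by (simp add: r_def dist_norm)
      then show ?thesis by simp
    qed
    note R = rpos[OF \<xi>(1)] rpos[OF \<xi>(2)]
    define \<eta>1 \<eta>2 s1 s2 where "\<eta>1 = retract \<xi>1" and "\<eta>2 = retract \<xi>2" and "s1 = stretch \<xi>1" and "s2 = stretch \<xi>2"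
    have \<eta>1: "\<eta>1 \<in> cball 1 1" "dist \<eta>1 \<eta>0 < d" and \<eta>2: "\<eta>2 \<in> cball 1 1" "dist \<eta>2 \<eta>0 < d"
      using retract_in_disc r1(2) \<xi>(1,2) by (auto simp: \<eta>1_def \<eta>2_def r_def dist_commute)
    have s: "1 \<le> s1" "1 \<le> s2" "s2 \<le> s1" using stretch_retract(2)[OF R(1)] stretch_retract(2)[OF R(2)] \<xi>(4) by (auto simp: s1_def s2_def)
    obtain u where u: "u \<in> speed_disc k \<eta>0" "cmod (H \<eta>1 - H \<eta>2 + \<gamma> \<eta>0 * u * (\<eta>1 - \<eta>2)) \<le> e * cmod (\<eta>1 - \<eta>2)"
      using d1(2)[of \<eta>1 \<eta>2] \<eta>1 \<eta>2 d by (auto simp: dist_commute)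
    obtain w where w: "w \<in> speed_disc k \<eta>0" "cmod (g \<eta>1 - g \<eta>2 - \<gamma> \<eta>0 * w * (\<eta>1 - \<eta>2)) \<le> e * cmod (\<eta>1 - \<eta>2)"
      using d2(2)[of \<eta>1 \<eta>2] \<eta>1 \<eta>2 d by (auto simp: dist_commute)
    \<comment> \<open>The two increments combine to a single point of the speed disc, by convexity.\<close>
    define v where "v = (1 / s2) *\<^sub>R u + ((s2 - 1) / s2) *\<^sub>R w"
    have v: "v \<in> speed_disc k \<eta>0"
      using u(1) w(1) s(2) unfolding speed_disc_eq_cball[OF k \<eta>c] v_def
      by (intro convexD[OF convex_cball]) (auto simp: field_simps)
    have vs: "of_real s2 * v = u + of_real (s2 - 1) * w"
      unfolding v_def using s(2) by (simp add: scaleR_conv_of_real field_simps)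
    define Y where "Y = \<eta>2 - \<eta>1"
    define E where "E = (H \<eta>1 - H \<eta>2 + \<gamma> \<eta>0 * u * (\<eta>1 - \<eta>2)) - of_real (s2 - 1) * (g \<eta>1 - g \<eta>2 - \<gamma> \<eta>0 * w * (\<eta>1 - \<eta>2))"
    have nY: "cmod (\<eta>1 - \<eta>2) = cmod Y" by (simp add: Y_def norm_minus_commute)
    have "cmod E \<le> e * cmod Y + (s2 - 1) * (e * cmod Y)"
      unfolding E_def using u(2) w(2) s(2) unfolding nY
      by (intro order_trans[OF norm_triangle_ineq4] add_mono) (auto simp: norm_mult simp del: of_real_diff intro!: mult_left_mono)
    then have E: "cmod E \<le> s2 * (e * cmod Y)" by (simp add: algebra_simps)
    have "H \<eta>1 - of_real (s1 - 1) * g \<eta>1 = H \<eta>2 - of_real (s2 - 1) * g \<eta>2"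
      using \<xi>(3) stretch_retract(4)[OF R(1)] stretch_retract(4)[OF R(2)] by (simp add: \<eta>1_def \<eta>2_def s1_def s2_def)
    then have "\<gamma> \<eta>0 * (u + of_real (s2 - 1) * w) * Y + E = of_real (s1 - s2) * g \<eta>1"
      unfolding E_def Y_def by (simp add: algebra_simps)
    then have bal0: "of_real s2 * (\<gamma> \<eta>0 * v * Y) + E = of_real (s1 - s2) * g \<eta>1"
      unfolding vs[symmetric] by (simp only: mult_ac)
    define t where "t = (s1 - s2) / s2"
    define E' where "E' = E / (of_real s2 * \<gamma> \<eta>0)"
    have bal: "v * Y + E' = of_real t * (g \<eta>1 / \<gamma> \<eta>0)"
    proof -
      have nz: "of_real s2 * \<gamma> \<eta>0 \<noteq> 0" using s \<gamma>_nonzero by auto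
      have "v * Y + E' = (of_real s2 * (\<gamma> \<eta>0 * v * Y) + E) / (of_real s2 * \<gamma> \<eta>0)"
        using nz by (simp add: E'_def add_divide_distrib mult_ac)
      also have "\<dots> = of_real t * (g \<eta>1 / \<gamma> \<eta>0)" unfolding bal0 by (simp add: t_def)
      finally show ?thesis .
    qed
    have E': "cmod E' \<le> \<epsilon> * cmod Y"
    proof -
      have "cmod E' = cmod E / (s2 * cmod (\<gamma> \<eta>0))" using s by (simp add: E'_def norm_divide norm_mult)
      also have "\<dots> \<le> (s2 * (e * cmod Y)) / (s2 * cmod (\<gamma> \<eta>0))" using E s by (intro divide_right_mono) auto
      also have "\<dots> = \<epsilon> * cmod Y" using s \<gamma>_nonzero by (simp add: e_def)
      finally show ?thesis .
    qed
    have vb: "a \<le> cmod v" "cmod v \<le> b" using speed_disc_bounds[OF k v \<eta>c] by (auto simp: a_def b_def)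
    have "s1 = s2"
    proof (rule ccontr)
      assume "s1 \<noteq> s2"
      then have s12: "s2 < s1" using s by simp
      then have t: "t > 0" using s by (simp add: t_def)
      have on: "cmod (\<eta>1 - 1) = 1" using stretch_retract(3)[OF R(1)] s12 s(2) by (simp add: s1_def \<eta>1_def)
      have "dist (g \<eta>1 / \<gamma> \<eta>0) (g \<eta>0 / \<gamma> \<eta>0) < 1" using d4(2)[of \<eta>1] \<eta>1 d by auto
      moreover have "g \<eta>0 / \<gamma> \<eta>0 = \<eta>0" using \<gamma>_nonzero by (simp add: g_def)
      moreover have "cmod \<eta>0 \<le> 2" using retract_norm_le by (simp add: \<eta>0_def)
      ultimately have w3: "cmod (g \<eta>1 / \<gamma> \<eta>0) \<le> 3"
        using norm_triangle_ineq[of "g \<eta>1 / \<gamma> \<eta>0 - \<eta>0" \<eta>0] by (simp add: dist_norm)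
      have "q / 2 \<le> Re (cnj v * X \<eta>1)"
      proof -
        have "q \<le> Re (cnj v * X \<eta>0)" using speed_disc_outward[OF k v \<eta>0] by (simp only: X0 q_def a_def)
        moreover have "cmod (cnj v * (X \<eta>1 - X \<eta>0)) \<le> b * (q / (2 * b))"
          unfolding norm_mult using d3(2)[of \<eta>1] \<eta>1 d vb ab by (intro mult_mono) (auto simp: dist_norm)
        moreover have "Re (cnj v * X \<eta>1) = Re (cnj v * X \<eta>0) + Re (cnj v * (X \<eta>1 - X \<eta>0))" by (simp add: algebra_simps)
        moreover have "b * (q / (2 * b)) = q / 2" using ab by simp
        ultimately show ?thesis using abs_Re_le_cmod[of "cnj v * (X \<eta>1 - X \<eta>0)"] by linarith
      qed
      then have qX: "q / 2 \<le> Re (cnj v * (g \<eta>1 / \<gamma> \<eta>0 * cnj (\<eta>1 - 1)))" by (simp only: X_def)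
      have "0 < Re (Y * cnj (\<eta>1 - 1))"
        by (rule outward_of_balance[OF t bal E' _ vb ab(1) w3 on qX \<epsilon>(2,3)]) (use \<epsilon> in simp)
      moreover have "(cmod (\<eta>2 - 1))\<^sup>2 \<le> 1" using \<eta>2(1) by (simp add: dist_norm norm_minus_commute abs_square_le_1)
      moreover have "(cmod (\<eta>2 - 1))\<^sup>2 = (cmod (\<eta>1 - 1))\<^sup>2 + 2 * Re (Y * cnj (\<eta>1 - 1)) + (cmod Y)\<^sup>2"
        unfolding cmod_power2 Y_def by (simp add: power2_eq_square algebra_simps)
      moreover have "(cmod (\<eta>1 - 1))\<^sup>2 = 1" "0 \<le> (cmod Y)\<^sup>2" using on by simp_all
      ultimately show False by linarith
    qed
    have "cmod (v * Y) \<le> \<epsilon> * cmod Y"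
    proof -
      have "v * Y = - E'" using bal \<open>s1 = s2\<close> by (simp add: t_def eq_neg_iff_add_eq_0)
      then show ?thesis using E' by simp
    qed
    then have "a * cmod Y \<le> a / 2 * cmod Y"
      using mult_right_mono[OF vb(1), of "cmod Y"] mult_right_mono[OF \<epsilon>(2), of "cmod Y"] by (simp add: norm_mult)
    then have "Y = 0" using ab by (simp add: mult_le_cancel_right)
    then have "\<eta>1 = \<eta>2" by (simp add: Y_def)
    then show ?thesis using stretch_retract(1)[OF R(1)] stretch_retract(1)[OF R(2)] \<open>s1 = s2\<close>
      unfolding \<eta>1_def \<eta>2_def s1_def s2_def by metis
  qed
  have "inj_on G (ball \<xi>0 r)"
  proof (rule inj_onI)
    fix x y assume xy: "x \<in> ball \<xi>0 r" "y \<in> ball \<xi>0 r" "G x = G y"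
    show "x = y"
    proof (cases "stretch y \<le> stretch x")
      case True
      then show ?thesis using main xy by blast
    next
      case False
      then show ?thesis using main[of y x] xy by simp
    qed
  qed
  then show ?thesis using r by blast
qed

text \<open>At \<open>\<eta> = 0\<close> the speed disc degenerates to a point, and the next order matters: the logarithmic derivative
of \<open>\<gamma>\<close> stays close to \<open>- dil_disc k\<close>.\<close>
lemma gamma_increment_at_0:
  assumes e: "e > 0"
  obtains d where "d > 0" "\<And>\<eta>1 \<eta>2. \<eta>1 \<in> cball 1 1 \<inter> ball 0 d \<Longrightarrow> \<eta>2 \<in> cball 1 1 \<inter> ball 0 d \<Longrightarrow>
     \<exists>\<delta>\<in>dil_disc k. cmod (\<gamma> \<eta>1 - \<gamma> \<eta>2 + \<gamma> 0 * \<delta> * (\<eta>1 - \<eta>2)) \<le> e * cmod (\<eta>1 - \<eta>2)"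
proof -
  define m where "m = complex_of_real (k\<^sup>2 / (1 - k\<^sup>2))"
  define R where "R = k / (1 - k\<^sup>2)"
  have dd: "dil_disc k = cball m R" unfolding m_def R_def by (rule dil_disc_eq_cball[OF k])
  have k2: "1 - k\<^sup>2 > 0" using k by (simp add: power_less_one_iff abs_square_less_1)
  have R: "R \<ge> 0" using k k2 by (simp add: R_def)
  define q where "q = 1 / (1 - k) * (1 / (1 - k)) * (2 / (1 - k))"
  let ?M = "\<lambda>\<eta>. - \<gamma> \<eta> * m" and ?r = "\<lambda>\<eta>. cmod (\<gamma> \<eta>) * (R + q * cmod \<eta>)"
  have der: "(\<gamma> has_field_derivative \<gamma> \<eta> * (- \<alpha> \<eta> / (1 + \<alpha> \<eta> * \<eta>))) (at \<eta>)" if "\<eta> \<in> ball 1 1" for \<eta>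
    using derl[OF that] unfolding \<gamma>_def[abs_def] by (auto intro!: derivative_eq_intros)
  have bd: "cmod (\<gamma> \<eta> * (- \<alpha> \<eta> / (1 + \<alpha> \<eta> * \<eta>)) - ?M \<eta>) \<le> ?r \<eta>" if \<eta>: "\<eta> \<in> ball 1 1" for \<eta>
  proof -
    note a = \<alpha>[OF \<eta>] and c = ball_cball[OF \<eta>]
    note nz = one_plus_dil_bound(2)[OF k a c]
    have "\<alpha> \<eta> / (1 + \<alpha> \<eta> * \<eta>) = \<alpha> \<eta> - \<alpha> \<eta> * \<alpha> \<eta> * (1 / (1 + \<alpha> \<eta> * \<eta>)) * \<eta>" using nz by (simp add: field_simps)
    moreover have "\<gamma> \<eta> * (- \<alpha> \<eta> / (1 + \<alpha> \<eta> * \<eta>)) - ?M \<eta> = \<gamma> \<eta> * (m - \<alpha> \<eta> / (1 + \<alpha> \<eta> * \<eta>))"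
      by (simp add: algebra_simps)
    ultimately have eq: "\<gamma> \<eta> * (- \<alpha> \<eta> / (1 + \<alpha> \<eta> * \<eta>)) - ?M \<eta> = \<gamma> \<eta> * ((m - \<alpha> \<eta>) + \<alpha> \<eta> * \<alpha> \<eta> * (1 / (1 + \<alpha> \<eta> * \<eta>)) * \<eta>)"
      by (simp only: diff_diff_eq2) (simp add: algebra_simps)
    have 1: "cmod (m - \<alpha> \<eta>) \<le> R" using a unfolding dd by (simp add: dist_norm)
    have "cmod (\<alpha> \<eta>) \<le> 1 / (1 - k)" using dil_disc_bounds(1)[OF k a] .
    moreover have "cmod (1 / (1 + \<alpha> \<eta> * \<eta>)) \<le> 2 / (1 - k)" using speed_disc_bounds(2)[OF k speed_in_disc[OF k a c] c] .
    ultimately have 2: "cmod (\<alpha> \<eta> * \<alpha> \<eta> * (1 / (1 + \<alpha> \<eta> * \<eta>)) * \<eta>) \<le> q * cmod \<eta>"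
      unfolding norm_mult q_def using k by (intro mult_right_mono mult_mono) auto
    show ?thesis unfolding eq norm_mult[of "\<gamma> \<eta>"]
      by (intro mult_left_mono order_trans[OF norm_triangle_ineq] add_mono 1 2) simp
  qed
  obtain d where d: "d > 0" "\<And>\<eta>1 \<eta>2. \<eta>1 \<in> cball 1 1 \<inter> ball 0 d \<Longrightarrow> \<eta>2 \<in> cball 1 1 \<inter> ball 0 d \<Longrightarrow>
     cmod (\<gamma> \<eta>1 - \<gamma> \<eta>2 - ?M 0 * (\<eta>1 - \<eta>2)) \<le> (?r 0 + e) * cmod (\<eta>1 - \<eta>2)"
    by (rule derivative_disc_mean_value[OF cont\<gamma> _ _ der bd _ e, of 0]) (auto intro!: continuous_intros cont\<gamma>)
  show thesis
  proof (rule that[OF d(1)])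
    fix \<eta>1 \<eta>2 :: complex assume E: "\<eta>1 \<in> cball 1 1 \<inter> ball 0 d" "\<eta>2 \<in> cball 1 1 \<inter> ball 0 d"
    show "\<exists>\<delta>\<in>dil_disc k. cmod (\<gamma> \<eta>1 - \<gamma> \<eta>2 + \<gamma> 0 * \<delta> * (\<eta>1 - \<eta>2)) \<le> e * cmod (\<eta>1 - \<eta>2)"
    proof (cases "\<eta>1 = \<eta>2")
      case True
      have "0 \<in> dil_disc k" using k by (simp add: dil_disc_def)
      then show ?thesis using True by (intro bexI[of _ 0]) auto
    next
      case False
      define y where "y = \<eta>1 - \<eta>2"
      have y: "y \<noteq> 0" using False by (simp add: y_def)
      have g0: "\<gamma> 0 \<noteq> 0" by (rule \<gamma>_nonzero)
      define w where "w = - (\<gamma> \<eta>1 - \<gamma> \<eta>2) / (\<gamma> 0 * y)"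
      have weq: "\<gamma> \<eta>1 - \<gamma> \<eta>2 = - \<gamma> 0 * y * w" using y g0 by (simp add: w_def)
      have "\<gamma> \<eta>1 - \<gamma> \<eta>2 - ?M 0 * y = - (\<gamma> 0 * (y * (w - m)))" unfolding weq by (simp add: algebra_simps)
      then have "cmod (\<gamma> 0) * (cmod y * cmod (w - m)) \<le> (?r 0 + e) * cmod y"
        using d(2)[OF E] unfolding y_def[symmetric] by (simp add: norm_mult)
      then have "cmod y * (cmod (\<gamma> 0) * cmod (w - m)) \<le> cmod y * (cmod (\<gamma> 0) * R + e)" by (simp add: mult_ac)
      then have "cmod (\<gamma> 0) * cmod (w - m) \<le> cmod (\<gamma> 0) * R + e" using y by simp
      then have "cmod (w - m) \<le> R + e / cmod (\<gamma> 0)" using g0 by (simp add: field_simps)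
      then obtain u where u: "u \<in> cball m R" "cmod (w - u) \<le> e / cmod (\<gamma> 0)"
        using R by (rule cball_approx[of w m R "e / cmod (\<gamma> 0)"]) (use e g0 in auto)
      have "\<gamma> \<eta>1 - \<gamma> \<eta>2 + \<gamma> 0 * u * y = - (\<gamma> 0 * (w - u)) * y" unfolding weq by (simp add: algebra_simps)
      moreover have "cmod (\<gamma> 0 * (w - u)) \<le> e" using u(2) g0 unfolding norm_mult by (simp add: field_simps)
      ultimately have "cmod (\<gamma> \<eta>1 - \<gamma> \<eta>2 + \<gamma> 0 * u * y) \<le> e * cmod y" by (simp add: norm_mult mult_right_mono)
      then show ?thesis using u(1) dd unfolding y_def by blast
    qed
  qed
qed

text \<open>Near a point of the imaginary axis the retraction is \<open>2 p / cnj \<xi>\<close>, with \<open>p\<close> the positive part of the real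
part. If \<open>G\<close> agrees at \<open>\<xi>1\<close> and \<open>\<xi>2\<close>, then to first order \<open>\<xi>1 - \<xi>2 = - 2 \<delta> (p1 - p2)\<close> with \<open>\<delta>\<close> in \<open>dil_disc k\<close>,
and \<open>collapse_of_balance\<close> applies. The constants \<open>\<theta>\<close>, \<open>e\<close> and \<open>\<tau>\<close> make all errors at most \<open>\<theta> (u + \<bar>\<Delta>\<bar>)\<close>.\<close>
lemma locally_injective_imaginary:
  assumes re: "Re \<xi>0 = 0" and nz: "\<xi>0 \<noteq> 0"
  shows "\<exists>r>0. inj_on G (ball \<xi>0 r)"
proof -
  obtain C0 C1 C2 where C: "C0 > 0" "C1 > 0" "C2 > 0"
    and c0: "\<And>\<eta>. \<eta> \<in> cball 1 1 \<Longrightarrow> cmod (\<gamma> \<eta>) \<le> C0 \<and> 1 / C0 \<le> cmod (\<gamma> \<eta>) \<and> cmod (H \<eta>) \<le> C0 \<and> cmod (cap \<eta>) \<le> C0"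
    and lip: "C1-lipschitz_on (cball 1 1) \<gamma>"
    and K: "\<And>\<eta>1 \<eta>2. \<eta>1 \<in> cball 1 1 \<Longrightarrow> \<eta>2 \<in> cball 1 1 \<Longrightarrow> cmod (cap \<eta>1 - cap \<eta>2) \<le> C2 * max (cmod \<eta>1) (cmod \<eta>2) * cmod (\<eta>1 - \<eta>2)"
    using bounds by metis
  define \<rho> where "\<rho> = cmod \<xi>0"
  have \<rho>: "\<rho> > 0" using nz by (simp add: \<rho>_def)
  define d q where "d = 1 / (1 - k)" and "q = (1 - k\<^sup>2) / 4"
  have d1: "d > 0" using k by (simp add: d_def)
  have "0 < 1 - k\<^sup>2" using k by (simp add: power_less_one_iff abs_square_less_1)
  then have q: "q > 0" "q \<le> 1 / 4" by (auto simp: q_def)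
  define \<theta> where "\<theta> = q / (2 * (4 * d + 2))"
  have \<theta>: "0 < \<theta>" "\<theta> \<le> 1/2" "\<theta> * (4 * d + 2) < q"
  proof -
    show "0 < \<theta>" using q d1 by (simp add: \<theta>_def)
    have "\<theta> * (4 * d + 2) = q / 2"
    proof -
      define X where "X = 4 * d + 2"
      have "X \<noteq> 0" using d1 by (simp add: X_def)
      then show ?thesis unfolding \<theta>_def X_def[symmetric] by simp
    qed
    then show "\<theta> * (4 * d + 2) < q" using q by simp
    have "\<theta> \<le> q / 4" unfolding \<theta>_def using q d1 by (intro divide_left_mono) auto
    then show "\<theta> \<le> 1/2" using q by simp
  qed
  define e where "e = \<theta> / (16 * C0)"
  have e: "e > 0" using \<theta> C by (simp add: e_def)
  obtain dd where dd: "dd > 0" "\<And>\<eta>1 \<eta>2. \<eta>1 \<in> cball 1 1 \<inter> ball 0 dd \<Longrightarrow> \<eta>2 \<in> cball 1 1 \<inter> ball 0 dd \<Longrightarrow>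
     \<exists>\<delta>\<in>dil_disc k. cmod (\<gamma> \<eta>1 - \<gamma> \<eta>2 + \<gamma> 0 * \<delta> * (\<eta>1 - \<eta>2)) \<le> e * cmod (\<eta>1 - \<eta>2)"
    using gamma_increment_at_0[OF e] by blast
  define D where "D = 8 * d + 16 * C0 * C2 / \<rho> + 4 * C0 * C1"
  have D: "D > 0" using d1 C \<rho> by (simp add: D_def add_pos_pos)
  have out: "cmod (\<xi>0 - 1) > 1"
  proof -
    have "Im \<xi>0 \<noteq> 0" using re nz by (simp add: complex_eq_iff)
    then have "(cmod (\<xi>0 - 1))\<^sup>2 > 1\<^sup>2" unfolding cmod_power2 using re by simp
    then show ?thesis by (rule power_less_imp_less_base) simp
  qed
  define \<tau> where "\<tau> = Min {1/4, dd / 8, \<theta> / (2 * D), (cmod (\<xi>0 - 1) - 1) / \<rho>}"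
  have \<tau>0: "0 < \<tau>" using dd(1) \<theta>(1) D out \<rho> by (simp add: \<tau>_def)
  have \<tau>': "\<tau> \<le> 1/4" "\<tau> \<le> dd / 8" "\<tau> \<le> \<theta> / (2 * D)" "\<tau> \<le> (cmod (\<xi>0 - 1) - 1) / \<rho>"
    unfolding \<tau>_def by (rule Min_le; simp)+
  have \<tau>: "0 < \<tau>" "\<tau> \<le> 1/4" "\<tau> \<le> dd / 8" "\<tau> \<le> \<theta> / (2 * D)" "\<tau> \<le> (cmod (\<xi>0 - 1) - 1) / \<rho>"
    using \<tau>0 \<tau>' by blast+
  define r where "r = \<rho> * \<tau>"
  have r: "r > 0" using \<rho> \<tau> by (simp add: r_def)
  have r4: "r \<le> \<rho> / 4" unfolding r_def using mult_left_mono[OF \<tau>(2), of \<rho>] \<rho> by simp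
  have rout: "r \<le> cmod (\<xi>0 - 1) - 1"
    unfolding r_def using mult_left_mono[OF \<tau>(5), of \<rho>] \<rho> by simp
  define p where "p \<xi> = max 0 (Re \<xi>)" for \<xi> :: complex
  have facts: "\<rho> / 2 \<le> cmod \<xi>" "\<xi> \<noteq> 0" "\<bar>Re \<xi>\<bar> \<le> r" "0 \<le> p \<xi>" "p \<xi> \<le> r" "retract \<xi> = of_real (2 * p \<xi>) / cnj \<xi>"
      "cmod (retract \<xi>) \<le> 4 * \<tau>" "retract \<xi> \<in> cball 1 1 \<inter> ball 0 dd" if \<xi>: "\<xi> \<in> ball \<xi>0 r" for \<xi>
  proof -
    have dx: "cmod (\<xi>0 - \<xi>) < r" using \<xi> by (simp add: dist_norm)
    then have "\<rho> - r \<le> cmod \<xi>" using norm_triangle_ineq2[of \<xi>0 "\<xi>0 - \<xi>"] by (simp add: \<rho>_def)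
    then show h: "\<rho> / 2 \<le> cmod \<xi>" using r4 \<rho> by linarith
    then show n0: "\<xi> \<noteq> 0" using \<rho> by auto
    show rr: "\<bar>Re \<xi>\<bar> \<le> r" using abs_Re_le_cmod[of "\<xi>0 - \<xi>"] dx re by simp
    then show p: "0 \<le> p \<xi>" "p \<xi> \<le> r" using r by (auto simp: p_def)
    have "cmod (\<xi>0 - 1) < cmod (\<xi> - 1) + r" using norm_triangle_ineq[of "\<xi> - 1" "\<xi>0 - \<xi>"] dx by simp
    then have o: "1 \<le> cmod (\<xi> - 1)" using rout by linarith
    show ret: "retract \<xi> = of_real (2 * p \<xi>) / cnj \<xi>"
    proof (cases "0 < Re \<xi>")
      case True
      then show ?thesis using retract_outside[OF o True] one_plus_unimodular[OF n0] by (simp add: p_def)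
    next
      case False
      then show ?thesis using retract_left[of \<xi>] by (simp add: p_def)
    qed
    have "cmod (retract \<xi>) = 2 * p \<xi> / cmod \<xi>" unfolding ret using p(1) by (simp add: norm_divide)
    also have "\<dots> \<le> 2 * r / (\<rho> / 2)" using h p \<rho> by (intro frac_le) auto
    also have "\<dots> = 4 * \<tau>" using \<rho> by (simp add: r_def)
    finally show t: "cmod (retract \<xi>) \<le> 4 * \<tau>" .
    then have "cmod (retract \<xi>) < dd" using \<tau>(3) dd(1) by linarith
    then show "retract \<xi> \<in> cball 1 1 \<inter> ball 0 dd" using retract_in_disc by auto
  qed
  have main: "\<xi>1 = \<xi>2" if \<xi>: "\<xi>1 \<in> ball \<xi>0 r" "\<xi>2 \<in> ball \<xi>0 r" "G \<xi>1 = G \<xi>2" "Re \<xi>2 \<le> Re \<xi>1" for \<xi>1 \<xi>2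
  proof -
    note f1 = facts[OF \<xi>(1)] and f2 = facts[OF \<xi>(2)]
    define \<eta>1 \<eta>2 p1 p2 where "\<eta>1 = retract \<xi>1" and "\<eta>2 = retract \<xi>2" and "p1 = p \<xi>1" and "p2 = p \<xi>2"
    define \<Delta> y u where "\<Delta> = \<xi>1 - \<xi>2" and "y = \<eta>1 - \<eta>2" and "u = p1 - p2"
    have u: "0 \<le> u" "u \<le> Re \<Delta>" using \<xi>(4) by (auto simp: u_def p1_def p2_def p_def \<Delta>_def)
    obtain \<delta> where \<delta>: "\<delta> \<in> dil_disc k" "cmod (\<gamma> \<eta>1 - \<gamma> \<eta>2 + \<gamma> 0 * \<delta> * y) \<le> e * cmod y"
      using dd(2)[OF f1(8) f2(8)] unfolding \<eta>1_def \<eta>2_def y_def by blast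
    have dl: "cmod \<delta> \<le> d" "q \<le> 1 + 2 * Re \<delta>" using dil_disc_bounds(1,3)[OF k \<delta>(1)] by (auto simp: d_def q_def)
    have c1: "cmod (1 / cnj \<xi>1) \<le> 2 / \<rho>" "cmod (1 / cnj \<xi>2) \<le> 2 / \<rho>"
      using f1(1,2) f2(1,2) \<rho> by (auto simp: norm_divide field_simps)
    define e2 where "e2 = of_real (2 * p2) * (cnj \<xi>2 - cnj \<xi>1) * (1 / cnj \<xi>1) * (1 / cnj \<xi>2)"
    have yeq: "y = of_real (2 * u) * (1 / cnj \<xi>1) + e2"
      unfolding y_def \<eta>1_def \<eta>2_def f1(6) f2(6) e2_def u_def p1_def p2_def using f1(2) f2(2) by (simp add: field_simps)
    have nc: "cmod (cnj \<xi>2 - cnj \<xi>1) = cmod \<Delta>" by (metis \<Delta>_def complex_cnj_diff complex_mod_cnj norm_minus_commute)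
    have e2: "cmod e2 \<le> 8 * \<tau> / \<rho> * cmod \<Delta>"
    proof -
      have "cmod e2 = 2 * p2 * cmod \<Delta> * cmod (1 / cnj \<xi>1) * cmod (1 / cnj \<xi>2)"
        unfolding e2_def norm_mult nc using f2(4) by (simp add: p2_def)
      also have "\<dots> \<le> 2 * r * cmod \<Delta> * (2 / \<rho>) * (2 / \<rho>)"
        using f2(4,5) c1 \<rho> r by (intro mult_mono) (auto simp: p2_def)
      also have "\<dots> = 8 * \<tau> / \<rho> * cmod \<Delta>" using \<rho> by (simp add: r_def field_simps)
      finally show ?thesis .
    qed
    have y: "cmod y \<le> 4 / \<rho> * (u + cmod \<Delta>)"
    proof -
      have "cmod y \<le> cmod (of_real (2 * u) * (1 / cnj \<xi>1)) + cmod e2" unfolding yeq by (rule norm_triangle_ineq)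
      also have "cmod (of_real (2 * u) * (1 / cnj \<xi>1)) \<le> 2 * u * (2 / \<rho>)"
        unfolding norm_mult using c1(1) u(1) by (intro mult_mono) auto
      also have "8 * \<tau> / \<rho> * cmod \<Delta> \<le> 4 / \<rho> * cmod \<Delta>" using \<tau>(2) \<rho> by (intro mult_right_mono divide_right_mono) auto
      then have "cmod e2 \<le> 4 / \<rho> * cmod \<Delta>" using e2 by linarith
      finally show ?thesis by (simp add: algebra_simps add_divide_distrib)
    qed
    define e3 where "e3 = \<xi>1 * y + 2 * of_real u"
    have e3: "cmod e3 \<le> 8 * \<tau> * (u + cmod \<Delta>)"
    proof -
      have x1: "1 + \<xi>1 / cnj \<xi>1 = of_real (2 * Re \<xi>1) * (1 / cnj \<xi>1)"
        using one_plus_unimodular[OF f1(2)] by simp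
      have "e3 = of_real (2 * u) * (1 + \<xi>1 / cnj \<xi>1) + \<xi>1 * e2" unfolding e3_def yeq by (simp add: algebra_simps)
      moreover have "\<xi>1 * e2 = of_real (2 * p2) * (cnj \<xi>2 - cnj \<xi>1) * (\<xi>1 / cnj \<xi>1) * (1 / cnj \<xi>2)"
        unfolding e2_def by simp
      ultimately have e3eq: "e3 = of_real (2 * u) * (of_real (2 * Re \<xi>1) * (1 / cnj \<xi>1)) + of_real (2 * p2) * (cnj \<xi>2 - cnj \<xi>1) * (\<xi>1 / cnj \<xi>1) * (1 / cnj \<xi>2)" unfolding x1 by (simp only:)
      have "cmod e3 \<le> cmod (of_real (2 * u) * (of_real (2 * Re \<xi>1) * (1 / cnj \<xi>1))) + cmod (of_real (2 * p2) * (cnj \<xi>2 - cnj \<xi>1) * (\<xi>1 / cnj \<xi>1) * (1 / cnj \<xi>2))"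
        unfolding e3eq by (rule norm_triangle_ineq)
      also have "cmod (of_real (2 * u) * (of_real (2 * Re \<xi>1) * (1 / cnj \<xi>1))) \<le> 2 * u * (2 * r * (2 / \<rho>))"
        unfolding norm_mult using c1(1) u(1) f1(3) r by (intro mult_mono) auto
      also have "cmod (of_real (2 * p2) * (cnj \<xi>2 - cnj \<xi>1) * (\<xi>1 / cnj \<xi>1) * (1 / cnj \<xi>2)) \<le> 2 * r * cmod \<Delta> * 1 * (2 / \<rho>)"
        unfolding norm_mult nc using c1(2) f2(4,5) r \<rho> f1(2) by (intro mult_mono) (auto simp: p2_def norm_divide)
      also have "2 * u * (2 * r * (2 / \<rho>)) + 2 * r * cmod \<Delta> * 1 * (2 / \<rho>) = 8 * \<tau> * u + 4 * \<tau> * cmod \<Delta>"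
        using \<rho> by (simp add: r_def field_simps)
      also have "\<dots> \<le> 8 * \<tau> * (u + cmod \<Delta>)" using \<tau>(1) by (simp add: algebra_simps)
      finally show ?thesis by simp
    qed
    define E where "E = (cap \<eta>1 - cap \<eta>2) - \<xi>1 * (\<gamma> \<eta>1 - \<gamma> \<eta>2 + \<gamma> 0 * \<delta> * y) - \<Delta> * (\<gamma> \<eta>2 - \<gamma> 0)"
    have "cap \<eta>1 - \<xi>1 * \<gamma> \<eta>1 = cap \<eta>2 - \<xi>2 * \<gamma> \<eta>2" using \<xi>(3) by (simp add: G_outer \<eta>1_def \<eta>2_def)
    then have "\<gamma> 0 * \<Delta> = \<gamma> 0 * (\<delta> * (\<xi>1 * y)) + E" unfolding E_def \<Delta>_def by (simp add: algebra_simps)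
    then have Deq: "\<Delta> = - 2 * \<delta> * of_real u + (\<delta> * e3 + E / \<gamma> 0)"
      using \<gamma>_nonzero[of 0] unfolding e3_def by (simp add: field_simps)
    have E: "cmod E \<le> (C2 * (4 * \<tau>) * (4 / \<rho>) + 8 * e + C1 * (4 * \<tau>)) * (u + cmod \<Delta>)"
    proof -
      have c: "\<eta>1 \<in> cball 1 1" "\<eta>2 \<in> cball 1 1" using retract_in_disc by (auto simp: \<eta>1_def \<eta>2_def)
      have "cmod (cap \<eta>1 - cap \<eta>2) \<le> C2 * max (cmod \<eta>1) (cmod \<eta>2) * cmod y" unfolding y_def by (rule K[OF c])
      also have "\<dots> \<le> C2 * (4 * \<tau>) * (4 / \<rho> * (u + cmod \<Delta>))"
        using C f1(7) f2(7) \<tau> y by (intro mult_mono) (auto simp: \<eta>1_def \<eta>2_def le_max_iff_disj)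
      finally have 1: "cmod (cap \<eta>1 - cap \<eta>2) \<le> C2 * (4 * \<tau>) * (4 / \<rho>) * (u + cmod \<Delta>)" by (simp add: mult_ac)
      have "cmod \<xi>1 \<le> \<rho> + r" using \<xi>(1) norm_triangle_ineq2[of \<xi>1 \<xi>0] by (simp add: \<rho>_def dist_norm norm_minus_commute)
      then have x2: "cmod \<xi>1 \<le> 2 * \<rho>" using r4 \<rho> by linarith
      have "cmod (\<xi>1 * (\<gamma> \<eta>1 - \<gamma> \<eta>2 + \<gamma> 0 * \<delta> * y)) \<le> 2 * \<rho> * (e * (4 / \<rho> * (u + cmod \<Delta>)))"
        unfolding norm_mult[of \<xi>1] using x2 \<delta>(2) y e \<rho> by (intro mult_mono order_trans[OF \<delta>(2)] mult_left_mono) auto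
      also have "2 * \<rho> * (e * (4 / \<rho> * (u + cmod \<Delta>))) = 8 * e * (u + cmod \<Delta>)" using \<rho> by simp
      finally have 2: "cmod (\<xi>1 * (\<gamma> \<eta>1 - \<gamma> \<eta>2 + \<gamma> 0 * \<delta> * y)) \<le> 8 * e * (u + cmod \<Delta>)" .
      have "cmod (\<gamma> \<eta>2 - \<gamma> 0) \<le> C1 * cmod \<eta>2" using lipschitz_onD[OF lip c(2), of 0] by (simp add: dist_norm)
      also have "\<dots> \<le> C1 * (4 * \<tau>)" using f2(7) C by (intro mult_left_mono) (auto simp: \<eta>2_def)
      finally have "cmod (\<Delta> * (\<gamma> \<eta>2 - \<gamma> 0)) \<le> (u + cmod \<Delta>) * (C1 * (4 * \<tau>))"
        unfolding norm_mult using u by (intro mult_mono) auto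
      then have 3: "cmod (\<Delta> * (\<gamma> \<eta>2 - \<gamma> 0)) \<le> C1 * (4 * \<tau>) * (u + cmod \<Delta>)" by (simp add: mult.commute)
      have "cmod E \<le> cmod (cap \<eta>1 - cap \<eta>2) + cmod (\<xi>1 * (\<gamma> \<eta>1 - \<gamma> \<eta>2 + \<gamma> 0 * \<delta> * y)) + cmod (\<Delta> * (\<gamma> \<eta>2 - \<gamma> 0))"
        unfolding E_def by (intro order_trans[OF norm_triangle_ineq4] add_mono order_refl norm_triangle_ineq4)
      then have "cmod E \<le> C2 * (4 * \<tau>) * (4 / \<rho>) * (u + cmod \<Delta>) + 8 * e * (u + cmod \<Delta>) + C1 * (4 * \<tau>) * (u + cmod \<Delta>)" using 1 2 3 by linarith
      then show ?thesis by (simp only: distrib_right)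
    qed
    have "cmod (\<delta> * e3 + E / \<gamma> 0) \<le> \<theta> * (u + cmod \<Delta>)"
    proof -
      have g0: "1 / cmod (\<gamma> 0) \<le> C0" using c0[of 0] C \<gamma>_nonzero[of 0] by (simp add: field_simps)
      define W where "W = u + cmod \<Delta>"
      have W: "W \<ge> 0" using u by (simp add: W_def)
      have "cmod (\<delta> * e3 + E / \<gamma> 0) \<le> cmod \<delta> * cmod e3 + cmod E * (1 / cmod (\<gamma> 0))"
        using norm_triangle_ineq[of "\<delta> * e3" "E / \<gamma> 0"] by (simp add: norm_mult norm_divide)
      also have "\<dots> \<le> d * (8 * \<tau> * W) + ((C2 * (4 * \<tau>) * (4 / \<rho>) + 8 * e + C1 * (4 * \<tau>)) * W) * C0"
        unfolding W_def using dl(1) d1 e3 E g0 C \<tau> \<rho> e u by (intro add_mono mult_mono) auto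
      also have "\<dots> = (\<tau> * D + 8 * e * C0) * W" by (simp add: D_def algebra_simps)
      also have "8 * e * C0 = \<theta> / 2" using C by (simp add: e_def)
      also have "(\<tau> * D + \<theta> / 2) * W \<le> (\<theta> / 2 + \<theta> / 2) * W"
        using mult_right_mono[OF \<tau>(4), of D] D W by (intro mult_right_mono add_right_mono) auto
      finally show ?thesis by (simp add: W_def)
    qed
    then have "\<Delta> = 0" using collapse_of_balance[OF Deq _ u dl _ \<theta>(2,3)] \<theta>(1) by simp
    then show ?thesis by (simp add: \<Delta>_def)
  qed
  have "inj_on G (ball \<xi>0 r)"
  proof (rule inj_onI)
    fix x y assume xy: "x \<in> ball \<xi>0 r" "y \<in> ball \<xi>0 r" "G x = G y"
    show "x = y"
    proof (cases "Re y \<le> Re x")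
      case True
      then show ?thesis using main xy by blast
    next
      case False
      then show ?thesis using main[of y x] xy by simp
    qed
  qed
  then show ?thesis using r by blast
qed

lemma locally_injective:
  assumes "\<xi>0 \<noteq> 0"
  shows "\<exists>r>0. inj_on G (ball \<xi>0 r)"
proof (cases "Re \<xi>0" "0::real" rule: linorder_cases)
  case less
  have "inj_on G (ball \<xi>0 (- Re \<xi>0))"
  proof (rule inj_onI)
    have l: "Re x < 0" if "x \<in> ball \<xi>0 (- Re \<xi>0)" for x
      using that abs_Re_le_cmod[of "\<xi>0 - x"] by (simp add: dist_norm)
    fix x y assume xy: "x \<in> ball \<xi>0 (- Re \<xi>0)" "y \<in> ball \<xi>0 (- Re \<xi>0)" "G x = G y"
    then have "x * \<gamma> 0 = y * \<gamma> 0" using l[of x] l[of y] by (simp add: G_def retract_left)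
    then show "x = y" using \<gamma>_nonzero[of 0] by simp
  qed
  then show ?thesis using less by (intro exI[of _ "- Re \<xi>0"]) auto
next
  case equal
  then show ?thesis using locally_injective_imaginary assms by simp
next
  case greater
  then show ?thesis using locally_injective_disc[of \<xi>0] locally_injective_right[of \<xi>0]
    by (cases "1 \<le> cmod (\<xi>0 - 1)") (auto simp: dist_norm norm_minus_commute)
qed

lemma inj_G: "inj G"
proof -
  obtain m R where mR: "m > 0" "R > 0" "\<And>\<xi>. R \<le> cmod \<xi> \<Longrightarrow> m * cmod \<xi> \<le> cmod (G \<xi>)" using G_lower by blast
  have proper: "bounded {\<xi>. cmod (G \<xi>) \<le> B}" for B
  proof (rule boundedI)
    fix \<xi> assume \<xi>: "\<xi> \<in> {\<xi>. cmod (G \<xi>) \<le> B}"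
    show "cmod \<xi> \<le> max R (B / m)"
    proof (cases "R \<le> cmod \<xi>")
      case True
      then have "m * cmod \<xi> \<le> B" using mR(3) \<xi> by force
      then show ?thesis using mR by (simp add: field_simps le_max_iff_disj)
    qed auto
  qed
  obtain R' where R': "R' > 0" "\<And>\<xi>. G \<xi> = H 0 + of_real R' * \<gamma> 0 \<Longrightarrow> \<xi> = - of_real R'" using unique_far_point by blast
  show ?thesis
  proof (rule proper_locally_injective_imp_injective[OF contG proper locally_injective])
    have "G 0 = H 0" by (simp add: G_def)
    then show "H 0 + of_real R' * \<gamma> 0 \<noteq> G 0" using R'(1) \<gamma>_nonzero by simp
    fix x y assume "G x = H 0 + of_real R' * \<gamma> 0" "G y = H 0 + of_real R' * \<gamma> 0"
    then have "x = - of_real R'" "y = - of_real R'" using R'(2) by blast+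
    then show "x = y" by simp
  qed
qed

text \<open>The circle parametrised by the slope \<open>Im \<xi> / Re \<xi>\<close> of the ray through the point.\<close>
definition circ :: "real \<Rightarrow> complex" where "circ \<tau> = 2 / (1 - \<i> * of_real \<tau>)"

lemma circ_denominator: "1 - \<i> * of_real \<tau> \<noteq> 0" "1 \<le> cmod (1 - \<i> * of_real \<tau>)"
proof -
  show "1 \<le> cmod (1 - \<i> * of_real \<tau>)" using abs_Re_le_cmod[of "1 - \<i> * of_real \<tau>"] by simp
  then show "1 - \<i> * of_real \<tau> \<noteq> 0" by auto
qed

lemma circ: "cmod (circ \<tau> - 1) = 1" "circ \<tau> \<in> cball 1 1" "circ \<tau> \<noteq> 0"
proof -
  have "circ \<tau> - 1 = cnj (1 - \<i> * of_real \<tau>) / (1 - \<i> * of_real \<tau>)"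
    using circ_denominator(1)[of \<tau>] by (simp add: circ_def field_simps)
  then show "cmod (circ \<tau> - 1) = 1" using circ_denominator(1)[of \<tau>] by (simp only: norm_divide complex_mod_cnj) simp
  then show "circ \<tau> \<in> cball 1 1" by (simp add: dist_norm norm_minus_commute)
  show "circ \<tau> \<noteq> 0" using circ_denominator(1)[of \<tau>] by (simp add: circ_def)
qed

lemma circ_Lipschitz: "2-lipschitz_on UNIV circ"
proof (rule lipschitz_onI)
  fix s t :: real
  let ?a = "1 - \<i> * of_real s" and ?b = "1 - \<i> * of_real t"
  have "circ s - circ t = 2 * \<i> * of_real (s - t) * (1 / ?a) * (1 / ?b)"
    using circ_denominator(1)[of s] circ_denominator(1)[of t] by (simp add: circ_def field_simps)
  then have "cmod (circ s - circ t) = 2 * \<bar>s - t\<bar> * cmod (1 / ?a) * cmod (1 / ?b)"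
    by (simp only: norm_mult norm_ii norm_of_real norm_numeral mult_1_right)
  also have "\<dots> \<le> 2 * \<bar>s - t\<bar> * 1 * 1"
    using circ_denominator(2)[of s] circ_denominator(2)[of t] by (intro mult_mono) (auto simp: norm_divide divide_le_eq)
  finally show "dist (circ s) (circ t) \<le> 2 * dist s t" by (simp add: dist_norm)
qed simp

lemma circ_derivative: "(circ has_vector_derivative (\<i> / 2 * (circ \<tau>)\<^sup>2)) (at \<tau>)"
proof -
  have "((\<lambda>t. 2 / (1 - \<i> * of_real t)) has_vector_derivative (2 * \<i> / (1 - \<i> * of_real \<tau>)\<^sup>2)) (at \<tau>)"
    by (rule has_vector_derivative_real_field)
       (use circ_denominator(1)[of \<tau>] in \<open>auto intro!: derivative_eq_intros simp: power2_eq_square\<close>)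
  moreover have "2 * \<i> / (1 - \<i> * of_real \<tau>)\<^sup>2 = \<i> / 2 * (circ \<tau>)\<^sup>2" by (simp add: circ_def power_divide)
  ultimately show ?thesis unfolding circ_def[abs_def] by (simp only: circ_def)
qed

text \<open>Where the boundary function has a derivative, the quotient by the derivative of \<open>circ\<close> is a limit of
difference quotients, and the speed disc is closed.\<close>
lemma boundary_speed:
  assumes D: "((\<lambda>t. \<phi> (circ t)) has_vector_derivative D) (at \<tau>)" and a: "a \<noteq> 0"
    and diff: "\<And>e. e > 0 \<Longrightarrow> \<exists>d>0. \<forall>\<eta>\<in>cball 1 1 \<inter> ball (circ \<tau>) d.
       \<exists>u\<in>speed_disc k (circ \<tau>). cmod (\<phi> \<eta> - \<phi> (circ \<tau>) - a * u * (\<eta> - circ \<tau>)) \<le> e * cmod (\<eta> - circ \<tau>)"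
  shows "\<exists>u\<in>speed_disc k (circ \<tau>). D = a * u * (\<i> / 2 * (circ \<tau>)\<^sup>2)"
proof -
  define T where "T = \<i> / 2 * (circ \<tau>)\<^sup>2"
  have T: "T \<noteq> 0" using circ(3) by (simp add: T_def)
  define w where "w = D / (a * T)"
  have inj: "circ t \<noteq> circ \<tau>" if "t \<noteq> \<tau>" for t
    using that circ_denominator(1)[of t] circ_denominator(1)[of \<tau>] by (auto simp: circ_def field_simps)
  have quot: "((\<lambda>t. (\<psi> t - \<psi> \<tau>) / of_real (t - \<tau>)) \<longlongrightarrow> D') (at \<tau>)"
    if "(\<psi> has_vector_derivative D') (at \<tau>)" for \<psi> :: "real \<Rightarrow> complex" and D'
  proof -
    have 0: "((\<lambda>t. (\<psi> t - \<psi> \<tau> - (t - \<tau>) *\<^sub>R D') /\<^sub>R norm (t - \<tau>)) \<longlongrightarrow> 0) (at \<tau>)"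
      using that unfolding has_vector_derivative_def has_derivative_at_within by simp
    have "((\<lambda>t. (\<psi> t - \<psi> \<tau>) / of_real (t - \<tau>) - D') \<longlongrightarrow> 0) (at \<tau>)"
    proof (rule Lim_null_comparison[OF _ tendsto_norm_zero[OF 0]])
      show "eventually (\<lambda>t. norm ((\<psi> t - \<psi> \<tau>) / of_real (t - \<tau>) - D') \<le> norm ((\<psi> t - \<psi> \<tau> - (t - \<tau>) *\<^sub>R D') /\<^sub>R norm (t - \<tau>))) (at \<tau>)"
        unfolding eventually_at_filter
      proof (intro always_eventually allI impI)
        fix t assume t: "t \<noteq> \<tau>"
        then have nz: "complex_of_real (t - \<tau>) \<noteq> 0" by (simp only: of_real_eq_0_iff)
        have "(\<psi> t - \<psi> \<tau>) / of_real (t - \<tau>) - D' = (\<psi> t - \<psi> \<tau> - (t - \<tau>) *\<^sub>R D') / of_real (t - \<tau>)"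
          using nz by (simp add: scaleR_conv_of_real diff_divide_distrib del: of_real_diff)
        then show "norm ((\<psi> t - \<psi> \<tau>) / of_real (t - \<tau>) - D') \<le> norm ((\<psi> t - \<psi> \<tau> - (t - \<tau>) *\<^sub>R D') /\<^sub>R norm (t - \<tau>))"
          by (simp add: norm_divide norm_mult norm_inverse divide_inverse mult.commute del: of_real_diff)
      qed
    qed
    then show ?thesis by (simp add: LIM_zero_iff del: of_real_diff)
  qed
  have lim: "((\<lambda>t. (\<phi> (circ t) - \<phi> (circ \<tau>)) / (circ t - circ \<tau>) / a) \<longlongrightarrow> D / T / a) (at \<tau>)"
  proof (rule tendsto_divide[OF _ tendsto_const a])
    have "((\<lambda>t. ((\<phi> (circ t) - \<phi> (circ \<tau>)) / of_real (t - \<tau>)) / ((circ t - circ \<tau>) / of_real (t - \<tau>))) \<longlongrightarrow> D / T) (at \<tau>)"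
      by (rule tendsto_divide[OF quot[OF D] quot[OF circ_derivative[of \<tau>, folded T_def]] T])
    moreover have "eventually (\<lambda>t. ((\<phi> (circ t) - \<phi> (circ \<tau>)) / of_real (t - \<tau>)) / ((circ t - circ \<tau>) / of_real (t - \<tau>)) = (\<phi> (circ t) - \<phi> (circ \<tau>)) / (circ t - circ \<tau>)) (at \<tau>)"
      unfolding eventually_at_filter by (intro always_eventually) (auto simp del: of_real_diff)
    ultimately show "((\<lambda>t. (\<phi> (circ t) - \<phi> (circ \<tau>)) / (circ t - circ \<tau>)) \<longlongrightarrow> D / T) (at \<tau>)"
      by (rule Lim_transform_eventually)
  qed
  have "w \<in> closure (speed_disc k (circ \<tau>))"
    unfolding closure_approachable
  proof (intro allI impI)
    fix \<epsilon> :: real assume \<epsilon>: "\<epsilon> > 0"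
    define e where "e = cmod a * (\<epsilon> / 3)"
    have e: "e > 0" using a \<epsilon> by (simp add: e_def)
    obtain d where d: "d > 0" "\<And>\<eta>. \<eta> \<in> cball 1 1 \<inter> ball (circ \<tau>) d \<Longrightarrow>
       \<exists>u\<in>speed_disc k (circ \<tau>). cmod (\<phi> \<eta> - \<phi> (circ \<tau>) - a * u * (\<eta> - circ \<tau>)) \<le> e * cmod (\<eta> - circ \<tau>)"
      using diff[OF e] by blast
    have "eventually (\<lambda>t. dist ((\<phi> (circ t) - \<phi> (circ \<tau>)) / (circ t - circ \<tau>) / a) (D / T / a) < \<epsilon> / 3) (at \<tau>)"
      using tendstoD[OF lim, of "\<epsilon> / 3"] \<epsilon> by simp
    moreover have "eventually (\<lambda>t. dist (circ t) (circ \<tau>) < d) (at \<tau>)"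
    proof -
      have "isCont circ \<tau>" using lipschitz_on_continuous_on[OF circ_Lipschitz] by (simp add: continuous_on_eq_continuous_at)
      then show ?thesis using d(1) by (simp add: isCont_def tendsto_iff)
    qed
    moreover have "eventually (\<lambda>t. t \<noteq> \<tau>) (at \<tau>)" by (simp add: eventually_at_filter)
    ultimately have "eventually (\<lambda>t. dist ((\<phi> (circ t) - \<phi> (circ \<tau>)) / (circ t - circ \<tau>) / a) (D / T / a) < \<epsilon> / 3 \<and>
        dist (circ t) (circ \<tau>) < d \<and> t \<noteq> \<tau>) (at \<tau>)"
      by eventually_elim auto
    then obtain t where t: "dist ((\<phi> (circ t) - \<phi> (circ \<tau>)) / (circ t - circ \<tau>) / a) (D / T / a) < \<epsilon> / 3"
      "dist (circ t) (circ \<tau>) < d" "t \<noteq> \<tau>" using eventually_happens[of _ "at \<tau>"] by auto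
    define y where "y = circ t - circ \<tau>"
    have y: "y \<noteq> 0" using inj[OF t(3)] by (simp add: y_def)
    define Q where "Q = (\<phi> (circ t) - \<phi> (circ \<tau>)) / y / a"
    have "circ t \<in> cball 1 1 \<inter> ball (circ \<tau>) d" using circ(2) t(2) by (simp add: dist_commute)
    from d(2)[OF this] obtain u where u: "u \<in> speed_disc k (circ \<tau>)" "cmod (\<phi> (circ t) - \<phi> (circ \<tau>) - a * u * y) \<le> e * cmod y"
      unfolding y_def by blast
    have "\<phi> (circ t) - \<phi> (circ \<tau>) - a * u * y = a * y * (Q - u)" using a y by (simp add: Q_def field_simps)
    then have "(cmod a * cmod y) * cmod (Q - u) \<le> (cmod a * cmod y) * (\<epsilon> / 3)" using u(2) by (simp add: norm_mult e_def mult_ac)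
    then have "cmod (Q - u) \<le> \<epsilon> / 3" using a y by (subst (asm) mult_le_cancel_left_pos) auto
    moreover have "dist Q w < \<epsilon> / 3" using t(1) by (simp add: Q_def y_def w_def mult.commute)
    ultimately have "dist u w < \<epsilon>" using dist_triangle[of u w Q] \<epsilon> by (simp add: dist_norm norm_minus_commute)
    then show "\<exists>u\<in>speed_disc k (circ \<tau>). dist u w < \<epsilon>" using u(1) by blast
  qed
  then have "w \<in> speed_disc k (circ \<tau>)" by (simp add: speed_disc_eq_cball[OF k circ(2)])
  then show ?thesis using a T unfolding T_def[symmetric] by (intro bexI[of _ w]) (auto simp: w_def)
qed

text \<open>Write \<open>\<xi> = s \<eta>\<close> and let \<open>v\<close> be the convex combination of the boundary speeds of \<open>H\<close> and \<open>g\<close>. The product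
rule gives \<open>A = - \<gamma> + \<gamma> (1 - v) / cnj \<eta>\<close> and \<open>B = - \<gamma> (1 - v) \<eta> / (cnj \<eta>)\<^sup>2\<close>. On the circle \<open>1 - \<eta>\<close> is unimodular,
so \<open>\<bar>B\<bar> \<le> k \<bar>A\<bar>\<close> is the inequality that defines \<open>speed_disc k \<eta>\<close>.\<close>
lemma G_derivative_outer:
  assumes re: "0 < Re \<xi>" and out: "1 < cmod (\<xi> - 1)"
    and dK: "(\<lambda>t. cap (circ t)) differentiable (at (Im \<xi> / Re \<xi>))" and dg: "(\<lambda>t. \<gamma> (circ t)) differentiable (at (Im \<xi> / Re \<xi>))"
  shows "\<exists>A B. (G has_derivative (\<lambda>x. A * x + B * cnj x)) (at \<xi>) \<and> cmod B \<le> k * cmod A"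
proof -
  define \<tau> \<eta> \<rho> where "\<tau> = Im \<xi> / Re \<xi>" and "\<eta> = circ \<tau>" and "\<rho> = Re \<xi>"
  define T where "T = \<i> / 2 * \<eta>\<^sup>2"
  obtain \<kappa> g' where \<kappa>: "((\<lambda>t. cap (circ t)) has_vector_derivative \<kappa>) (at \<tau>)" and g': "((\<lambda>t. \<gamma> (circ t)) has_vector_derivative g') (at \<tau>)"
    using dK dg unfolding \<tau>_def by (meson vector_derivative_works)
  note \<eta>p = circ[of \<tau>, folded \<eta>_def]
  have \<rho>: "\<rho> > 0" using re by (simp add: \<rho>_def)
  have \<xi>0: "\<xi> \<noteq> 0" using re by auto
  have ret: "retract x = circ (Im x / Re x)" if "0 < Re x" "1 < cmod (x - 1)" for x
  proof -
    have x0: "x \<noteq> 0" using that by auto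
    have "cnj x = of_real (Re x) * (1 - \<i> * of_real (Im x / Re x))" using that by (simp add: complex_eq_iff)
    then have "of_real (2 * Re x) / cnj x = circ (Im x / Re x)" using that by (simp add: circ_def)
    then show ?thesis using retract_outside[of x] one_plus_unimodular[OF x0] that by simp
  qed
  have Dg: "((\<lambda>t. g (circ t)) has_vector_derivative (T * \<gamma> \<eta> + \<eta> * g')) (at \<tau>)"
    unfolding g_def using has_vector_derivative_mult[OF circ_derivative g'] by (simp add: \<eta>_def T_def add.commute)
  have DH: "((\<lambda>t. H (circ t)) has_vector_derivative (\<kappa> - (T * \<gamma> \<eta> + \<eta> * g'))) (at \<tau>)"
    using has_vector_derivative_diff[OF \<kappa> Dg] by (simp add: cap_def)
  have "\<exists>u\<in>speed_disc k (circ \<tau>). \<kappa> - (T * \<gamma> \<eta> + \<eta> * g') = - \<gamma> \<eta> * u * (\<i> / 2 * (circ \<tau>)\<^sup>2)"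
  proof (rule boundary_speed[OF DH])
    fix e :: real assume e: "e > 0"
    obtain d where d: "d > 0" "\<And>\<eta>1 \<eta>2. \<eta>1 \<in> cball 1 1 \<inter> ball (circ \<tau>) d \<Longrightarrow> \<eta>2 \<in> cball 1 1 \<inter> ball (circ \<tau>) d \<Longrightarrow>
     \<exists>u\<in>speed_disc k (circ \<tau>). cmod (H \<eta>1 - H \<eta>2 + \<gamma> (circ \<tau>) * u * (\<eta>1 - \<eta>2)) \<le> e * cmod (\<eta>1 - \<eta>2)"
      using H_increment[OF circ(2) e] by blast
    have "circ \<tau> \<in> cball 1 1 \<inter> ball (circ \<tau>) d" using circ(2) d(1) by simp
    from d(2)[OF _ this] d(1) show "\<exists>d>0. \<forall>\<eta>'\<in>cball 1 1 \<inter> ball (circ \<tau>) d.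
       \<exists>u\<in>speed_disc k (circ \<tau>). cmod (H \<eta>' - H (circ \<tau>) - - \<gamma> \<eta> * u * (\<eta>' - circ \<tau>)) \<le> e * cmod (\<eta>' - circ \<tau>)"
      by (auto simp: \<eta>_def intro!: exI[of _ d])
  qed (simp add: \<gamma>_nonzero)
  then obtain u where u: "u \<in> speed_disc k \<eta>" "\<kappa> - (T * \<gamma> \<eta> + \<eta> * g') = - \<gamma> \<eta> * u * T" by (auto simp: \<eta>_def T_def)
  have "\<exists>u\<in>speed_disc k (circ \<tau>). T * \<gamma> \<eta> + \<eta> * g' = \<gamma> \<eta> * u * (\<i> / 2 * (circ \<tau>)\<^sup>2)"
  proof (rule boundary_speed[OF Dg])
    fix e :: real assume e: "e > 0"
    obtain d where d: "d > 0" "\<And>\<eta>1 \<eta>2. \<eta>1 \<in> cball 1 1 \<inter> ball (circ \<tau>) d \<Longrightarrow> \<eta>2 \<in> cball 1 1 \<inter> ball (circ \<tau>) d \<Longrightarrow>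
     \<exists>u\<in>speed_disc k (circ \<tau>). cmod (g \<eta>1 - g \<eta>2 - \<gamma> (circ \<tau>) * u * (\<eta>1 - \<eta>2)) \<le> e * cmod (\<eta>1 - \<eta>2)"
      using g_increment[OF circ(2) e] by blast
    have "circ \<tau> \<in> cball 1 1 \<inter> ball (circ \<tau>) d" using circ(2) d(1) by simp
    from d(2)[OF _ this] d(1) show "\<exists>d>0. \<forall>\<eta>'\<in>cball 1 1 \<inter> ball (circ \<tau>) d.
       \<exists>u\<in>speed_disc k (circ \<tau>). cmod (g \<eta>' - g (circ \<tau>) - \<gamma> \<eta> * u * (\<eta>' - circ \<tau>)) \<le> e * cmod (\<eta>' - circ \<tau>)"
      by (auto simp: \<eta>_def intro!: exI[of _ d])
  qed (simp add: \<gamma>_nonzero)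
  then obtain w where w: "w \<in> speed_disc k \<eta>" "T * \<gamma> \<eta> + \<eta> * g' = \<gamma> \<eta> * w * T" by (auto simp: \<eta>_def T_def)
  have ret\<xi>: "retract \<xi> = \<eta>" using ret[OF re out] by (simp add: \<eta>_def \<tau>_def)
  define s where "s = stretch \<xi>"
  have s: "\<xi> = of_real s * \<eta>" "1 \<le> s" using stretch_retract(1,2)[OF re] by (auto simp: s_def ret\<xi>)
  define v where "v = (1 / s) *\<^sub>R u + ((s - 1) / s) *\<^sub>R w"
  have v: "v \<in> speed_disc k \<eta>"
    using u(1) w(1) s(2) unfolding speed_disc_eq_cball[OF k \<eta>p(2)] v_def
    by (intro convexD[OF convex_cball]) (auto simp: field_simps)
  have vs: "of_real s * v = u + of_real (s - 1) * w"
    unfolding v_def using s(2) by (simp add: scaleR_conv_of_real field_simps)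
  have c: "\<kappa> - \<xi> * g' = \<gamma> \<eta> * (1 - v) * (of_real s * T)"
  proof -
    have "\<xi> * g' = of_real s * (\<eta> * g')" unfolding s(1) by simp
    also have "\<eta> * g' = \<gamma> \<eta> * w * T - T * \<gamma> \<eta>" unfolding w(2)[symmetric] by simp
    finally have xg: "\<xi> * g' = of_real s * (\<gamma> \<eta> * w * T - T * \<gamma> \<eta>)" .
    have "\<kappa> = (\<kappa> - (T * \<gamma> \<eta> + \<eta> * g')) + (T * \<gamma> \<eta> + \<eta> * g')" by simp
    also have "\<dots> = \<gamma> \<eta> * w * T - \<gamma> \<eta> * u * T" unfolding u(2) unfolding w(2) by simp
    finally have "\<kappa> - \<xi> * g' = (\<gamma> \<eta> * w * T - \<gamma> \<eta> * u * T) - of_real s * (\<gamma> \<eta> * w * T - T * \<gamma> \<eta>)"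
      unfolding xg by (simp only:)
    also have "\<dots> = \<gamma> \<eta> * T * (of_real s - (u + of_real (s - 1) * w))" by (simp add: algebra_simps)
    also have "\<dots> = \<gamma> \<eta> * (1 - v) * (of_real s * T)" unfolding vs[symmetric] by (simp add: algebra_simps)
    finally show ?thesis .
  qed
  define A B where "A = - \<gamma> \<eta> + \<gamma> \<eta> * (1 - v) / cnj \<eta>" and "B = - \<gamma> \<eta> * (1 - v) * \<eta> / (cnj \<eta>)\<^sup>2"
  define d\<tau> where "d\<tau> x = (Im x * Re \<xi> - Im \<xi> * Re x) / (Re \<xi> * Re \<xi>)" for x
  have d\<tau>: "((\<lambda>x. Im x / Re x) has_derivative d\<tau>) (at \<xi>)"
    unfolding d\<tau>_def using re by (auto intro!: derivative_eq_intros simp: field_simps)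
  have comp: "((\<lambda>x. \<psi> (Im x / Re x)) has_derivative (\<lambda>x. d\<tau> x *\<^sub>R D)) (at \<xi>)"
    if "(\<psi> has_vector_derivative D) (at \<tau>)" for \<psi> :: "real \<Rightarrow> complex" and D
  proof -
    have "(\<psi> has_derivative (\<lambda>x. x *\<^sub>R D)) (at (Im \<xi> / Re \<xi>))" using that by (simp add: has_vector_derivative_def \<tau>_def)
    from has_derivative_compose[OF d\<tau> this] show ?thesis .
  qed
  have "((\<lambda>x. cap (circ (Im x / Re x)) - x * \<gamma> (circ (Im x / Re x))) has_derivative
      (\<lambda>x. d\<tau> x *\<^sub>R \<kappa> - (\<xi> * (d\<tau> x *\<^sub>R g') + x * \<gamma> \<eta>))) (at \<xi>)"
    using has_derivative_diff[OF comp[OF \<kappa>] has_derivative_mult[OF has_derivative_ident comp[OF g']]] by (simp add: \<eta>_def \<tau>_def)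
  moreover have "d\<tau> x *\<^sub>R \<kappa> - (\<xi> * (d\<tau> x *\<^sub>R g') + x * \<gamma> \<eta>) = A * x + B * cnj x" for x
  proof -
    have key: "of_real (d\<tau> x) * (of_real s * T) = x / cnj \<eta> - cnj x * \<eta> / (cnj \<eta>)\<^sup>2"
    proof -
      have s0: "s \<noteq> 0" using s(2) by auto
      have \<eta>2: "\<eta> + cnj \<eta> = \<eta> * cnj \<eta>"
      proof -
        have "(cmod (\<eta> - 1))\<^sup>2 = 1" using \<eta>p(1) by simp
        then show ?thesis unfolding cmod_power2 by (auto simp: complex_eq_iff power2_eq_square algebra_simps)
      qed
      have re\<xi>: "of_real (Re \<xi>) = of_real s * (\<eta> * cnj \<eta>) / 2"
      proof -
        have "2 * of_real (Re \<xi>) = \<xi> + cnj \<xi>" by (simp add: complex_add_cnj)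
        also have "\<dots> = of_real s * (\<eta> + cnj \<eta>)" by (subst (1 2) s(1)) (simp add: algebra_simps)
        finally have "2 * complex_of_real (Re \<xi>) = of_real s * (\<eta> * cnj \<eta>)" unfolding \<eta>2 .
        moreover have "complex_of_real (Re \<xi>) = 2 * complex_of_real (Re \<xi>) / 2" by simp
        ultimately show ?thesis by (simp only:)
      qed
      have num: "of_real (Im x * Re \<xi> - Im \<xi> * Re x) = of_real s * (x * cnj \<eta> - cnj x * \<eta>) / (2 * \<i>)"
      proof -
        have "of_real (Im x * Re \<xi> - Im \<xi> * Re x) = (x * cnj \<xi> - cnj x * \<xi>) / (2 * \<i>)"
          by (auto simp: complex_eq_iff Re_divide Im_divide power2_eq_square algebra_simps)
        also have "x * cnj \<xi> - cnj x * \<xi> = of_real s * (x * cnj \<eta> - cnj x * \<eta>)" by (subst (1 2) s(1)) (simp add: algebra_simps)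
        finally show ?thesis .
      qed
      have "of_real (d\<tau> x) = (of_real s * (x * cnj \<eta> - cnj x * \<eta>) / (2 * \<i>)) / ((of_real s * (\<eta> * cnj \<eta>) / 2) * (of_real s * (\<eta> * cnj \<eta>) / 2))"
        unfolding d\<tau>_def of_real_divide num of_real_mult[of "Re \<xi>"] re\<xi> ..
      then have "of_real (d\<tau> x) * (of_real s * T) = (of_real s * (x * cnj \<eta> - cnj x * \<eta>) / (2 * \<i>)) / ((of_real s * (\<eta> * cnj \<eta>) / 2) * (of_real s * (\<eta> * cnj \<eta>) / 2)) * (of_real s * (\<i> / 2 * \<eta>\<^sup>2))"
        by (simp only: T_def)
      also have "\<dots> = (x * cnj \<eta> - cnj x * \<eta>) / (cnj \<eta>)\<^sup>2"
        using s0 \<eta>p(3) by (simp add: power2_eq_square field_simps)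
      also have "\<dots> = x / cnj \<eta> - cnj x * \<eta> / (cnj \<eta>)\<^sup>2" using \<eta>p(3) by (simp add: power2_eq_square field_simps)
      finally show ?thesis .
    qed
    have "d\<tau> x *\<^sub>R \<kappa> - (\<xi> * (d\<tau> x *\<^sub>R g') + x * \<gamma> \<eta>) = of_real (d\<tau> x) * (\<kappa> - \<xi> * g') - x * \<gamma> \<eta>"
      by (simp add: scaleR_conv_of_real algebra_simps)
    also have "of_real (d\<tau> x) * (\<kappa> - \<xi> * g') = \<gamma> \<eta> * (1 - v) * (of_real (d\<tau> x) * (of_real s * T))" unfolding c by (simp add: mult_ac)
    also have "\<dots> = \<gamma> \<eta> * (1 - v) * (x / cnj \<eta> - cnj x * \<eta> / (cnj \<eta>)\<^sup>2)" unfolding key ..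
    also have "\<gamma> \<eta> * (1 - v) * (x / cnj \<eta> - cnj x * \<eta> / (cnj \<eta>)\<^sup>2) - x * \<gamma> \<eta> = A * x + B * cnj x"
      unfolding A_def B_def by (simp add: algebra_simps add_divide_distrib diff_divide_distrib)
    finally show ?thesis .
  qed
  ultimately have "((\<lambda>x. cap (circ (Im x / Re x)) - x * \<gamma> (circ (Im x / Re x))) has_derivative (\<lambda>x. A * x + B * cnj x)) (at \<xi>)"
    by simp
  moreover have "open {x. 0 < Re x \<and> 1 < cmod (x - 1)}"
    by (intro open_Collect_conj open_Collect_less continuous_intros)
  ultimately have "(G has_derivative (\<lambda>x. A * x + B * cnj x)) (at \<xi>)"
    by (rule has_derivative_transform_within_open) (use re out ret in \<open>auto simp: G_outer\<close>)
  moreover have "cmod B \<le> k * cmod A"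
  proof -
    have b1: "(1 - \<eta>) * cnj (1 - \<eta>) = 1" using \<eta>p(1) complex_norm_square[of "1 - \<eta>"] by (simp add: norm_minus_commute)
    have "cmod (1 - (1 - \<eta>) * v) = cmod (cnj (1 - \<eta>)) * cmod (1 - (1 - \<eta>) * v)" using \<eta>p(1) by (simp add: norm_minus_commute flip: complex_cnj_diff)
    also have "\<dots> = cmod (cnj (1 - \<eta>) * (1 - (1 - \<eta>) * v))" by (rule norm_mult[symmetric])
    also have "cnj (1 - \<eta>) * (1 - (1 - \<eta>) * v) = cnj (1 - \<eta>) - ((1 - \<eta>) * cnj (1 - \<eta>)) * v" by (simp add: algebra_simps)
    also have "\<dots> = (1 - v) - cnj \<eta>" unfolding b1 by simp
    finally have m: "cmod (1 - v) \<le> k * cmod ((1 - v) - cnj \<eta>)" using v by (simp add: speed_disc_def)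
    have "A = \<gamma> \<eta> * ((1 - v) - cnj \<eta>) / cnj \<eta>" using \<eta>p(3) by (simp add: A_def field_simps)
    then have Ac: "cmod A = (cmod (\<gamma> \<eta>) / cmod \<eta>) * cmod ((1 - v) - cnj \<eta>)" by (simp add: norm_mult norm_divide)
    have Bc: "cmod B = (cmod (\<gamma> \<eta>) / cmod \<eta>) * cmod (1 - v)"
      using \<eta>p(3) by (simp add: B_def norm_mult norm_divide norm_power power2_eq_square)
    show ?thesis unfolding Ac Bc using mult_left_mono[OF m, of "cmod (\<gamma> \<eta>) / cmod \<eta>"] by (simp add: mult.left_commute)
  qed
  ultimately show ?thesis by blast
qed

lemma beltrami_AE:
  obtains N where "negligible N"
    "\<And>\<xi>. \<xi> \<notin> N \<Longrightarrow> \<exists>A B. (G has_derivative (\<lambda>x. A * x + B * cnj x)) (at \<xi>) \<and> cmod B \<le> k * cmod A"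
proof -
  obtain C1 where C: "C1 > 0" and lip: "C1-lipschitz_on (cball 1 1) \<gamma>" "C1-lipschitz_on (cball 1 1) cap"
    using bounds by metis
  have lc: "(C1 * 2)-lipschitz_on UNIV (\<lambda>t. \<phi> (circ t))" if "C1-lipschitz_on (cball 1 1) \<phi>" for \<phi> :: "complex \<Rightarrow> complex"
    by (rule lipschitz_on_compose2[OF circ_Lipschitz lipschitz_on_subset[OF that]]) (use circ(2) in auto)
  \<comment> \<open>Bad slopes are null on the line, hence the rays with these slopes are null in the plane.\<close>
  define N1 where "N1 = {t. \<not> (\<lambda>t. \<gamma> (circ t)) differentiable (at t)} \<union> {t. \<not> (\<lambda>t. cap (circ t)) differentiable (at t)}"
  have "negligible N1" unfolding N1_def
    using Lipschitz_differentiable_AE[OF lc[OF lip(1)]] Lipschitz_differentiable_AE[OF lc[OF lip(2)]] by (rule negligible_Un)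
  then have "negligible {z::complex. Im z \<in> N1}" by (rule negligible_Im_vimage)
  then have "negligible ((\<lambda>z. of_real (Re z) * (1 + \<i> * of_real (Im z))) ` {z::complex. Im z \<in> N1})"
  proof (rule negligible_differentiable_image_negligible[rotated])
    have "((\<lambda>z. of_real (Re z) * (1 + \<i> * of_real (Im z))) has_derivative
       (\<lambda>x. of_real (Re z) * (\<i> * of_real (Im x)) + of_real (Re x) * (1 + \<i> * of_real (Im z)))) (at z within S)" for z S
      by (auto intro!: derivative_eq_intros)
    then show "(\<lambda>z. of_real (Re z) * (1 + \<i> * of_real (Im z))) differentiable_on {z::complex. Im z \<in> N1}"
      unfolding differentiable_on_def differentiable_def by blast
  qed simp
  then have rays: "negligible {\<xi>. 0 < Re \<xi> \<and> Im \<xi> / Re \<xi> \<in> N1}"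
  proof (rule negligible_subset)
    show "{\<xi>. 0 < Re \<xi> \<and> Im \<xi> / Re \<xi> \<in> N1} \<subseteq> (\<lambda>z. of_real (Re z) * (1 + \<i> * of_real (Im z))) ` {z::complex. Im z \<in> N1}"
    proof
      fix \<xi> assume "\<xi> \<in> {\<xi>. 0 < Re \<xi> \<and> Im \<xi> / Re \<xi> \<in> N1}"
      then show "\<xi> \<in> (\<lambda>z. of_real (Re z) * (1 + \<i> * of_real (Im z))) ` {z::complex. Im z \<in> N1}"
        by (intro image_eqI[of _ _ "Complex (Re \<xi>) (Im \<xi> / Re \<xi>)"]) (auto simp: complex_eq_iff)
    qed
  qed
  have line: "negligible {\<xi>::complex. Re \<xi> = 0}"
    using negligible_hyperplane[of "1::complex" 0] by (simp add: inner_complex_def)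
  define N where "N = sphere 1 1 \<union> ({\<xi>. Re \<xi> = 0} \<union> {\<xi>. 0 < Re \<xi> \<and> Im \<xi> / Re \<xi> \<in> N1})"
  have "negligible N" unfolding N_def by (intro negligible_Un rays line negligible_sphere)
  moreover have "\<exists>A B. (G has_derivative (\<lambda>x. A * x + B * cnj x)) (at \<xi>) \<and> cmod B \<le> k * cmod A" if \<xi>: "\<xi> \<notin> N" for \<xi>
  proof -
    consider "\<xi> \<in> ball 1 1" | "Re \<xi> < 0" | "0 < Re \<xi>" "1 < cmod (\<xi> - 1)"
      using \<xi> by (fastforce simp: N_def dist_norm norm_minus_commute)
    then show ?thesis
    proof cases
      case 1
      have "(H has_derivative (\<lambda>x. (- exp (l \<xi>) / (1 + \<beta> \<xi> * \<xi>)) * x)) (at \<xi>)"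
        using derH[OF 1] by (simp only: has_field_derivative_def)
      then have "(G has_derivative (\<lambda>x. (- exp (l \<xi>) / (1 + \<beta> \<xi> * \<xi>)) * x)) (at \<xi>)"
        by (rule has_derivative_transform_within_open[OF _ open_ball 1]) (simp add: G_def)
      then show ?thesis using k by (intro exI[of _ "- exp (l \<xi>) / (1 + \<beta> \<xi> * \<xi>)"] exI[of _ 0]) simp
    next
      case 2
      have "((\<lambda>\<xi>. H 0 - \<xi> * \<gamma> 0) has_derivative (\<lambda>x. - \<gamma> 0 * x)) (at \<xi>)"
        by (auto intro!: derivative_eq_intros)
      moreover have "open {x. Re x < 0}" by (intro open_Collect_less continuous_intros)
      ultimately have "(G has_derivative (\<lambda>x. - \<gamma> 0 * x)) (at \<xi>)"
        by (rule has_derivative_transform_within_open) (use 2 in \<open>auto simp: G_def retract_left\<close>)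
      then show ?thesis using k by (intro exI[of _ "- \<gamma> 0"] exI[of _ 0]) simp
    next
      case 3
      then have "Im \<xi> / Re \<xi> \<notin> N1" using \<xi> by (auto simp: N_def)
      then show ?thesis using G_derivative_outer[OF 3] by (simp add: N1_def)
    qed
  qed
  ultimately show thesis by (rule that)
qed

end

section \<open>From the two conditions to the extension\<close>

text \<open>The hyperbolic disc is \<open>\<bar>w - c\<bar> \<le> k \<bar>w + cnj c\<bar>\<close>; divide by \<open>2 Re c = c + cnj c\<close>.\<close>
lemma hyp_cball_imp_dil_disc:
  assumes k: "0 \<le> k" "k < 1" and c: "c \<in> right_half_plane"
    and w: "w \<in> hyp_cball c (1/2 * ln ((1 + k) / (1 - k)))"
  shows "(w - c) / of_real (2 * Re c) \<in> dil_disc k"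
proof -
  have re: "0 < Re w" "0 < Re c" using w c by (auto simp: hyp_cball_def right_half_plane_def)
  define \<rho> where "\<rho> = cmod ((w - c) / (w + cnj c))"
  have "(cmod (w - c))\<^sup>2 < (cmod (w + cnj c))\<^sup>2"
    unfolding cmod_power2 using re mult_pos_pos[OF re] by (simp add: power2_eq_square algebra_simps)
  then have lt: "cmod (w - c) < cmod (w + cnj c)" by (rule power_less_imp_less_base) simp
  then have p: "0 < cmod (w + cnj c)" using norm_ge_zero[of "w - c"] by linarith
  have \<rho>: "0 \<le> \<rho>" "\<rho> < 1" using lt p by (auto simp: \<rho>_def norm_divide divide_less_eq)
  have "1/2 * ln ((1 + \<rho>) / (1 - \<rho>)) \<le> 1/2 * ln ((1 + k) / (1 - k))"
    using w by (simp add: hyp_cball_def hyp_dist_def \<rho>_def Let_def)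
  then have "ln ((1 + \<rho>) / (1 - \<rho>)) \<le> ln ((1 + k) / (1 - k))" by simp
  then have "(1 + \<rho>) / (1 - \<rho>) \<le> (1 + k) / (1 - k)" using \<rho> k by (subst (asm) ln_le_cancel_iff) auto
  then have "\<rho> \<le> k" using \<rho> k by (simp add: divide_simps algebra_simps)
  then have m: "cmod (w - c) \<le> k * cmod (w + cnj c)" using p by (simp add: \<rho>_def norm_divide divide_le_eq)
  define \<kappa> where "\<kappa> = 2 * Re c"
  have \<kappa>: "\<kappa> > 0" using re by (simp add: \<kappa>_def)
  have "c + cnj c = of_real \<kappa>" by (simp add: \<kappa>_def complex_add_cnj)
  then have "1 + (w - c) / of_real \<kappa> = (w + cnj c) / of_real \<kappa>" using \<kappa> by (simp add: field_simps)
  then have "cmod (1 + (w - c) / of_real \<kappa>) = cmod (w + cnj c) / \<kappa>" using \<kappa> by (simp add: norm_divide)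
  moreover have "cmod ((w - c) / of_real \<kappa>) = cmod (w - c) / \<kappa>" using \<kappa> by (simp add: norm_divide)
  ultimately show ?thesis using m \<kappa> unfolding \<kappa>_def[symmetric] dil_disc_def by (simp add: divide_right_mono)
qed

lemma unit_disc_at_1_iff: "\<eta> \<noteq> 0 \<Longrightarrow> \<eta> \<in> ball 1 1 \<longleftrightarrow> 1 / 2 < Re (1 / \<eta>)" for \<eta> :: complex
proof -
  assume \<eta>: "\<eta> \<noteq> 0"
  then have pos: "0 < (cmod \<eta>)\<^sup>2" by simp
  have "\<eta> \<in> ball 1 1 \<longleftrightarrow> (cmod (\<eta> - 1))\<^sup>2 < 1" by (simp add: dist_norm norm_minus_commute abs_square_less_1)
  also have "\<dots> \<longleftrightarrow> (cmod \<eta>)\<^sup>2 < 2 * Re \<eta>" unfolding cmod_power2 by (auto simp: power2_eq_square algebra_simps)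
  also have "\<dots> \<longleftrightarrow> 1 / 2 < Re \<eta> / (cmod \<eta>)\<^sup>2" using pos by (auto simp: field_simps)
  also have "Re \<eta> / (cmod \<eta>)\<^sup>2 = Re (1 / \<eta>)" by (simp add: Re_divide cmod_power2)
  finally show ?thesis .
qed

text \<open>With \<open>z = \<kappa> / \<eta> - c\<close>, a point \<open>z + a\<close> with \<open>a \<in> D\<close> equals \<open>(\<kappa> / \<eta>) (1 + \<delta> \<eta>)\<close> with \<open>\<delta> = (a - c) / \<kappa>\<close>. This turns the
two conditions into the logarithmic derivative of \<open>1 / (\<eta> f(z))\<close> and the derivative of \<open>h(z)\<close>. The values
\<open>f\<close>, \<open>f'\<close>, \<open>h'\<close> do not vanish, as otherwise the quotient in question would be \<open>0\<close> and \<open>- z\<close> would lie in \<open>D\<close>.\<close>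
lemma radial_extension_of_conditions:
  fixes k :: real and h f :: "complex \<Rightarrow> complex" and c :: complex and D :: "complex set"
  assumes k: "0 \<le> k" "k < 1"
    and h: "h holomorphic_on right_half_plane"
    and c: "c \<in> right_half_plane"
    and D: "D = hyp_cball c (1/2 * ln ((1 + k) / (1 - k)))"
    and f: "f holomorphic_on right_half_plane"
    and A: "\<forall>z \<in> right_half_plane. f z / deriv f z - z \<in> D"
    and B: "\<forall>z \<in> right_half_plane. inverse (deriv h z * f z) - z \<in> D"
  obtains H l \<alpha> \<beta> where "radial_extension k H l \<alpha> \<beta>"
    "\<And>\<eta>. \<eta> \<in> ball 1 1 \<Longrightarrow> H \<eta> = h (of_real (2 * Re c) / \<eta> - c)"
proof -
  define \<kappa> where "\<kappa> = 2 * Re c"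
  have \<kappa>: "\<kappa> > 0" using c by (simp add: \<kappa>_def right_half_plane_def)
  have rhp: "open right_half_plane" unfolding right_half_plane_def by (intro open_Collect_less continuous_intros)
  define z where "z \<eta> = of_real \<kappa> / \<eta> - c" for \<eta> :: complex
  have \<eta>0: "\<eta> \<noteq> 0" if "\<eta> \<in> ball 1 1" for \<eta> :: complex using that by auto
  have z: "z \<eta> \<in> right_half_plane" if "\<eta> \<in> ball 1 1" for \<eta>
  proof -
    have "1 / 2 < Re (1 / \<eta>)" using unit_disc_at_1_iff[OF \<eta>0[OF that]] that by simp
    then have "\<kappa> * (1 / 2) < \<kappa> * Re (1 / \<eta>)" using \<kappa> by (intro mult_strict_left_mono)
    moreover have "Re (of_real \<kappa> / \<eta>) = \<kappa> * Re (1 / \<eta>)"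
    proof -
      have "of_real \<kappa> / \<eta> = of_real \<kappa> * (1 / \<eta>)" by simp
      then show ?thesis by (simp only: times_complex.sel Re_complex_of_real Im_complex_of_real mult_zero_left diff_zero)
    qed
    ultimately show ?thesis by (simp add: z_def right_half_plane_def \<kappa>_def)
  qed
  have dz: "(z has_field_derivative - of_real \<kappa> / \<eta>\<^sup>2) (at \<eta>)" if "\<eta> \<in> ball 1 1" for \<eta>
    unfolding z_def[abs_def] using \<eta>0[OF that] by (auto intro!: derivative_eq_intros simp: power2_eq_square)
  define \<alpha> where "\<alpha> \<eta> = (f (z \<eta>) / deriv f (z \<eta>) - z \<eta> - c) / of_real \<kappa>" for \<eta>
  define \<beta> where "\<beta> \<eta> = (inverse (deriv h (z \<eta>) * f (z \<eta>)) - z \<eta> - c) / of_real \<kappa>" for \<eta>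
  have \<alpha>: "\<alpha> \<eta> \<in> dil_disc k" and \<beta>: "\<beta> \<eta> \<in> dil_disc k" if "\<eta> \<in> ball 1 1" for \<eta>
    using hyp_cball_imp_dil_disc[OF k c] A B z[OF that] unfolding D \<alpha>_def \<beta>_def \<kappa>_def by blast+
  have D0: "- w \<notin> D" if "w \<in> right_half_plane" for w
    using that by (auto simp: D hyp_cball_def right_half_plane_def)
  have nz: "f w \<noteq> 0" "deriv f w \<noteq> 0" "deriv h w \<noteq> 0" if w: "w \<in> right_half_plane" for w
  proof -
    have "f w / deriv f w - w \<in> D" "inverse (deriv h w * f w) - w \<in> D" using A B w by auto
    then show "f w \<noteq> 0" "deriv f w \<noteq> 0" "deriv h w \<noteq> 0" using D0[OF w] by auto
  qed
  define \<gamma> where "\<gamma> \<eta> = 1 / (\<eta> * f (z \<eta>))" for \<eta>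
  have df: "((\<lambda>\<eta>. f (z \<eta>)) has_field_derivative deriv f (z \<eta>) * (- of_real \<kappa> / \<eta>\<^sup>2)) (at \<eta>)" if "\<eta> \<in> ball 1 1" for \<eta>
    using DERIV_chain2[OF holomorphic_derivI[OF f rhp z[OF that]] dz[OF that]] .
  have dh: "((\<lambda>\<eta>. h (z \<eta>)) has_field_derivative deriv h (z \<eta>) * (- of_real \<kappa> / \<eta>\<^sup>2)) (at \<eta>)" if "\<eta> \<in> ball 1 1" for \<eta>
    using DERIV_chain2[OF holomorphic_derivI[OF h rhp z[OF that]] dz[OF that]] .
  have one_plus: "of_real \<kappa> * (1 + \<alpha> \<eta> * \<eta>) = \<eta> * (f (z \<eta>) / deriv f (z \<eta>))"
     "of_real \<kappa> * (1 + \<beta> \<eta> * \<eta>) = \<eta> * inverse (deriv h (z \<eta>) * f (z \<eta>))" if "\<eta> \<in> ball 1 1" for \<eta>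
  proof -
    have gen: "of_real \<kappa> * (1 + (X - z \<eta> - c) / of_real \<kappa> * \<eta>) = \<eta> * X" for X
      using \<kappa> \<eta>0[OF that] unfolding z_def by (simp add: field_simps)
    show "of_real \<kappa> * (1 + \<alpha> \<eta> * \<eta>) = \<eta> * (f (z \<eta>) / deriv f (z \<eta>))" unfolding \<alpha>_def by (rule gen)
    show "of_real \<kappa> * (1 + \<beta> \<eta> * \<eta>) = \<eta> * inverse (deriv h (z \<eta>) * f (z \<eta>))" unfolding \<beta>_def by (rule gen)
  qed
  have d\<gamma>: "(\<gamma> has_field_derivative \<gamma> \<eta> * (- \<alpha> \<eta> / (1 + \<alpha> \<eta> * \<eta>))) (at \<eta>)" if \<eta>: "\<eta> \<in> ball 1 1" for \<eta>
  proof -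
    note n = nz[OF z[OF \<eta>]] \<eta>0[OF \<eta>]
    have o: "1 + \<alpha> \<eta> * \<eta> \<noteq> 0" using one_plus_dil_bound(2)[OF k \<alpha>[OF \<eta>], of \<eta>] \<eta> by simp
    have "(\<gamma> has_field_derivative - (f (z \<eta>) + deriv f (z \<eta>) * (- of_real \<kappa> / \<eta>\<^sup>2) * \<eta>) / ((\<eta> * f (z \<eta>)) * (\<eta> * f (z \<eta>)))) (at \<eta>)"
      unfolding \<gamma>_def[abs_def] using n by (auto intro!: derivative_eq_intros df[OF \<eta>])
    also have "- (f (z \<eta>) + deriv f (z \<eta>) * (- of_real \<kappa> / \<eta>\<^sup>2) * \<eta>) / ((\<eta> * f (z \<eta>)) * (\<eta> * f (z \<eta>)))
       = \<gamma> \<eta> * (1 / \<eta>) * (of_real \<kappa> * deriv f (z \<eta>) / (\<eta> * f (z \<eta>)) - 1)"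
      using n unfolding \<gamma>_def by (simp add: power2_eq_square field_simps)
    also have "of_real \<kappa> * deriv f (z \<eta>) / (\<eta> * f (z \<eta>)) = 1 / (1 + \<alpha> \<eta> * \<eta>)"
      using one_plus(1)[OF \<eta>] n o by (simp add: field_simps)
    also have "\<gamma> \<eta> * (1 / \<eta>) * (1 / (1 + \<alpha> \<eta> * \<eta>) - 1) = \<gamma> \<eta> * (- \<alpha> \<eta> / (1 + \<alpha> \<eta> * \<eta>))"
      using n o by (simp add: field_simps)
    finally show ?thesis .
  qed
  have \<gamma>0: "\<gamma> \<eta> \<noteq> 0" if "\<eta> \<in> ball 1 1" for \<eta> using nz(1)[OF z[OF that]] \<eta>0[OF that] by (simp add: \<gamma>_def)
  have "\<gamma> holomorphic_on ball 1 1" unfolding holomorphic_on_open[OF open_ball] using d\<gamma> by blast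
  then obtain l0 where l0: "l0 holomorphic_on ball 1 1" "\<And>\<eta>. \<eta> \<in> ball 1 1 \<Longrightarrow> \<gamma> \<eta> = exp (l0 \<eta>)"
    using contractible_imp_holomorphic_log[of \<gamma> "ball 1 1"] \<gamma>0 convex_imp_contractible[OF convex_ball] by metis
  have dl0: "(l0 has_field_derivative - \<alpha> \<eta> / (1 + \<alpha> \<eta> * \<eta>)) (at \<eta>)" if \<eta>: "\<eta> \<in> ball 1 1" for \<eta>
  proof -
    have d: "(l0 has_field_derivative deriv l0 \<eta>) (at \<eta>)" using holomorphic_derivI[OF l0(1) open_ball \<eta>] .
    then have "((\<lambda>\<eta>. exp (l0 \<eta>)) has_field_derivative exp (l0 \<eta>) * deriv l0 \<eta>) (at \<eta>)"
      by (auto intro!: derivative_eq_intros)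
    then have "(\<gamma> has_field_derivative exp (l0 \<eta>) * deriv l0 \<eta>) (at \<eta>)"
      by (rule has_field_derivative_transform_within_open[OF _ open_ball \<eta>]) (simp add: l0(2))
    then have "exp (l0 \<eta>) * deriv l0 \<eta> = \<gamma> \<eta> * (- \<alpha> \<eta> / (1 + \<alpha> \<eta> * \<eta>))" using d\<gamma>[OF \<eta>] DERIV_unique by blast
    then have "deriv l0 \<eta> = - \<alpha> \<eta> / (1 + \<alpha> \<eta> * \<eta>)" unfolding l0(2)[OF \<eta>] by (simp only: mult_cancel_left exp_not_eq_zero) simp
    then show ?thesis using d by simp
  qed
  define q where "q = 2 / (1 - k)"
  have q: "q > 0" using k by (simp add: q_def)
  have inv: "cmod (1 / (1 + \<delta> * \<eta>)) \<le> q" if "\<delta> \<in> dil_disc k" "\<eta> \<in> cball 1 1" for \<delta> \<eta>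
    unfolding q_def by (rule speed_disc_bounds(2)[OF k speed_in_disc[OF k that] that(2)])
  have lip_ball: "C-lipschitz_on (ball 1 1) \<phi>"
    if "C \<ge> 0" "\<And>\<eta>. \<eta> \<in> ball 1 1 \<Longrightarrow> (\<phi> has_field_derivative \<phi>' \<eta>) (at \<eta>)" "\<And>\<eta>. \<eta> \<in> ball 1 1 \<Longrightarrow> cmod (\<phi>' \<eta>) \<le> C"
    for \<phi> \<phi>' :: "complex \<Rightarrow> complex" and C
  proof (rule lipschitz_onI)
    fix x y :: complex assume "x \<in> ball 1 1" "y \<in> ball 1 1"
    then have "norm (\<phi> x - \<phi> y) \<le> C * norm (x - y)"
      using that(3) has_field_derivative_at_within[OF that(2)]
      by (intro field_differentiable_bound[where S="ball 1 1" and f'=\<phi>']) auto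
    then show "dist (\<phi> x) (\<phi> y) \<le> C * dist x y" by (simp add: dist_norm)
  qed (rule that)
  have "(q * q)-lipschitz_on (ball 1 1) l0"
  proof (rule lip_ball[OF _ dl0])
    fix \<eta> :: complex assume \<eta>: "\<eta> \<in> ball 1 1"
    have "1 / (1 - k) \<le> q" using k unfolding q_def by (intro divide_right_mono) auto
    with dil_disc_bounds(1)[OF k \<alpha>[OF \<eta>]] have "cmod (\<alpha> \<eta>) \<le> q" by (rule order_trans)
    then have "cmod (\<alpha> \<eta>) * cmod (1 / (1 + \<alpha> \<eta> * \<eta>)) \<le> q * q" using inv[OF \<alpha>[OF \<eta>]] \<eta> q by (intro mult_mono) auto
    then show "cmod (- \<alpha> \<eta> / (1 + \<alpha> \<eta> * \<eta>)) \<le> q * q" by (simp add: norm_divide)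
  qed (use q in simp)
  then obtain l where l: "(q * q)-lipschitz_on (closure (ball 1 1)) l" "\<And>x. x \<in> ball 1 1 \<Longrightarrow> l x = l0 x"
    using lipschitz_extend_closure by blast
  have contl: "continuous_on (cball 1 1) l" using lipschitz_on_continuous_on[OF l(1)] by simp
  obtain C0 where C0: "C0 \<ge> 0" "\<And>\<eta>. \<eta> \<in> cball 1 1 \<Longrightarrow> cmod (exp (l \<eta>)) \<le> C0"
    by (rule continuous_on_compact_bound[of "cball 1 1" "\<lambda>\<eta>. exp (l \<eta>)"]) (auto intro!: continuous_intros contl)
  have dh0: "((\<lambda>\<eta>. h (z \<eta>)) has_field_derivative - exp (l \<eta>) / (1 + \<beta> \<eta> * \<eta>)) (at \<eta>)" if \<eta>: "\<eta> \<in> ball 1 1" for \<eta>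
  proof -
    note n = nz[OF z[OF \<eta>]] \<eta>0[OF \<eta>]
    have o: "1 + \<beta> \<eta> * \<eta> \<noteq> 0" using one_plus_dil_bound(2)[OF k \<beta>[OF \<eta>], of \<eta>] \<eta> by simp
    have "exp (l \<eta>) = 1 / (\<eta> * f (z \<eta>))" using l0(2)[OF \<eta>] l(2)[OF \<eta>] by (simp add: \<gamma>_def)
    moreover have "deriv h (z \<eta>) * (- of_real \<kappa> / \<eta>\<^sup>2) = - (1 / (\<eta> * f (z \<eta>))) / (1 + \<beta> \<eta> * \<eta>)"
    proof -
      have e: "of_real \<kappa> * (1 + \<beta> \<eta> * \<eta>) * (deriv h (z \<eta>) * f (z \<eta>)) = \<eta>"
      proof -
        have nz': "deriv h (z \<eta>) * f (z \<eta>) \<noteq> 0" using n by simp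
        show ?thesis unfolding one_plus(2)[OF \<eta>] mult.assoc[of \<eta>] left_inverse[OF nz'] by (rule mult_1_right)
      qed
      have "deriv h (z \<eta>) * (of_real \<kappa> / \<eta>\<^sup>2) * ((1 + \<beta> \<eta> * \<eta>) * (\<eta> * f (z \<eta>))) = (of_real \<kappa> * (1 + \<beta> \<eta> * \<eta>) * (deriv h (z \<eta>) * f (z \<eta>))) / \<eta>"
        using n by (simp add: power2_eq_square)
      also have "\<dots> = 1" unfolding e using n by simp
      finally have "deriv h (z \<eta>) * (of_real \<kappa> / \<eta>\<^sup>2) = 1 / ((1 + \<beta> \<eta> * \<eta>) * (\<eta> * f (z \<eta>)))"
        using n o by (simp add: eq_divide_eq)
      then show ?thesis by (simp add: mult.commute)
    qed
    ultimately show ?thesis using dh[OF \<eta>] by simp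
  qed
  have "(C0 * q)-lipschitz_on (ball 1 1) (\<lambda>\<eta>. h (z \<eta>))"
  proof (rule lip_ball[OF _ dh0])
    fix \<eta> :: complex assume \<eta>: "\<eta> \<in> ball 1 1"
    have "cmod (exp (l \<eta>)) * cmod (1 / (1 + \<beta> \<eta> * \<eta>)) \<le> C0 * q" using inv[OF \<beta>[OF \<eta>]] C0 \<eta> by (intro mult_mono) auto
    then show "cmod (- exp (l \<eta>) / (1 + \<beta> \<eta> * \<eta>)) \<le> C0 * q" by (simp add: norm_divide)
  qed (use q C0 in simp)
  then obtain H where H: "(C0 * q)-lipschitz_on (closure (ball 1 1)) H" "\<And>x. x \<in> ball 1 1 \<Longrightarrow> H x = h (z x)"
    using lipschitz_extend_closure[of "C0 * q" "ball 1 1" "\<lambda>\<eta>. h (z \<eta>)"] by blast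
  have "radial_extension k H l \<alpha> \<beta>"
  proof
    show "continuous_on (cball 1 1) H" using lipschitz_on_continuous_on[OF H(1)] by simp
    fix \<eta> :: complex assume \<eta>: "\<eta> \<in> ball 1 1"
    show "(l has_field_derivative - \<alpha> \<eta> / (1 + \<alpha> \<eta> * \<eta>)) (at \<eta>)"
      by (rule has_field_derivative_transform_within_open[OF dl0[OF \<eta>] open_ball \<eta>]) (simp add: l(2))
    show "(H has_field_derivative - exp (l \<eta>) / (1 + \<beta> \<eta> * \<eta>)) (at \<eta>)"
      by (rule has_field_derivative_transform_within_open[OF dh0[OF \<eta>] open_ball \<eta>]) (simp add: H(2))
  qed (use k contl \<alpha> \<beta> in auto)
  then show thesis by (rule that) (simp add: H(2) z_def \<kappa>_def)
qed

lemma (in radial_extension) qc_plane_map_scaled: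
  assumes \<kappa>: "\<kappa> > 0"
  obtains M m R N S where "qc_plane_map (\<lambda>\<xi>. G (of_real \<kappa> * \<xi>)) k M m R N S"
proof -
  obtain M where M: "M-lipschitz_on UNIV G" using G_Lipschitz by blast
  obtain m R where mR: "m > 0" "R > 0" "\<And>\<xi>. R \<le> cmod \<xi> \<Longrightarrow> m * cmod \<xi> \<le> cmod (G \<xi>)" using G_lower by blast
  obtain N where N: "negligible N"
    "\<And>\<xi>. \<xi> \<notin> N \<Longrightarrow> \<exists>A B. (G has_derivative (\<lambda>x. A * x + B * cnj x)) (at \<xi>) \<and> cmod B \<le> k * cmod A"
    using beltrami_AE by blast
  let ?s = "\<lambda>\<xi>::complex. of_real \<kappa> * \<xi>"
  have \<kappa>0: "complex_of_real \<kappa> \<noteq> 0" using \<kappa> by simp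
  have "qc_plane_map (\<lambda>\<xi>. G (?s \<xi>)) k (M * \<kappa>) (m * \<kappa>) (R / \<kappa>) {\<xi> \<in> UNIV. ?s \<xi> \<in> N} (?s -` ball 1 1)"
  proof
    show "inj (\<lambda>\<xi>. G (?s \<xi>))"
    proof (rule injI)
      fix x y assume "G (?s x) = G (?s y)"
      then have "?s x = ?s y" by (rule injD[OF inj_G])
      then show "x = y" using \<kappa>0 by simp
    qed
    show "(M * \<kappa>)-lipschitz_on UNIV (\<lambda>\<xi>. G (?s \<xi>))"
    proof (rule lipschitz_onI)
      fix x y
      have "dist (?s x) (?s y) = \<kappa> * dist x y" using \<kappa> by (simp add: dist_norm right_diff_distrib[symmetric] norm_mult)
      then show "dist (G (?s x)) (G (?s y)) \<le> M * \<kappa> * dist x y" using lipschitz_onD[OF M, of "?s x" "?s y"] by simp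
    qed (use lipschitz_on_nonneg[OF M] \<kappa> in simp)
    show "0 < m * \<kappa>" "0 < R / \<kappa>" using mR \<kappa> by auto
    show "m * \<kappa> * norm \<xi> \<le> norm (G (?s \<xi>))" if "R / \<kappa> \<le> norm \<xi>" for \<xi>
      using mR(3)[of "?s \<xi>"] that \<kappa> by (simp add: norm_mult field_simps)
    have dS: "(?s has_derivative (\<lambda>x. of_real \<kappa> * x)) (at \<xi> within T)" for \<xi> T by (auto intro!: derivative_eq_intros)
    show "negligible {\<xi> \<in> UNIV. ?s \<xi> \<in> N}"
      by (rule negligible_differentiable_vimage[OF N(1) _ dS]) (use \<kappa>0 in \<open>auto simp: inj_def\<close>)
    fix \<xi> assume "\<xi> \<notin> {\<xi> \<in> UNIV. ?s \<xi> \<in> N}"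
    then obtain A B where AB: "(G has_derivative (\<lambda>x. A * x + B * cnj x)) (at (?s \<xi>))" "cmod B \<le> k * cmod A" using N(2) by blast
    have "((\<lambda>\<xi>. G (?s \<xi>)) has_derivative (\<lambda>x. A * (of_real \<kappa> * x) + B * cnj (of_real \<kappa> * x))) (at \<xi>)"
      by (rule has_derivative_compose[OF dS AB(1)])
    moreover have "cmod (B * of_real \<kappa>) \<le> k * cmod (A * of_real \<kappa>)"
      using mult_right_mono[OF AB(2), of \<kappa>] \<kappa> by (simp add: norm_mult)
    ultimately show "\<exists>A B. ((\<lambda>\<xi>. G (?s \<xi>)) has_derivative (\<lambda>x. A * x + B * cnj x)) (at \<xi>) \<and> cmod B \<le> k * cmod A"
      by (intro exI[of _ "A * of_real \<kappa>"] exI[of _ "B * of_real \<kappa>"]) (simp add: mult.assoc)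
  next
    show "open (?s -` ball 1 1)" by (intro open_vimage continuous_intros) auto
    have "1 / of_real \<kappa> \<in> ?s -` ball 1 1" using \<kappa>0 by simp
    then show "?s -` ball 1 1 \<noteq> {}" by blast
    fix \<xi> assume "\<xi> \<in> ?s -` ball 1 1"
    then have \<xi>: "?s \<xi> \<in> ball 1 1" by simp
    define A where "A = - exp (l (?s \<xi>)) / (1 + \<beta> (?s \<xi>) * ?s \<xi>)"
    have "(H has_field_derivative A) (at (?s \<xi>))" unfolding A_def using derH[OF \<xi>] .
    then have dG: "(G has_field_derivative A) (at (?s \<xi>))"
      by (rule has_field_derivative_transform_within_open[OF _ open_ball \<xi>]) (simp add: G_def)
    have ds: "(?s has_field_derivative of_real \<kappa>) (at \<xi>)" by (auto intro!: derivative_eq_intros)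
    have "((\<lambda>\<xi>. G (?s \<xi>)) has_field_derivative A * of_real \<kappa>) (at \<xi>)" by (rule DERIV_chain2[OF dG ds])
    moreover have "A * of_real \<kappa> \<noteq> 0"
      using one_plus_dil_bound(2)[OF k \<beta>[OF \<xi>] ball_cball[OF \<xi>]] \<kappa>0 by (simp add: A_def)
    ultimately show "\<exists>A. A \<noteq> 0 \<and> ((\<lambda>\<xi>. G (?s \<xi>)) has_field_derivative A) (at \<xi>)" by blast
  qed
  then show thesis by (rule that)
qed

theorem theorem5p15:
  fixes k :: real and h f :: "complex \<Rightarrow> complex" and c :: complex and D :: "complex set"
  assumes "0 \<le> k" and "k < 1"
    and "h holomorphic_on right_half_plane"
    and "c \<in> right_half_plane"
    and "D = hyp_cball c (1/2 * ln ((1 + k) / (1 - k)))"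
    and "f holomorphic_on right_half_plane"
    and "\<forall>z \<in> right_half_plane. f z / deriv f z - z \<in> D"
    and "\<forall>z \<in> right_half_plane. inverse (deriv h z * f z) - z \<in> D"
  shows "inj_on h right_half_plane \<and> has_quasiconformal_extension k h"
proof -
  obtain H l \<alpha> \<beta> where ext: "radial_extension k H l \<alpha> \<beta>"
    and H: "\<And>\<eta>. \<eta> \<in> ball 1 1 \<Longrightarrow> H \<eta> = h (of_real (2 * Re c) / \<eta> - c)"
    using radial_extension_of_conditions[OF assms] by blast
  interpret radial_extension k H l \<alpha> \<beta> by (rule ext)
  define \<kappa> where "\<kappa> = 2 * Re c"
  have \<kappa>: "\<kappa> > 0" using assms(4) by (simp add: \<kappa>_def right_half_plane_def)
  obtain M m R N S where q: "qc_plane_map (\<lambda>\<xi>. G (of_real \<kappa> * \<xi>)) k M m R N S"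
    using qc_plane_map_scaled[OF \<kappa>] by blast
  define F where "F = map_option (\<lambda>\<xi>. G (of_real \<kappa> * \<xi>)) \<circ> sphere_inv \<circ> map_option (\<lambda>w. w + c)"
  have c0: "c \<noteq> 0" using assms(4) by (auto simp: right_half_plane_def)
  have qF: "quasiconformal_sphere k F"
    unfolding F_def by (rule qc_plane_map.quasiconformal_sphere[OF q c0])
  have val: "G (of_real \<kappa> * (1 / (z + c))) = h z" "z + c \<noteq> 0" if "z \<in> right_half_plane" for z
  proof -
    have re: "0 < Re z" "0 < Re c" using that assms(4) by (auto simp: right_half_plane_def)
    show nz: "z + c \<noteq> 0"
    proof
      assume "z + c = 0"
      then have "Re z + Re c = 0" by (metis plus_complex.sel(1) zero_complex.sel(1))
      then show False using re by simp
    qed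
    define \<eta> where "\<eta> = of_real \<kappa> * (1 / (z + c))"
    have \<eta>0: "\<eta> \<noteq> 0" using nz \<kappa> by (simp add: \<eta>_def)
    have "1 / \<eta> = (z + c) / of_real \<kappa>" using nz by (simp add: \<eta>_def)
    then have "Re (1 / \<eta>) = (Re z + Re c) / \<kappa>" by simp
    then have "1 / 2 < Re (1 / \<eta>)" using re \<kappa> by (simp add: \<kappa>_def less_divide_eq)
    then have \<eta>: "\<eta> \<in> ball 1 1" using unit_disc_at_1_iff[OF \<eta>0] by simp
    have "of_real (2 * Re c) / \<eta> - c = z" using nz \<kappa> unfolding \<kappa>_def[symmetric] by (simp add: \<eta>_def)
    then show "G (of_real \<kappa> * (1 / (z + c))) = h z" using H[OF \<eta>] \<eta> unfolding \<eta>_def[symmetric] by (simp add: G_def)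
  qed
  have "inj_on h right_half_plane"
  proof (rule inj_onI)
    fix x y assume xy: "x \<in> right_half_plane" "y \<in> right_half_plane" "h x = h y"
    then have "of_real \<kappa> * (1 / (x + c)) = of_real \<kappa> * (1 / (y + c))" using val(1) injD[OF inj_G] by metis
    then show "x = y" using \<kappa> val(2)[OF xy(1)] val(2)[OF xy(2)] by simp
  qed
  moreover have "F (Some z) = Some (h z)" if "z \<in> right_half_plane" for z
    using val[OF that] by (simp add: F_def sphere_inv_def)
  ultimately show ?thesis unfolding has_quasiconformal_extension_def using qF by blast
qed

end
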